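(* Let $0<\lambda<\sqrt2$ and, for $f\in W^{2,2}(\mathbb{R}^d,\mathbb{R})\setminus\{0\}$, let $\mu_f=\mu_f^{(d)}$ be the (symmetric and positive definite matrix-valued) solution of the implicit equation $$\mu_f^2(x)=\frac{\lambda^2\mu_f^2(x)}{2}+\frac{\big(\nabla f\,\nabla f^{\intercal}-f\,D^2f\big)\ast G^2_{(\lambda\mu_f)^{-2}(x)}}{2\,f^2\ast G^2_{(\lambda\mu_f)^{-2}(x)}}(x)\qquad(x\in\mathbb{R}^d).$$ Then the assignment $f\mapsto\mu_f^{(d)}$ fulfills the Adaptation Axioms (A1)–(A4).
   Context: For symmetric positive definite $\Sigma\in\mathrm{GL}(d,\mathbb{R})$, $G_\Sigma(x)=(2\pi)^{-d/2}|\det\Sigma|^{-1/2}\exp\big[-\tfrac12x^{\intercal}\Sigma^{-1}x\big]$, and $G_\Sigma^2$ is its pointwise square. In the equation, for each fixed $x$ the matrix $\Sigma=(\lambda\mu_f(x))^{-2}$ is fixed, the ordinary convolutions (entrywise for matrix-valued functions) are formed with $G_\Sigma^2$, and the quotient is evaluated at $x$. $\nabla f\,\nabla f^{\intercal}$ is the $d\times d$ matrix of products of first partial derivatives and $D^2f$ is the Hessian. Standing assumption: every function $f$ considered (including all the translates, multiples, rescalings, sums $f^{(t)}$ and summands $f_k$ occurring in the axioms) is a nonzero element of $W^{2,2}(\mathbb{R}^d,\mathbb{R})$ for which the implicit equation has a unique symmetric and positive definite solution $\mu_f$, and for which the fixed point iteration $$\mu_f^{(n+1)}(x)=\sqrt{\frac{(\lambda\mu_f^{(n)})^2(x)}{2}+\frac{\big(\nabla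 f\,\nabla f^{\intercal}-f\,D^2f\big)\ast G^2_{(\lambda\mu_f^{(n)})^{-2}(x)}}{2\,f^2\ast G^2_{(\lambda\mu_f^{(n)})^{-2}(x)}}(x)}$$ converges to that solution for every symmetric and positive definite initial choice $\mu_f^{(0)}$ (the square root being the unique symmetric positive definite one). Adaptation Axioms for an assignment $f\mapsto\mu_f$ of measurable functions $\mu_f\colon\mathbb{R}^d\to\mathrm{GL}(d,\mathbb{R})$: for any $f\in W^{2,2}(\mathbb{R}^d,\mathbb{R})$, $a\in\mathbb{R}^d$, $\alpha\in\mathbb{R}\setminus\{0\}$, $A\in\mathrm{GL}(d,\mathbb{R})$, any parametrized function $f^{(t)}=\sum_{k=1}^Kf_k(\cdot-a_k^{(t)})$, $t\ge0$, with $f_k\in W^{2,2}(\mathbb{R}^d,\mathbb{R})$, $a_k^{(t)}\in\mathbb{R}^d$, such that $\|a_k^{(t)}-a_j^{(t)}\|\xrightarrow{t\to\infty}\infty$ for all $k\neq j$, and any $x\in\mathbb{R}^d$: - (A1) $\mu_{f(\cdot-a)}(x)=\mu_f(x-a)$; - (A2) $\mu_{\alpha f}=\mu_f$; - (A3) $\mu_{f(A\,\cdot)}^{\intercal}(x)\,\mu_{f(A\,\cdot)}(x)=A^{\intercal}\,\mu_f^{\intercal}(Ax)\,\mu_f(Ax)\,A$; - (A4) $\mu_{f^{(t)}}(x+a_k^{(t)})\xrightarrow{t\to\infty}\mu_{f_k}(x)$ for all $k=1,\dots,K$. *)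

theory Defs
  imports "HOL-Analysis.Analysis"
begin

section \<open>Sobolev functions on Euclidean space\<close>

primrec C_k :: "nat \<Rightarrow> ('a::euclidean_space \<Rightarrow> real) \<Rightarrow> bool" where
  "C_k 0 \<phi> \<longleftrightarrow> continuous_on UNIV \<phi>"
| "C_k (Suc k) \<phi> \<longleftrightarrow>
     \<phi> differentiable_on UNIV \<and> (\<forall>v. C_k k (\<lambda>x. frechet_derivative \<phi> (at x) v))"

definition test_function :: "('a::euclidean_space \<Rightarrow> real) \<Rightarrow> bool" where
  "test_function \<phi> \<longleftrightarrow> (\<forall>k. C_k k \<phi>) \<and> compact (closure {x. \<phi> x \<noteq> 0})"

definition locally_integrable :: "('a::euclidean_space \<Rightarrow> real) \<Rightarrow> bool" where
  "locally_integrable f \<longleftrightarrow> (\<forall>K. compact K \<longrightarrow> set_integrable lebesgue K f)"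

definition square_integrable :: "('a::euclidean_space \<Rightarrow> real) \<Rightarrow> bool" where
  "square_integrable f \<longleftrightarrow>
     f \<in> borel_measurable lebesgue \<and> integrable lebesgue (\<lambda>x. (f x)\<^sup>2)"

text \<open>\<open>g\<close> is a weak partial derivative of \<open>f\<close> in the \<open>i\<close>-th coordinate direction.\<close>

definition has_weak_pderiv ::
  "'d::finite \<Rightarrow> (real^'d \<Rightarrow> real) \<Rightarrow> (real^'d \<Rightarrow> real) \<Rightarrow> bool" where
  "has_weak_pderiv i f g \<longleftrightarrow>
     locally_integrable f \<and> locally_integrable g \<and>
     (\<forall>\<phi>. test_function \<phi> \<longrightarrow>
        (\<integral>x. f x * frechet_derivative \<phi> (at x) (axis i 1) \<partial>lebesgue) =
        - (\<integral>x. g x * \<phi> x \<partial>lebesgue))"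

text \<open>
  \<open>W2 k\<close> is the Sobolev space of order \<open>k\<close> over the square integrable functions. Its members are
  representatives; functions that agree almost everywhere are not identified.
\<close>

primrec W2 :: "nat \<Rightarrow> (real^'d::finite \<Rightarrow> real) set" where
  "W2 0 = {f. square_integrable f}"
| "W2 (Suc k) = {f. square_integrable f \<and> (\<forall>i. \<exists>g\<in>W2 k. has_weak_pderiv i f g)}"

text \<open>
  A representative of the weak derivative, which is unique up to null sets. It only occurs under
  integral signs below, so the choice is immaterial.
\<close>

definition weak_pderiv :: "'d::finite \<Rightarrow> (real^'d \<Rightarrow> real) \<Rightarrow> real^'d \<Rightarrow> real" where
  "weak_pderiv i f = (SOME g. has_weak_pderiv i f g)"

definition weak_grad :: "(real^'d::finite \<Rightarrow> real) \<Rightarrow> real^'d \<Rightarrow> real^'d" where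
  "weak_grad f y = (\<chi> i. weak_pderiv i f y)"

definition weak_hessian :: "(real^'d::finite \<Rightarrow> real) \<Rightarrow> real^'d \<Rightarrow> real^'d^'d" where
  "weak_hessian f y = (\<chi> i j. weak_pderiv i (weak_pderiv j f) y)"


section \<open>Symmetric positive definite matrices, Gaussians, convolutions\<close>

definition spd :: "real^'d^'d::finite \<Rightarrow> bool" where
  "spd M \<longleftrightarrow> transpose M = M \<and> (\<forall>v. v \<noteq> 0 \<longrightarrow> 0 < v \<bullet> (M *v v))"

definition spd_sqrt :: "real^'d^'d::finite \<Rightarrow> real^'d^'d" where
  "spd_sqrt S = (THE R. spd R \<and> R ** R = S)"

definition gauss :: "real^'d^'d::finite \<Rightarrow> real^'d \<Rightarrow> real" where
  "gauss \<Sigma> x = (2 * pi) powr (- real CARD('d) / 2) * \<bar>det \<Sigma>\<bar> powr (- 1 / 2)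
                * exp (- (1 / 2) * (x \<bullet> (matrix_inv \<Sigma> *v x)))"

definition conv :: "(real^'d::finite \<Rightarrow> real) \<Rightarrow> (real^'d \<Rightarrow> real) \<Rightarrow> real^'d \<Rightarrow> real" where
  "conv h g x = (\<integral>y. h y * g (x - y) \<partial>lebesgue)"

definition mconv ::
  "(real^'d::finite \<Rightarrow> real^'d^'d) \<Rightarrow> (real^'d \<Rightarrow> real) \<Rightarrow> real^'d \<Rightarrow> real^'d^'d" where
  "mconv H g x = (\<chi> i j. conv (\<lambda>y. H y $ i $ j) g x)"


section \<open>The implicit equation and its fixed point iteration\<close>

text \<open>The matrix field \<open>\<nabla>f \<nabla>f\<^sup>T - f D\<^sup>2f\<close>.\<close>

definition curv :: "(real^'d::finite \<Rightarrow> real) \<Rightarrow> real^'d \<Rightarrow> real^'d^'d" where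
  "curv f y = (\<chi> i j. weak_grad f y $ i * weak_grad f y $ j) - f y *\<^sub>R weak_hessian f y"

text \<open>
  Right-hand side of the equation at the point \<open>x\<close>, as a function of the matrix \<open>M = \<mu>\<^sub>f(x)\<close>;
  the covariance \<open>S = (lam M)\<^sup>-\<^sup>2\<close> is fixed before the convolutions are formed.
\<close>

definition eq_rhs ::
  "real \<Rightarrow> (real^'d::finite \<Rightarrow> real) \<Rightarrow> real^'d \<Rightarrow> real^'d^'d \<Rightarrow> real^'d^'d" where
  "eq_rhs lam f x M =
     (let S = matrix_inv ((lam *\<^sub>R M) ** (lam *\<^sub>R M));
          G2 = (\<lambda>y. (gauss S y)\<^sup>2)
      in (1 / 2) *\<^sub>R ((lam *\<^sub>R M) ** (lam *\<^sub>R M))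
         + (1 / (2 * conv (\<lambda>y. (f y)\<^sup>2) G2 x)) *\<^sub>R mconv (curv f) G2 x)"

definition solves ::
  "real \<Rightarrow> (real^'d::finite \<Rightarrow> real) \<Rightarrow> (real^'d \<Rightarrow> real^'d^'d) \<Rightarrow> bool" where
  "solves lam f m \<longleftrightarrow> (\<forall>x. spd (m x) \<and> m x ** m x = eq_rhs lam f x (m x))"

primrec fp_iter ::
  "real \<Rightarrow> (real^'d::finite \<Rightarrow> real) \<Rightarrow> (real^'d \<Rightarrow> real^'d^'d) \<Rightarrow> nat
     \<Rightarrow> real^'d \<Rightarrow> real^'d^'d" where
  "fp_iter lam f m0 0 = m0"
| "fp_iter lam f m0 (Suc n) = (\<lambda>x. spd_sqrt (eq_rhs lam f x (fp_iter lam f m0 n x)))"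

text \<open>
  Convergence is pointwise. The positivity clause says that the square roots in the iteration
  exist, so that no iterate is an unspecified value of \<^const>\<open>spd_sqrt\<close>.
\<close>

definition iteration_converges ::
  "real \<Rightarrow> (real^'d::finite \<Rightarrow> real) \<Rightarrow> (real^'d \<Rightarrow> real^'d^'d) \<Rightarrow> bool" where
  "iteration_converges lam f m \<longleftrightarrow>
     (\<forall>m0. (\<forall>x. spd (m0 x)) \<longrightarrow>
        (\<forall>n x. spd (eq_rhs lam f x (fp_iter lam f m0 n x))) \<and>
        (\<forall>x. (\<lambda>n. fp_iter lam f m0 n x) \<longlonglongrightarrow> m x))"

definition admissible :: "real \<Rightarrow> (real^'d::finite \<Rightarrow> real) set" where
  "admissible lam =
     {f \<in> W2 2. \<not> (AE x in lebesgue. f x = 0) \<and>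
        (\<exists>!m. solves lam f m) \<and> (\<forall>m. solves lam f m \<longrightarrow> iteration_converges lam f m)}"


section \<open>Adaptation axioms\<close>

text \<open>
  \<open>F\<close> is the class of functions under consideration: every function occurring in an axiom,
  including the transformed ones, is required to lie in it.
\<close>

definition axiom_A1 ::
  "(real^'d::finite \<Rightarrow> real) set \<Rightarrow> ((real^'d \<Rightarrow> real) \<Rightarrow> real^'d \<Rightarrow> real^'d^'d) \<Rightarrow> bool" where
  "axiom_A1 F \<mu> \<longleftrightarrow>
     (\<forall>f a x. f \<in> F \<and> (\<lambda>y. f (y - a)) \<in> F \<longrightarrow> \<mu> (\<lambda>y. f (y - a)) x = \<mu> f (x - a))"

definition axiom_A2 ::
  "(real^'d::finite \<Rightarrow> real) set \<Rightarrow> ((real^'d \<Rightarrow> real) \<Rightarrow> real^'d \<Rightarrow> real^'d^'d) \<Rightarrow> bool" where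
  "axiom_A2 F \<mu> \<longleftrightarrow>
     (\<forall>f \<alpha>. f \<in> F \<and> \<alpha> \<noteq> 0 \<and> (\<lambda>y. \<alpha> * f y) \<in> F \<longrightarrow> \<mu> (\<lambda>y. \<alpha> * f y) = \<mu> f)"

definition axiom_A3 ::
  "(real^'d::finite \<Rightarrow> real) set \<Rightarrow> ((real^'d \<Rightarrow> real) \<Rightarrow> real^'d \<Rightarrow> real^'d^'d) \<Rightarrow> bool" where
  "axiom_A3 F \<mu> \<longleftrightarrow>
     (\<forall>f A x. f \<in> F \<and> invertible A \<and> (\<lambda>y. f (A *v y)) \<in> F \<longrightarrow>
        transpose (\<mu> (\<lambda>y. f (A *v y)) x) ** \<mu> (\<lambda>y. f (A *v y)) x =
        transpose A ** transpose (\<mu> f (A *v x)) ** \<mu> f (A *v x) ** A)"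

definition axiom_A4 ::
  "(real^'d::finite \<Rightarrow> real) set \<Rightarrow> ((real^'d \<Rightarrow> real) \<Rightarrow> real^'d \<Rightarrow> real^'d^'d) \<Rightarrow> bool" where
  "axiom_A4 F \<mu> \<longleftrightarrow>
     (\<forall>(K::nat) (f :: nat \<Rightarrow> real^'d \<Rightarrow> real) (a :: nat \<Rightarrow> real \<Rightarrow> real^'d).
        (\<forall>k\<in>{1..K}. f k \<in> F) \<and>
        (\<forall>t\<ge>0. (\<lambda>y. \<Sum>k=1..K. f k (y - a k t)) \<in> F) \<and>
        (\<forall>k\<in>{1..K}. \<forall>j\<in>{1..K}. k \<noteq> j \<longrightarrow>
           filterlim (\<lambda>t. norm (a k t - a j t)) at_top at_top) \<longrightarrow>
        (\<forall>x. \<forall>k\<in>{1..K}.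
           ((\<lambda>t. \<mu> (\<lambda>y. \<Sum>l=1..K. f l (y - a l t)) (x + a k t)) \<longlongrightarrow> \<mu> (f k) x) at_top))"

definition adaptation_axioms ::
  "(real^'d::finite \<Rightarrow> real) set \<Rightarrow> ((real^'d \<Rightarrow> real) \<Rightarrow> real^'d \<Rightarrow> real^'d^'d) \<Rightarrow> bool" where
  "adaptation_axioms F \<mu> \<longleftrightarrow>
     (\<forall>f\<in>F. \<mu> f \<in> borel_measurable borel \<and> (\<forall>x. invertible (\<mu> f x))) \<and>
     axiom_A1 F \<mu> \<and> axiom_A2 F \<mu> \<and> axiom_A3 F \<mu> \<and> axiom_A4 F \<mu>"

end

theory Submission
  imports Defs
begin

text \<open>
  At a fixed point \<open>x\<close> the right-hand side of the equation is a function of the matrix \<open>M = \<mu>\<^sub>f(x)\<close>, built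
  from quotients of integrals of \<open>\<nabla>f \<nabla>f\<^sup>T - f D\<^sup>2f\<close> and of \<open>f\<^sup>2\<close> against the Gaussian window
  \<open>y \<mapsto> exp (- |lam M (x - y)|\<^sup>2)\<close>; the normalization of the Gaussian cancels. All four axioms are properties
  of these quotients combined with the uniqueness of the solution and the convergence of the iteration.

  \<^bold>\<open>A1, A2, A3.\<close> Translating \<open>f\<close> translates the windows, multiplying \<open>f\<close> by a constant multiplies numerator
  and denominator by its square, and composing \<open>f\<close> with a linear map \<open>A\<close> turns the window of \<open>M\<close> into the
  window of the square root of \<open>A\<^sup>T M\<^sup>2 A\<close> and the numerator into its congruence by \<open>A\<close>
  (\<open>eq_rhs_translate\<close>, \<open>eq_rhs_scale\<close>, \<open>eq_rhs_linear\<close>). So the transported solution solves the equation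
  of the transformed function, and uniqueness identifies the two. As the weak derivatives are arbitrary
  representatives, this rests on their uniqueness almost everywhere, that is, on the fundamental lemma of
  the calculus of variations, for which enough smooth compactly supported functions are constructed.

  \<^bold>\<open>A4.\<close> Seen from the moving centre \<open>a\<^sub>k\<close>, the summand \<open>f\<^sub>k\<close> stands still while all others escape to infinity,
  where the Gaussian window suppresses them, including the mixed products
  (\<open>eq_rhs_sum_translates_tendsto\<close>). Thus the fixed point maps \<open>\<Phi>\<^sub>t\<close> of the sum converge to the map \<open>\<Psi>\<close> of
  \<open>f\<^sub>k\<close>, locally uniformly on the cone of positive definite matrices. No uniformity near the boundary
  of the cone is available, since wide windows see the far summands. It is replaced by a dynamical
  argument (\<open>attracting_points_of_perturbations_converge\<close>): let \<open>B\<close> be a small compact ball around the fixed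
  point \<open>m\<close> of \<open>\<Psi>\<close>. If the fixed points of \<open>\<Phi>\<^sub>t\<close> stayed outside \<open>B\<close> for arbitrarily large \<open>t\<close>, the orbit of \<open>m\<close>
  under such a \<open>\<Phi>\<^sub>t\<close> would leave \<open>B\<close> for good from some last point in \<open>B\<close>; a limit of these last
  points would have a \<open>\<Psi>\<close>-orbit that never returns to the interior of \<open>B\<close>, although all \<open>\<Psi>\<close>-orbits converge to \<open>m\<close>.

  \<^bold>\<open>Measurability.\<close> The right-hand side is jointly continuous in the point and the matrix, and so is the square
  root; hence the iterates that start at the identity are continuous, and the solution is their
  pointwise limit.
\<close>


section \<open>Symmetric matrices and square roots\<close>

text \<open>
  The form \<open>y \<bullet> g y\<close> has its minimum \<open>0\<close> at \<open>b\<close>, so its derivative at \<open>b\<close> in the direction \<open>g b\<close>, which is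
  \<open>2 |g b|\<^sup>2\<close>, must vanish.
\<close>

lemma psd_on_subspace_null_vector:
  fixes g :: "'a::euclidean_space \<Rightarrow> 'a"
  assumes g: "linear g" "\<And>x y. g x \<bullet> y = x \<bullet> g y"
    and S: "subspace S" "g ` S \<subseteq> S"
    and psd: "\<And>y. y \<in> S \<Longrightarrow> 0 \<le> y \<bullet> g y"
    and b: "b \<in> S" "b \<bullet> g b = 0"
  shows "g b = 0"
proof (rule ccontr)
  assume nz: "g b \<noteq> 0"
  define y where "y = g b"
  have y: "y \<in> S" using S b by (auto simp: y_def)
  define p where "p = y \<bullet> y"
  define q where "q = y \<bullet> g y"
  have p: "p > 0" using nz by (simp add: p_def y_def)
  have q: "q \<ge> 0" using psd[OF y] by (simp add: q_def)
  have expand: "(b + t *\<^sub>R y) \<bullet> g (b + t *\<^sub>R y) = 2 * t * p + t\<^sup>2 * q" for t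
  proof -
    have "b \<bullet> g y = p" using g(2)[of b y] by (simp add: p_def y_def)
    moreover have "y \<bullet> g b = p" by (simp add: p_def y_def)
    ultimately show ?thesis
      using b(2) g(1) by (simp add: linear_add linear_scale inner_add q_def power2_eq_square algebra_simps)
  qed
  have nonneg: "0 \<le> 2 * t * p + t\<^sup>2 * q" for t
    unfolding expand[symmetric] by (rule psd) (use S y b in \<open>simp add: subspace_add subspace_scale\<close>)
  \<comment> \<open>A value of \<open>t\<close> at which the negative linear term outweighs the quadratic one.\<close>
  have "2 * (- (p / w)) * p + (- (p / w))\<^sup>2 * q = p\<^sup>2 * (- 2 * w + q) / w\<^sup>2" if "w \<noteq> 0" for w
    using that by (simp add: divide_simps) (simp add: algebra_simps power2_eq_square)
  from this[of "q + 1"] q have "2 * (- (p / (q + 1))) * p + (- (p / (q + 1)))\<^sup>2 * q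
      = p\<^sup>2 * (- 2 * (q + 1) + q) / (q + 1)\<^sup>2" by simp
  also have "\<dots> < 0"
    using p q by (intro divide_neg_pos mult_pos_neg) auto
  finally show False using nonneg[of "- (p / (q + 1))"] by simp
qed

text \<open>
  Induction on the dimension. A unit vector \<open>b\<close> of the subspace at which \<open>y \<bullet> f y\<close> is largest is an
  eigenvector: with \<open>l\<close> the maximum, \<open>y \<mapsto> l y - f y\<close> is positive semidefinite on the subspace and its form
  vanishes at \<open>b\<close>. The orthogonal complement of \<open>b\<close> is again invariant.
\<close>

theorem selfadjoint_orthonormal_eigenbasis_subspace:
  fixes f :: "'a::euclidean_space \<Rightarrow> 'a"
  assumes f: "linear f" "\<And>x y. f x \<bullet> y = x \<bullet> f y"
  shows "subspace S \<Longrightarrow> f ` S \<subseteq> S \<Longrightarrow>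
    \<exists>B. B \<subseteq> S \<and> finite B \<and> pairwise orthogonal B \<and> (\<forall>b\<in>B. norm b = 1) \<and> span B = S \<and>
        (\<forall>b\<in>B. \<exists>l. f b = l *\<^sub>R b)"
proof (induction "dim S" arbitrary: S rule: less_induct)
  case less
  show ?case
  proof (cases "S = {0}")
    case True
    then show ?thesis by (intro exI[of _ "{}"]) auto
  next
    case False
    then obtain x where x: "x \<in> S" "x \<noteq> 0" using less.prems(1) subspace_0 by blast
    define C where "C = sphere 0 1 \<inter> S"
    have "compact C" unfolding C_def
      by (intro compact_Int_closed compact_sphere closed_subspace less.prems)
    moreover have "x /\<^sub>R norm x \<in> C" using x less.prems by (auto simp: C_def subspace_scale)
    hence "C \<noteq> {}" by auto
    moreover have "continuous_on C (\<lambda>y. y \<bullet> f y)"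
      by (intro continuous_intros linear_continuous_on linear_linear[THEN iffD2] f)
    ultimately obtain b where b: "b \<in> C" and bmax: "\<And>y. y \<in> C \<Longrightarrow> y \<bullet> f y \<le> b \<bullet> f b"
      using continuous_attains_sup[of C] by metis
    define l where "l = b \<bullet> f b"
    have bS: "b \<in> S" and nb: "norm b = 1" using b by (auto simp: C_def)
    define g where "g y = l *\<^sub>R y - f y" for y
    have ling: "linear g" unfolding g_def
      by (intro linear_compose_sub f(1)) (auto intro!: linearI simp: algebra_simps)
    have "g b = 0"
    proof (rule psd_on_subspace_null_vector[OF ling])
      show "g x \<bullet> y = x \<bullet> g y" for x y by (simp add: g_def inner_diff f)
      show "g ` S \<subseteq> S" using less.prems by (auto simp: g_def subspace_diff subspace_scale)
      show "b \<bullet> g b = 0" using nb by (simp add: g_def inner_diff l_def norm_eq_1)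
      show "0 \<le> y \<bullet> g y" if "y \<in> S" for y
      proof (cases "y = 0")
        case False
        have "y /\<^sub>R norm y \<in> C" using that False less.prems by (auto simp: C_def subspace_scale)
        from bmax[OF this] have "(y \<bullet> f y) / (norm y)\<^sup>2 \<le> l"
          by (simp add: l_def linear_scale[OF f(1)] power2_eq_square divide_inverse mult_ac)
        with False have "y \<bullet> f y \<le> l * (norm y)\<^sup>2" by (simp add: divide_simps)
        thus ?thesis by (simp add: g_def inner_diff power2_norm_eq_inner)
      qed (simp add: g_def)
    qed (use less.prems bS in auto)
    hence fb: "f b = l *\<^sub>R b" by (simp add: g_def)
    define S' where "S' = S \<inter> {y. b \<bullet> y = 0}"
    have sub': "subspace S'" unfolding S'_def by (intro subspace_inter less.prems subspace_hyperplane)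
    have inv': "f ` S' \<subseteq> S'"
    proof -
      have "b \<bullet> f y = 0" if "b \<bullet> y = 0" for y using f(2)[of b y] that by (simp add: fb)
      thus ?thesis using less.prems by (auto simp: S'_def)
    qed
    have "b \<notin> S'" using nb by (auto simp: S'_def norm_eq_1)
    hence "S' \<subset> S" using bS unfolding S'_def by blast
    hence "dim S' < dim S"
      using dim_psubset sub' less.prems(1) by (metis span_eq_iff)
    from less.hyps[OF this sub' inv'] obtain B where B: "B \<subseteq> S'" "finite B" "pairwise orthogonal B"
        "\<forall>b\<in>B. norm b = 1" "span B = S'" "\<forall>b\<in>B. \<exists>l. f b = l *\<^sub>R b" by blast
    show ?thesis
    proof (intro exI[of _ "insert b B"] conjI)
      show "insert b B \<subseteq> S" using B bS by (auto simp: S'_def)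
      show "pairwise orthogonal (insert b B)" using B
        by (auto simp: pairwise_insert orthogonal_def S'_def inner_commute)
      show "span (insert b B) = S"
      proof
        show "span (insert b B) \<subseteq> S" using B bS less.prems(1)
          by (intro span_minimal) (auto simp: S'_def)
        show "S \<subseteq> span (insert b B)"
        proof
          fix y assume y: "y \<in> S"
          have "y - (b \<bullet> y) *\<^sub>R b \<in> S'"
            using y bS less.prems(1) nb by (auto simp: S'_def subspace_diff subspace_scale inner_diff_right norm_eq_1)
          with B have "y - (b \<bullet> y) *\<^sub>R b \<in> span B" by simp
          thus "y \<in> span (insert b B)" by (auto simp: span_insert)
        qed
      qed
    qed (use B nb fb in auto)
  qed
qed

lemma inner_matrix_transpose: "(transpose A *v x) \<bullet> y = x \<bullet> (A *v (y::real^'d::finite))"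
  by (metis dot_lmul_matrix transpose_matrix_vector)

lemma inner_matrix_transpose_right: "x \<bullet> (transpose A *v y) = (A *v x) \<bullet> (y::real^'d::finite)"
  using inner_matrix_transpose[of A y x] by (simp add: inner_commute)

corollary symmetric_matrix_orthonormal_eigenbasis:
  fixes X :: "real^'d^'d::finite"
  assumes "transpose X = X"
  shows "\<exists>B l. finite B \<and> card B \<le> CARD('d) \<and> pairwise orthogonal B \<and>
    (\<forall>b\<in>B. norm b = 1 \<and> X *v b = l b *\<^sub>R b) \<and> (\<forall>v. (\<Sum>b\<in>B. (b \<bullet> v) *\<^sub>R b) = v)"
proof -
  obtain B where B: "finite B" "pairwise orthogonal B" "\<forall>b\<in>B. norm b = 1" "span B = UNIV"
      "\<forall>b\<in>B. \<exists>l. X *v b = l *\<^sub>R b"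
    using selfadjoint_orthonormal_eigenbasis_subspace[of "(*v) X" UNIV] assms inner_matrix_transpose[of X]
    by auto
  have "independent B" using B by (intro pairwise_orthogonal_independent) auto
  hence "card B \<le> CARD('d)" using independent_bound[of B] by simp
  moreover have "(\<Sum>b\<in>B. (b \<bullet> v) *\<^sub>R b) = v" for v
  proof -
    have "(\<Sum>b\<in>B. (v \<bullet> b) *\<^sub>R b) = v" using B
      by (intro orthonormal_basis_expand) auto
    thus ?thesis by (simp add: inner_commute)
  qed
  moreover obtain l where "\<forall>b\<in>B. X *v b = l b *\<^sub>R b" using bchoice[OF B(5)] by blast
  ultimately show ?thesis using B by blast
qed

lemma norm_matrix_vector_le: "norm (A *v x) \<le> norm A * norm (x :: real^'n::finite)"
  for A :: "real^'n^'m::finite"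
proof -
  have "norm (A *v x) = L2_set (\<lambda>i. \<bar>A $ i \<bullet> x\<bar>) UNIV"
    by (simp add: norm_vec_def matrix_vector_mul_component)
  also have "\<dots> \<le> L2_set (\<lambda>i. norm x * norm (A $ i)) UNIV"
    by (intro L2_set_mono) (auto simp: mult.commute intro: order_trans[OF Cauchy_Schwarz_ineq2])
  also have "\<dots> = norm x * norm A"
    by (simp add: L2_set_right_distrib norm_vec_def)
  finally show ?thesis by (simp add: mult.commute)
qed

text \<open>
  The dimension enters because the eigenvector expansion of \<open>v\<close> is estimated term by term.
\<close>

lemma symmetric_norm_le_eigenvalue_bound:
  fixes X :: "real^'d^'d::finite"
  assumes "transpose X = X"
    and bound: "\<And>b l. norm b = 1 \<Longrightarrow> X *v b = l *\<^sub>R b \<Longrightarrow> \<bar>l\<bar> \<le> C"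
  shows "norm (X *v v) \<le> real CARD('d) * C * norm v"
proof -
  obtain B l where B': "finite B" "card B \<le> CARD('d)" "\<forall>b\<in>B. norm b = 1 \<and> X *v b = l b *\<^sub>R b"
      "\<forall>v. (\<Sum>b\<in>B. (b \<bullet> v) *\<^sub>R b) = v"
    using symmetric_matrix_orthonormal_eigenbasis[OF assms(1)] by blast
  note B = B'(1,2) B'(3)[rule_format, THEN conjunct1] B'(3)[rule_format, THEN conjunct2]
    B'(4)[rule_format, symmetric]
  have "X *v v = (\<Sum>b\<in>B. X *v ((b \<bullet> v) *\<^sub>R b))"
    by (subst B(5)[of v]) (rule linear_sum[OF matrix_vector_mul_linear])
  also have "\<dots> = (\<Sum>b\<in>B. (b \<bullet> v) *\<^sub>R l b *\<^sub>R b)"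
    by (intro sum.cong refl) (simp add: B(4) matrix_vector_mult_scaleR)
  finally have X: "X *v v = \<dots>" .
  have "norm (X *v v) \<le> (\<Sum>b\<in>B. C * norm v)" unfolding X
  proof (rule sum_norm_le)
    fix b assume b: "b \<in> B"
    have "norm ((b \<bullet> v) *\<^sub>R l b *\<^sub>R b) = \<bar>b \<bullet> v\<bar> * \<bar>l b\<bar>" using B(3)[OF b] by (simp add: abs_mult)
    also have "\<dots> \<le> norm v * C"
      using bound[OF B(3)[OF b] B(4)[OF b]] Cauchy_Schwarz_ineq2[of b v] B(3)[OF b]
      by (intro mult_mono) auto
    finally show "norm ((b \<bullet> v) *\<^sub>R l b *\<^sub>R b) \<le> C * norm v" by (simp add: mult.commute)
  qed
  also have "\<dots> = real (card B) * (C * norm v)" by simp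
  also have "\<dots> \<le> real CARD('d) * (C * norm v)"
  proof (cases "B = {}")
    case True
    hence "v = 0" using B(5)[of v] by simp
    thus ?thesis by simp
  next
    case False
    then obtain b where "b \<in> B" by auto
    hence "0 \<le> C" using bound[OF B(3) B(4)] by fastforce
    thus ?thesis using B(2) by (intro mult_right_mono) auto
  qed
  finally show ?thesis by simp
qed

lemma spd_inner_transfer: "spd M \<Longrightarrow> (M *v x) \<bullet> y = x \<bullet> (M *v y)"
  by (metis inner_matrix_transpose spd_def)

text \<open>
  The constant is the minimum of the quadratic form over the unit sphere.
\<close>

lemma spd_coercive:
  fixes M :: "real^'d^'d::finite"
  assumes "spd M"
  shows "\<exists>c>0. \<forall>v. c * (norm v)\<^sup>2 \<le> v \<bullet> (M *v v)"
proof -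
  have "sphere (0::real^'d) 1 \<noteq> {}" by simp
  then obtain u where u: "u \<in> sphere 0 1" and min: "\<And>v. v \<in> sphere 0 1 \<Longrightarrow> u \<bullet> (M *v u) \<le> v \<bullet> (M *v v)"
    using continuous_attains_inf[of "sphere (0::real^'d) 1" "\<lambda>v. v \<bullet> (M *v v)", OF compact_sphere]
      continuous_on_inner[OF continuous_on_id matrix_vector_mult_linear_continuous_on, of "sphere 0 1" M]
    by blast
  have "u \<noteq> 0" using u by auto
  hence pos: "u \<bullet> (M *v u) > 0" using assms by (simp add: spd_def)
  show ?thesis
  proof (intro exI[of _ "u \<bullet> (M *v u)"] conjI allI pos)
    fix v :: "real^'d"
    show "u \<bullet> (M *v u) * (norm v)\<^sup>2 \<le> v \<bullet> (M *v v)"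
    proof (cases "v = 0")
      case False
      hence "u \<bullet> (M *v u) \<le> (v /\<^sub>R norm v) \<bullet> (M *v (v /\<^sub>R norm v))" by (intro min) simp
      also have "\<dots> = (v \<bullet> (M *v v)) / (norm v)\<^sup>2"
        by (simp add: matrix_vector_mult_scaleR power2_eq_square divide_inverse)
      finally show ?thesis using False by (simp add: divide_simps)
    qed simp
  qed
qed

lemma spd_mat_1: "spd (mat 1)"
  by (simp add: spd_def)

lemma spd_invertible: "spd M \<Longrightarrow> invertible M"
  unfolding invertible_left_inverse matrix_left_invertible_ker spd_def by force

lemma spd_congruence:
  fixes M A :: "real^'d^'d::finite"
  assumes "spd M" "invertible A"
  shows "spd (transpose A ** M ** A)"
proof -
  have "A *v v \<noteq> 0" if "v \<noteq> 0" for v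
    using that assms(2) unfolding invertible_left_inverse matrix_left_invertible_ker by blast
  moreover have "v \<bullet> ((transpose A ** M ** A) *v v) = (A *v v) \<bullet> (M *v (A *v v))" for v
    by (simp add: matrix_vector_mul_assoc[symmetric] inner_matrix_transpose_right del: transpose_matrix_vector)
  ultimately show ?thesis using assms
    by (simp add: spd_def matrix_transpose_mul transpose_transpose matrix_mul_assoc)
qed

lemma spd_square:
  assumes "spd M" shows "spd (M ** M)"
proof -
  have "transpose M ** mat 1 ** M = M ** M" using assms by (simp add: spd_def)
  thus ?thesis using spd_congruence[OF spd_mat_1 spd_invertible[OF assms]] by metis
qed

lemma spd_scaleR:
  assumes "spd M" "c > 0" shows "spd (c *\<^sub>R M)"
proof -
  have "transpose (c *\<^sub>R M) = c *\<^sub>R transpose M" by (simp add: transpose_def vec_eq_iff)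
  thus ?thesis using assms by (auto simp: spd_def scaleR_matrix_vector_assoc[symmetric])
qed

text \<open>
  If \<open>b\<close> is a unit eigenvector of \<open>R - Q\<close> with eigenvalue \<open>l\<close>, then
  \<open>b \<bullet> (R\<^sup>2 - Q\<^sup>2) b = l (b \<bullet> R b + b \<bullet> Q b)\<close>, and the last factor is at least \<open>c\<close>. So the difference of the
  squares controls every eigenvalue of \<open>R - Q\<close>. Both the uniqueness and the continuity of the square root
  are instances.
\<close>

theorem spd_sqrt_perturbation:
  fixes R Q :: "real^'d^'d::finite"
  assumes R: "spd R" and Q: "spd Q" and c: "c > 0" "\<And>v. c * (norm v)\<^sup>2 \<le> v \<bullet> (Q *v v)"
  shows "norm ((R - Q) *v v) \<le> real CARD('d) * (norm (R ** R - Q ** Q) / c) * norm v"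
proof (rule symmetric_norm_le_eigenvalue_bound)
  show "transpose (R - Q) = R - Q"
    using R Q by (auto simp: spd_def transpose_def vec_eq_iff)
next
  fix b l assume b: "norm b = 1" and l: "(R - Q) *v b = l *\<^sub>R b"
  have Rb: "R *v b = Q *v b + l *\<^sub>R b" using l by (simp add: matrix_vector_mult_diff_rdistrib algebra_simps)
  have "b \<bullet> ((R ** R - Q ** Q) *v b) = (R *v b) \<bullet> (R *v b) - (Q *v b) \<bullet> (Q *v b)"
    by (simp add: matrix_vector_mult_diff_rdistrib inner_diff_right spd_inner_transfer[OF R]
        spd_inner_transfer[OF Q] matrix_vector_mul_assoc[symmetric])
  also have "\<dots> = l * (b \<bullet> (R *v b) + b \<bullet> (Q *v b))"
    by (simp add: Rb inner_add algebra_simps inner_commute)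
  finally have eq: "b \<bullet> ((R ** R - Q ** Q) *v b) = l * (b \<bullet> (R *v b) + b \<bullet> (Q *v b))" .
  have pos: "c \<le> b \<bullet> (R *v b) + b \<bullet> (Q *v b)"
    using c(2)[of b] R b unfolding spd_def by (smt (verit) norm_zero mult_cancel_left1 one_power2)
  have "c * \<bar>l\<bar> \<le> \<bar>l\<bar> * (b \<bullet> (R *v b) + b \<bullet> (Q *v b))"
    using pos by (subst mult.commute) (rule mult_left_mono, auto)
  also have "\<dots> = \<bar>b \<bullet> ((R ** R - Q ** Q) *v b)\<bar>"
    using pos c(1) by (simp add: eq abs_mult)
  also have "\<dots> \<le> norm (R ** R - Q ** Q)"
    using Cauchy_Schwarz_ineq2[of b "(R ** R - Q ** Q) *v b"] norm_matrix_vector_le[of "R ** R - Q ** Q" b] b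
    by simp
  finally show "\<bar>l\<bar> \<le> norm (R ** R - Q ** Q) / c" using c(1) by (simp add: field_simps)
qed

corollary spd_sqrt_unique:
  fixes R Q :: "real^'d^'d::finite"
  assumes "spd R" "spd Q" "R ** R = Q ** Q"
  shows "R = Q"
proof -
  obtain c where "c > 0" "\<And>v. c * (norm v)\<^sup>2 \<le> v \<bullet> (Q *v v)" using spd_coercive[OF assms(2)] by blast
  from spd_sqrt_perturbation[OF assms(1,2) this] assms(3)
  have "(R - Q) *v v = 0" for v by simp
  hence "R *v v = Q *v v" for v by (simp add: matrix_vector_mult_diff_rdistrib)
  thus ?thesis by (simp add: matrix_eq)
qed

text \<open>
  The root has the same eigenvectors as \<open>S\<close> and the square roots of its eigenvalues.
\<close>

theorem spd_sqrt_exists: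
  fixes S :: "real^'d^'d::finite"
  assumes S: "spd S"
  shows "\<exists>R. spd R \<and> R ** R = S"
proof -
  have "transpose S = S" using S by (simp add: spd_def)
  from symmetric_matrix_orthonormal_eigenbasis[OF this]
  obtain B l where B': "finite B" "pairwise orthogonal B" "\<forall>b\<in>B. norm b = 1 \<and> S *v b = l b *\<^sub>R b"
      "\<forall>v. (\<Sum>b\<in>B. (b \<bullet> v) *\<^sub>R b) = v"
    by blast
  note B = B'(1) B'(3)[rule_format, THEN conjunct1] B'(3)[rule_format, THEN conjunct2]
    B'(4)[rule_format, symmetric] B'(2)
  have l: "l b > 0" if "b \<in> B" for b
  proof -
    have "b \<noteq> 0" using B(2)[OF that] by auto
    hence "0 < b \<bullet> (S *v b)" using S by (simp add: spd_def)
    also have "\<dots> = l b" using B(2,3)[OF that] by (simp add: norm_eq_1)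
    finally show ?thesis .
  qed
  define r where "r v = (\<Sum>b\<in>B. (sqrt (l b) * (b \<bullet> v)) *\<^sub>R b)" for v
  have lin: "linear r" unfolding r_def
  proof (rule linearI)
    fix x y :: "real^'d" and k :: real
    show "(\<Sum>b\<in>B. (sqrt (l b) * (b \<bullet> (x + y))) *\<^sub>R b) =
      (\<Sum>b\<in>B. (sqrt (l b) * (b \<bullet> x)) *\<^sub>R b) + (\<Sum>b\<in>B. (sqrt (l b) * (b \<bullet> y)) *\<^sub>R b)"
      by (simp add: inner_add_right distrib_left scaleR_add_left sum.distrib)
    show "(\<Sum>b\<in>B. (sqrt (l b) * (b \<bullet> (k *\<^sub>R x))) *\<^sub>R b) = k *\<^sub>R (\<Sum>b\<in>B. (sqrt (l b) * (b \<bullet> x)) *\<^sub>R b)"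
      by (simp add: scaleR_sum_right mult_ac)
  qed
  define R where "R = matrix r"
  have Rv: "R *v v = r v" for v using lin by (simp add: R_def matrix_works)
  have orth: "b \<bullet> b' = (if b = b' then 1 else 0)" if "b \<in> B" "b' \<in> B" for b b'
    using B(2,5) that by (auto simp: pairwise_def orthogonal_def norm_eq_1)
  have rb: "r b = sqrt (l b) *\<^sub>R b" if "b \<in> B" for b
  proof -
    have "r b = (\<Sum>b'\<in>B. if b' = b then sqrt (l b) *\<^sub>R b else 0)"
      unfolding r_def using that by (intro sum.cong) (auto simp: orth)
    thus ?thesis using B(1) that by simp
  qed
  have "(R ** R) *v v = S *v v" for v
  proof -
    have "(R ** R) *v v = (\<Sum>b\<in>B. (R ** R) *v ((b \<bullet> v) *\<^sub>R b))"
      by (subst B(4)[of v]) (rule linear_sum[OF matrix_vector_mul_linear])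
    also have "\<dots> = (\<Sum>b\<in>B. S *v ((b \<bullet> v) *\<^sub>R b))"
    proof (intro sum.cong refl)
      fix b assume b: "b \<in> B"
      have "(R ** R) *v b = S *v b"
        using l[OF b] by (simp add: matrix_vector_mul_assoc[symmetric] Rv rb[OF b] linear_scale[OF lin] B(3)[OF b])
      thus "(R ** R) *v ((b \<bullet> v) *\<^sub>R b) = S *v ((b \<bullet> v) *\<^sub>R b)" by (simp add: matrix_vector_mult_scaleR)
    qed
    also have "\<dots> = S *v v"
      by (subst (2) B(4)[of v]) (rule linear_sum[OF matrix_vector_mul_linear, symmetric])
    finally show ?thesis .
  qed
  hence RR: "R ** R = S" by (simp add: matrix_eq)
  have "(R *v x) \<bullet> y = x \<bullet> (R *v y)" for x y
    by (simp add: Rv r_def inner_sum_left inner_sum_right inner_commute mult_ac)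
  hence "x \<bullet> (transpose R *v y) = x \<bullet> (R *v y)" for x y
    by (metis inner_commute inner_matrix_transpose)
  hence "transpose R *v y = R *v y" for y using vector_eq_ldot[of "transpose R *v y" "R *v y"] by blast
  hence sym: "transpose R = R" by (simp add: matrix_eq)
  have "0 < v \<bullet> (R *v v)" if v: "v \<noteq> 0" for v
  proof -
    have eq: "v \<bullet> (R *v v) = (\<Sum>b\<in>B. sqrt (l b) * (b \<bullet> v)\<^sup>2)"
      by (simp add: Rv r_def inner_sum_right power2_eq_square inner_commute mult_ac)
    obtain b where b: "b \<in> B" "b \<bullet> v \<noteq> 0"
    proof -
      have "\<not> (\<forall>b\<in>B. b \<bullet> v = 0)"
      proof
        assume "\<forall>b\<in>B. b \<bullet> v = 0"
        hence "(\<Sum>b\<in>B. (b \<bullet> v) *\<^sub>R b) = 0" by simp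
        thus False using B'(4) v by simp
      qed
      thus ?thesis using that by blast
    qed
    show ?thesis unfolding eq
      by (rule sum_pos2[OF B(1) b(1)]) (use b l less_imp_le[OF l] in auto)
  qed
  with sym RR show ?thesis by (auto simp: spd_def)
qed

lemma spd_sqrt:
  assumes "spd S"
  shows "spd (spd_sqrt S)" "spd_sqrt S ** spd_sqrt S = S"
proof -
  have "\<exists>!R. spd R \<and> R ** R = S"
    using spd_sqrt_exists[OF assms] spd_sqrt_unique by blast
  from theI'[OF this] show "spd (spd_sqrt S)" "spd_sqrt S ** spd_sqrt S = S"
    by (auto simp: spd_sqrt_def)
qed

lemma spd_sqrt_tendsto:
  fixes S :: "nat \<Rightarrow> real^'d^'d::finite"
  assumes S: "\<And>n. spd (S n)" "spd L" "S \<longlonglongrightarrow> L"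
  shows "(\<lambda>n. spd_sqrt (S n)) \<longlonglongrightarrow> spd_sqrt L"
proof -
  obtain c where c: "c > 0" "\<And>v. c * (norm v)\<^sup>2 \<le> v \<bullet> (spd_sqrt L *v v)"
    using spd_coercive[OF spd_sqrt(1)[OF S(2)]] by (elim exE conjE) (rule that, assumption, erule spec)
  have bound: "norm (spd_sqrt (S n) $ i $ j - spd_sqrt L $ i $ j) \<le> real CARD('d) * (norm (S n - L) / c)" for n i j
  proof -
    have "spd_sqrt (S n) $ i $ j - spd_sqrt L $ i $ j = ((spd_sqrt (S n) - spd_sqrt L) *v axis j 1) $ i"
      by (simp add: matrix_vector_mult_basis column_def)
    also have "norm \<dots> \<le> norm ((spd_sqrt (S n) - spd_sqrt L) *v axis j 1)"
      by (simp add: component_le_norm_cart)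
    also have "\<dots> \<le> real CARD('d) * (norm (S n - L) / c) * norm (axis j 1 :: real^'d)"
      using spd_sqrt_perturbation[OF spd_sqrt(1)[OF S(1)] spd_sqrt(1)[OF S(2)] c, of n "axis j 1"]
      by (simp add: spd_sqrt S)
    finally show ?thesis by simp
  qed
  have "(\<lambda>n. real CARD('d) * (norm (S n - L) / c)) \<longlonglongrightarrow> real CARD('d) * (norm (L - L) / c)"
    by (intro tendsto_intros S) (use c in auto)
  hence lim0: "(\<lambda>n. real CARD('d) * (norm (S n - L) / c)) \<longlonglongrightarrow> 0" by simp
  have "(\<lambda>n. spd_sqrt (S n) $ i $ j) \<longlonglongrightarrow> spd_sqrt L $ i $ j" for i j
    by (rule LIM_zero_cancel, rule Lim_null_comparison[OF _ lim0])
       (intro always_eventually allI bound)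
  thus ?thesis by (intro vec_tendstoI)
qed

text \<open>
  Among symmetric matrices positive definiteness is an open condition, and symmetry is a closed one.
\<close>

lemma spd_compact_neighbourhood:
  fixes M :: "real^'d^'d::finite"
  assumes "spd M"
  obtains e where "e > 0" "\<And>r. r \<le> e \<Longrightarrow> compact {X \<in> cball M r. spd X}"
proof -
  obtain c where c: "c > 0" "\<And>v. c * (norm v)\<^sup>2 \<le> v \<bullet> (M *v v)" using spd_coercive[OF assms] by blast
  have spdI: "spd X" if X: "transpose X = X" "norm (X - M) \<le> c / 2" for X
  proof -
    have "0 < v \<bullet> (X *v v)" if v: "v \<noteq> 0" for v
    proof -
      have "\<bar>v \<bullet> ((X - M) *v v)\<bar> \<le> norm v * (norm (X - M) * norm v)"
        using Cauchy_Schwarz_ineq2[of v "(X - M) *v v"] norm_matrix_vector_le[of "X - M" v]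
        by (meson mult_left_mono norm_ge_zero order_trans)
      also have "\<dots> \<le> norm v * (c / 2 * norm v)" using X by (intro mult_left_mono mult_right_mono) auto
      also have "\<dots> = c / 2 * (norm v)\<^sup>2" by (simp add: power2_eq_square)
      finally have "- (v \<bullet> ((X - M) *v v)) \<le> c / 2 * (norm v)\<^sup>2" by (rule abs_le_D2)
      moreover have "v \<bullet> ((X - M) *v v) = v \<bullet> (X *v v) - v \<bullet> (M *v v)"
        by (simp add: matrix_vector_mult_diff_rdistrib inner_diff_right)
      ultimately have "v \<bullet> (X *v v) \<ge> c / 2 * (norm v)\<^sup>2"
        using c(2)[of v] by argo
      moreover have "c / 2 * (norm v)\<^sup>2 > 0" using c v by simp
      ultimately show ?thesis by linarith
    qed
    thus ?thesis using X by (simp add: spd_def)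
  qed
  show thesis
  proof (rule that[of "c / 2"])
    fix r assume r: "r \<le> c / 2"
    have eq: "{X \<in> cball M r. spd X} = cball M r \<inter> {X. \<forall>i j. X $ i $ j = X $ j $ i}"
    proof -
      have sym: "transpose X = X \<longleftrightarrow> (\<forall>i j. X $ i $ j = X $ j $ i)" for X :: "real^'d^'d"
        by (auto simp: transpose_def vec_eq_iff)
      have "spd X \<longleftrightarrow> transpose X = X" if "X \<in> cball M r" for X
        using that r spdI[of X] by (auto simp: spd_def dist_norm norm_minus_commute)
      thus ?thesis using sym by blast
    qed
    have "closed {X :: real^'d^'d. \<forall>i j. X $ i $ j = X $ j $ i}"
      by (intro closed_Collect_all closed_Collect_eq continuous_intros)
    thus "compact {X \<in> cball M r. spd X}" unfolding eq by (intro compact_Int_closed) auto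
  qed (use c in auto)
qed


section \<open>Affine changes of variables for Lebesgue integrals\<close>

lemma nn_integral_lborel_plus:
  fixes a :: "'a::euclidean_space"
  assumes [measurable]: "f \<in> borel_measurable borel"
  shows "(\<integral>\<^sup>+x. f (a + x) \<partial>lborel) = (\<integral>\<^sup>+x. f x \<partial>lborel)"
  by (subst (2) lborel_distr_plus[of a, symmetric]) (simp add: nn_integral_distr)

lemma nn_integral_lborel_minus:
  fixes a :: "'a::euclidean_space"
  assumes [measurable]: "f \<in> borel_measurable borel"
  shows "(\<integral>\<^sup>+x. f (a - x) \<partial>lborel) = (\<integral>\<^sup>+x. f x \<partial>lborel)"
proof -
  have "(lborel :: 'a measure) = distr lborel borel (\<lambda>x. a + (-1) *\<^sub>R x)"
    by (subst lborel_affine[of "-1" a]) (simp_all add: density_1)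
  hence "(lborel :: 'a measure) = distr lborel borel (\<lambda>x. a - x)" by simp
  hence "(\<integral>\<^sup>+x. f x \<partial>lborel) = (\<integral>\<^sup>+x. f x \<partial>distr lborel borel (\<lambda>x. a - x))" by metis
  thus ?thesis by (simp add: nn_integral_distr)
qed

text \<open>
  This is the uniqueness argument for Haar measure. Put \<open>T x = A x + b\<close>. Both sides are the double
  integral of \<open>f (T x) g (T x + y)\<close>: for the left-hand side integrate over \<open>y\<close> first, for the right-hand
  side first move \<open>x\<close> by \<open>- B y\<close>, which turns the integrand into \<open>f (T x - y) g (T x)\<close>. With the indicator of
  the unit cube as \<open>g\<close> it follows that the substitution \<open>T\<close> multiplies all integrals by one constant.
\<close>

lemma nn_integral_affine_exchange:
  fixes A B :: "real^'d^'d::finite" and b :: "real^'d"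
  assumes AB: "A ** B = mat 1"
    and [measurable]: "f \<in> borel_measurable borel" "g \<in> borel_measurable borel"
  shows "(\<integral>\<^sup>+x. f (A *v x + b) \<partial>lborel) * (\<integral>\<^sup>+y. g y \<partial>lborel) =
         (\<integral>\<^sup>+x. g (A *v x + b) \<partial>lborel) * (\<integral>\<^sup>+y. f y \<partial>lborel)"
proof -
  define T where "T x = A *v x + b" for x
  have [measurable]: "T \<in> borel_measurable borel" unfolding T_def
    by (intro borel_measurable_continuous_onI continuous_intros)
  have [measurable]: "(*v) B \<in> borel_measurable borel"
    by (intro borel_measurable_continuous_onI continuous_intros)
  have shift: "T (x - B *v y) = T x - y" for x y
  proof -
    have "T (x - B *v y) = A *v (x - B *v y) + b" by (simp add: T_def)
    also have "\<dots> = T x - y" using AB by (simp add: T_def matrix_vector_mult_diff_distrib matrix_vector_mul_assoc)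
    finally show ?thesis .
  qed
  have "(\<integral>\<^sup>+x. f (T x) \<partial>lborel) * (\<integral>\<^sup>+y. g y \<partial>lborel) = (\<integral>\<^sup>+x. f (T x) * (\<integral>\<^sup>+y. g y \<partial>lborel) \<partial>lborel)"
    by (simp add: nn_integral_multc)
  also have "\<dots> = (\<integral>\<^sup>+x. (\<integral>\<^sup>+y. f (T x) * g (T x + y) \<partial>lborel) \<partial>lborel)"
    by (simp add: nn_integral_cmult nn_integral_lborel_plus)
  also have "\<dots> = (\<integral>\<^sup>+y. (\<integral>\<^sup>+x. f (T x) * g (T x + y) \<partial>lborel) \<partial>lborel)"
    by (rule lborel_pair.Fubini') simp
  also have "\<dots> = (\<integral>\<^sup>+y. (\<integral>\<^sup>+x. f (T x - y) * g (T x) \<partial>lborel) \<partial>lborel)"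
  proof (rule nn_integral_cong)
    fix y :: "real^'d"
    have "(\<integral>\<^sup>+x. f (T x) * g (T x + y) \<partial>lborel)
        = (\<integral>\<^sup>+x. (\<lambda>x. f (T x) * g (T x + y)) (- (B *v y) + x) \<partial>lborel)"
      by (rule nn_integral_lborel_plus[symmetric]) simp
    thus "(\<integral>\<^sup>+x. f (T x) * g (T x + y) \<partial>lborel) = (\<integral>\<^sup>+x. f (T x - y) * g (T x) \<partial>lborel)"
      by (simp add: shift)
  qed
  also have "\<dots> = (\<integral>\<^sup>+x. (\<integral>\<^sup>+y. f (T x - y) * g (T x) \<partial>lborel) \<partial>lborel)"
    by (rule lborel_pair.Fubini') simp
  also have "\<dots> = (\<integral>\<^sup>+x. g (T x) \<partial>lborel) * (\<integral>\<^sup>+y. f y \<partial>lborel)"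
    by (simp add: nn_integral_multc nn_integral_lborel_minus) (simp add: nn_integral_cmult mult.commute)
  finally show ?thesis by (simp add: T_def)
qed

text \<open>
  The constant is \<open>1 / |det A|\<close>. Only its positivity matters, because it occurs both in the numerator and
  in the denominator of the quotients of Gaussian integrals.
\<close>

theorem distr_lborel_affine:
  fixes A B :: "real^'d^'d::finite" and b :: "real^'d"
  assumes AB: "A ** B = mat 1"
  shows "\<exists>c>0. distr lborel borel (\<lambda>x. A *v x + b) = density lborel (\<lambda>_. ennreal c)"
proof -
  define T where "T x = A *v x + b" for x
  have BA: "B ** A = mat 1" using AB matrix_left_right_inverse by blast
  have T[measurable]: "T \<in> borel_measurable borel" unfolding T_def
    by (intro borel_measurable_continuous_onI continuous_intros)
  define Q where "Q = cbox (0::real^'d) One"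
  have Q: "emeasure lborel Q = 1" by (simp add: Q_def emeasure_lborel_cbox_eq)
  define c' where "c' = emeasure lborel (T -` Q)"
  have TQ: "T -` Q \<in> sets borel" using measurable_sets[OF T, of Q] by (simp add: Q_def)
  have scale: "(\<integral>\<^sup>+x. f (T x) \<partial>lborel) = c' * (\<integral>\<^sup>+x. f x \<partial>lborel)" if "f \<in> borel_measurable borel" for f
  proof -
    have "(\<integral>\<^sup>+x. indicator Q (T x) \<partial>lborel) = (\<integral>\<^sup>+x. indicator (T -` Q) x \<partial>lborel)"
      by (intro nn_integral_cong) (auto simp: indicator_def)
    also have "\<dots> = c'" using TQ by (simp add: c'_def)
    finally show ?thesis
      using nn_integral_affine_exchange[OF AB that, of "indicator Q" b] Q
      by (simp add: T_def Q_def)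
  qed
  have "T -` Q \<subseteq> (\<lambda>y. B *v (y - b)) ` Q"
  proof
    fix x assume "x \<in> T -` Q"
    moreover have "x = B *v (T x - b)" by (simp add: T_def matrix_vector_mul_assoc BA)
    ultimately show "x \<in> (\<lambda>y. B *v (y - b)) ` Q" by blast
  qed
  moreover have "bounded ((\<lambda>y. B *v (y - b)) ` Q)" unfolding Q_def
    by (intro compact_imp_bounded compact_continuous_image compact_cbox continuous_intros
          continuous_on_compose2[OF matrix_vector_mult_linear_continuous_on[of UNIV B]]) simp
  ultimately have "bounded (T -` Q)" by (rule bounded_subset[rotated])
  hence fin: "c' < \<infinity>" unfolding c'_def by (rule emeasure_bounded_finite)
  \<comment> \<open>The constant function 1 has infinite integral on both sides.\<close>
  have "c' \<noteq> 0" using scale[of "\<lambda>_. 1"] by auto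
  with fin obtain c where c: "c > 0" "c' = ennreal c"
    by (metis ennreal_cases ennreal_0 infinity_ennreal_def order_less_irrefl order_le_less)
  have "distr lborel borel T = density lborel (\<lambda>_. ennreal c)"
  proof (rule measure_eqI)
    fix S assume "S \<in> sets (distr lborel borel T)"
    hence S[measurable]: "S \<in> sets borel" by simp
    have "emeasure (distr lborel borel T) S = (\<integral>\<^sup>+x. indicator S x \<partial>distr lborel borel T)" by simp
    also have "\<dots> = (\<integral>\<^sup>+x. indicator S (T x) \<partial>lborel)" by (rule nn_integral_distr) simp_all
    also have "\<dots> = c' * emeasure lborel S" by (simp add: scale)
    also have "\<dots> = emeasure (density lborel (\<lambda>_. ennreal c)) S"
      by (simp add: c emeasure_density nn_integral_cmult)
    finally show "emeasure (distr lborel borel T) S = emeasure (density lborel (\<lambda>_. ennreal c)) S" .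
  qed simp
  thus ?thesis using c(1) unfolding T_def by blast
qed

theorem lebesgue_affine_matrix:
  fixes A :: "real^'d^'d::finite" and b :: "real^'d"
  assumes "invertible A"
  shows "(\<lambda>x. A *v x + b) \<in> lebesgue \<rightarrow>\<^sub>M lebesgue"
    and "\<exists>c>0. distr lebesgue lebesgue (\<lambda>x. A *v x + b) = density lebesgue (\<lambda>_. ennreal c)"
proof -
  define T where "T x = A *v x + b" for x
  obtain B where "A ** B = mat 1" using assms unfolding invertible_def by blast
  from distr_lborel_affine[OF this, of b] obtain c where c: "c > 0"
    "distr lborel borel T = density lborel (\<lambda>_. ennreal c)" unfolding T_def by blast
  have [measurable]: "T \<in> borel_measurable borel" unfolding T_def
    by (intro borel_measurable_continuous_onI continuous_intros)
  have dl: "distr lebesgue lborel T = density lborel (\<lambda>_. ennreal c)"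
    using c(2) by (simp add: distr_completion cong: distr_cong)
  have null: "null_sets (distr lebesgue lborel T) = null_sets lborel"
    unfolding dl using c(1) by (auto simp: null_sets_def emeasure_density nn_integral_cmult)
  show "(\<lambda>x. A *v x + b) \<in> lebesgue \<rightarrow>\<^sub>M lebesgue"
    unfolding T_def[symmetric] by (rule completion.measurable_completion2) (simp_all add: null measurable_completion)
  have "distr lebesgue lebesgue T = completion (distr lebesgue lborel T)"
    by (rule completion.completion_distr_eq[symmetric]) (simp_all add: null measurable_completion)
  also have "\<dots> = density lebesgue (\<lambda>_. ennreal c)"
    unfolding dl using c(1) by (intro completion_density_eq) auto
  finally show "\<exists>c>0. distr lebesgue lebesgue (\<lambda>x. A *v x + b) = density lebesgue (\<lambda>_. ennreal c)"
    using c(1) unfolding T_def by blast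
qed

corollary lebesgue_affine_change_of_variables:
  fixes A :: "real^'d^'d::finite" and b :: "real^'d"
  assumes "invertible A"
  shows "\<exists>c>0. \<forall>f::real^'d \<Rightarrow> real. f \<in> borel_measurable lebesgue \<longrightarrow>
    (\<integral>x. f (A *v x + b) \<partial>lebesgue) = c * (\<integral>x. f x \<partial>lebesgue) \<and>
    (integrable lebesgue (\<lambda>x. f (A *v x + b)) \<longleftrightarrow> integrable lebesgue f)"
proof -
  obtain c where c: "c > 0"
    "distr lebesgue lebesgue (\<lambda>x. A *v x + b) = density lebesgue (\<lambda>_. ennreal c)"
    using lebesgue_affine_matrix(2)[OF assms] by blast
  note T = lebesgue_affine_matrix(1)[OF assms, of b]
  have "(\<integral>x. f (A *v x + b) \<partial>lebesgue) = c * (\<integral>x. f x \<partial>lebesgue)"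
    and "integrable lebesgue (\<lambda>x. f (A *v x + b)) \<longleftrightarrow> integrable lebesgue f"
    if f: "f \<in> borel_measurable lebesgue" for f :: "real^'d \<Rightarrow> real"
  proof -
    have "(\<integral>x. f (A *v x + b) \<partial>lebesgue) = (\<integral>x. f x \<partial>distr lebesgue lebesgue (\<lambda>x. A *v x + b))"
      by (rule integral_distr[symmetric, OF T f])
    thus "(\<integral>x. f (A *v x + b) \<partial>lebesgue) = c * (\<integral>x. f x \<partial>lebesgue)"
      unfolding c(2) using c(1) f by (subst (asm) integral_density) auto
    have "integrable lebesgue (\<lambda>x. f (A *v x + b)) \<longleftrightarrow> integrable (distr lebesgue lebesgue (\<lambda>x. A *v x + b)) f"
      by (rule integrable_distr_eq[symmetric, OF T f])
    thus "integrable lebesgue (\<lambda>x. f (A *v x + b)) \<longleftrightarrow> integrable lebesgue f"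
      unfolding c(2) using c(1) f by (subst (asm) integrable_density) auto
  qed
  thus ?thesis using c(1) by blast
qed

text \<open>
  The unit cube and its translates have volume 1, so the constant of the affine substitution is 1.
\<close>

lemma lebesgue_integral_translate:
  fixes f :: "real^'d::finite \<Rightarrow> real"
  assumes "f \<in> borel_measurable lebesgue"
  shows "(\<integral>x. f (x + b) \<partial>lebesgue) = (\<integral>x. f x \<partial>lebesgue)"
    and "integrable lebesgue (\<lambda>x. f (x + b)) \<longleftrightarrow> integrable lebesgue f"
proof -
  obtain c where c: "c > 0" "\<And>f::real^'d \<Rightarrow> real. f \<in> borel_measurable lebesgue \<Longrightarrow>
    (\<integral>x. f (x + b) \<partial>lebesgue) = c * (\<integral>x. f x \<partial>lebesgue) \<and>
    (integrable lebesgue (\<lambda>x. f (x + b)) \<longleftrightarrow> integrable lebesgue f)"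
    using lebesgue_affine_change_of_variables[of "mat 1 :: real^'d^'d" b] 
    by (auto simp: spd_invertible spd_mat_1)
  define Q where "Q = cbox (0::real^'d) One"
  have Q: "measure lebesgue Q = 1" by (simp add: Q_def content_cbox_if)
  have "(\<integral>x. indicat_real Q (x + b) \<partial>lebesgue) = (\<integral>x. indicat_real ((+) (- b) ` Q) x \<partial>lebesgue)"
    by (intro Bochner_Integration.integral_cong) (auto simp: indicator_def image_iff algebra_simps)
  also have "\<dots> = measure lebesgue ((+) (- b) ` Q)"
    by (simp add: Q_def cbox_translation[symmetric])
  also have "\<dots> = 1" using Q measure_translation[of "- b" Q] by simp
  finally have "(\<integral>x. indicat_real Q (x + b) \<partial>lebesgue) = 1" .
  moreover have "indicat_real Q \<in> borel_measurable lebesgue"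
    by (intro borel_measurable_indicator) (simp add: Q_def)
  ultimately have "c = 1" using c(2)[of "indicat_real Q"] Q by (simp add: Q_def)
  with c(2)[OF assms] show "(\<integral>x. f (x + b) \<partial>lebesgue) = (\<integral>x. f x \<partial>lebesgue)"
    and "integrable lebesgue (\<lambda>x. f (x + b)) \<longleftrightarrow> integrable lebesgue f" by auto
qed


section \<open>Test functions and the fundamental lemma of the calculus of variations\<close>

text \<open>
  The derivatives of \<open>exp (- 1 / t)\<close>, extended by zero to \<open>t \<le> 0\<close>, are linear combinations of these functions.
  Having all of them at hand makes the class of functions below closed under differentiation.
\<close>

definition flat :: "nat \<Rightarrow> real \<Rightarrow> real" where
  "flat k t = (if t \<le> 0 then 0 else exp (- (1 / t)) / t ^ k)"

lemma flat_tendsto_0: "(flat k \<longlongrightarrow> 0) (at 0)"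
proof -
  have "((\<lambda>x. x ^ k / exp x) \<longlongrightarrow> (0::real)) at_top" by (rule tendsto_power_div_exp_0)
  hence "((\<lambda>t. (inverse t) ^ k / exp (inverse t)) \<longlongrightarrow> (0::real)) (at_right 0)"
    by (rule filterlim_compose[OF _ filterlim_inverse_at_top_right])
  moreover have "eventually (\<lambda>t. (inverse t) ^ k / exp (inverse t) = flat k t) (at_right (0::real))"
    by (auto simp: eventually_at_right_less flat_def exp_minus divide_simps power_inverse
        intro!: eventually_at_rightI[of 0 1])
  ultimately have r: "(flat k \<longlongrightarrow> 0) (at_right 0)" by (rule Lim_transform_eventually)
  have "eventually (\<lambda>t. 0 = flat k t) (at_left (0::real))"
    by (auto simp: flat_def intro!: eventually_at_leftI[of "-1" 0])
  hence l: "(flat k \<longlongrightarrow> 0) (at_left 0)" by (rule Lim_transform_eventually[OF tendsto_const])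
  show ?thesis using l r by (simp add: filterlim_split_at)
qed

lemma flat_deriv: "(flat k has_real_derivative flat (k + 2) t - real k * flat (k + 1) t) (at t)"
proof -
  consider "t < 0" | "t = 0" | "t > 0" by linarith
  then show ?thesis
  proof cases
    case 1
    have "((\<lambda>_. 0) has_real_derivative 0) (at t)" by simp
    hence "(flat k has_real_derivative 0) (at t)"
      by (rule DERIV_cong_ev[THEN iffD1, rotated -1])
         (use 1 in \<open>auto simp: flat_def eventually_nhds intro!: exI[of _ "{..<0}"]\<close>)
    thus ?thesis using 1 by (simp add: flat_def)
  next
    case 2
    have "((\<lambda>h. flat (k + 1) h) \<longlongrightarrow> 0) (at 0)" by (rule flat_tendsto_0)
    moreover have "flat (k + 1) h = (flat k (0 + h) - flat k 0) / h" if "h \<noteq> 0" for h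
      using that by (simp add: flat_def)
    ultimately have "((\<lambda>h. (flat k (0 + h) - flat k 0) / h) \<longlongrightarrow> 0) (at 0)"
      by (elim Lim_transform_eventually) (auto simp: eventually_at_filter)
    thus ?thesis using 2 by (simp add: DERIV_def flat_def)
  next
    case 3
    have "((\<lambda>t. exp (- (1 / t)) / t ^ k) has_real_derivative
        exp (- (1 / t)) / t ^ (k + 2) - real k * (exp (- (1 / t)) / t ^ (k + 1))) (at t)"
    proof -
      have e: "((\<lambda>t. exp (- (1 / t))) has_real_derivative exp (- (1 / t)) / t\<^sup>2) (at t)"
        using 3 by (auto intro!: derivative_eq_intros simp: power2_eq_square)
      have "t ^ k \<noteq> 0" using 3 by simp
      from DERIV_divide[OF e DERIV_pow[of k t] this] show ?thesis
        by (rule DERIV_cong) (use 3 in \<open>cases k; simp add: divide_simps; simp add: algebra_simps power2_eq_square\<close>)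
    qed
    hence "(flat k has_real_derivative
        exp (- (1 / t)) / t ^ (k + 2) - real k * (exp (- (1 / t)) / t ^ (k + 1))) (at t)"
      by (rule DERIV_cong_ev[THEN iffD1, rotated -1])
         (use 3 in \<open>auto simp: flat_def eventually_nhds intro!: exI[of _ "{0<..}"]\<close>)
    thus ?thesis using 3 by (simp add: flat_def)
  qed
qed

text \<open>
  Closure under directional derivatives makes every member smooth, without a calculus of higher
  derivatives of compositions.
\<close>

inductive flat_algebra :: "('a::euclidean_space \<Rightarrow> real) \<Rightarrow> bool" where
  const: "flat_algebra (\<lambda>x. c)"
| flat: "flat_algebra (\<lambda>x. flat k (u \<bullet> x + c))"
| add: "flat_algebra f \<Longrightarrow> flat_algebra g \<Longrightarrow> flat_algebra (\<lambda>x. f x + g x)"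
| mult: "flat_algebra f \<Longrightarrow> flat_algebra g \<Longrightarrow> flat_algebra (\<lambda>x. f x * g x)"

lemma flat_algebra_derivative:
  "flat_algebra f \<Longrightarrow>
    \<exists>D. (\<forall>x. (f has_derivative D x) (at x)) \<and> (\<forall>v. flat_algebra (\<lambda>x. D x v))"
proof (induction rule: flat_algebra.induct)
  case (const c)
  show ?case by (intro exI[of _ "\<lambda>x v. 0"]) (auto intro: flat_algebra.const)
next
  case (flat k u c)
  let ?D = "\<lambda>x v. (u \<bullet> v) * (flat (k + 2) (u \<bullet> x + c) + (- real k) * flat (k + 1) (u \<bullet> x + c))"
  have "((\<lambda>x. flat k (u \<bullet> x + c)) has_derivative ?D x) (at x)" for x
  proof -
    have "((\<lambda>x. u \<bullet> x + c) has_derivative (\<lambda>v. u \<bullet> v)) (at x)"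
      by (auto intro!: derivative_eq_intros)
    from has_derivative_compose[OF this flat_deriv[unfolded has_field_derivative_def]]
    show ?thesis by (rule has_derivative_eq_rhs) (auto simp: fun_eq_iff algebra_simps)
  qed
  moreover have "flat_algebra (\<lambda>x. ?D x v)" for v
    by (intro flat_algebra.intros)
  ultimately show ?case by (intro exI[of _ ?D]) blast
next
  case (add f g)
  then obtain D E where D: "\<And>x. (f has_derivative D x) (at x)" "\<And>v. flat_algebra (\<lambda>x. D x v)"
    and E: "\<And>x. (g has_derivative E x) (at x)" "\<And>v. flat_algebra (\<lambda>x. E x v)" by blast
  show ?case using D E
    by (intro exI[of _ "\<lambda>x v. D x v + E x v"]) (auto intro!: derivative_intros flat_algebra.add)
next
  case (mult f g)
  then obtain D E where D: "\<And>x. (f has_derivative D x) (at x)" "\<And>v. flat_algebra (\<lambda>x. D x v)"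
    and E: "\<And>x. (g has_derivative E x) (at x)" "\<And>v. flat_algebra (\<lambda>x. E x v)" by blast
  show ?case using D E mult.hyps
    by (intro exI[of _ "\<lambda>x v. f x * E x v + D x v * g x"])
       (auto intro!: derivative_intros flat_algebra.add flat_algebra.mult)
qed

lemma flat_algebra_C_k: "flat_algebra f \<Longrightarrow> C_k k f"
proof (induction k arbitrary: f)
  case 0
  from flat_algebra_derivative[OF 0] obtain D where "\<And>x. (f has_derivative D x) (at x)" by blast
  thus ?case by (auto intro!: continuous_at_imp_continuous_on has_derivative_continuous)
next
  case (Suc k)
  from flat_algebra_derivative[OF Suc.prems] obtain D
    where D: "\<And>x. (f has_derivative D x) (at x)" "\<And>v. flat_algebra (\<lambda>x. D x v)" by blast
  have "frechet_derivative f (at x) = D x" for x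
    using frechet_derivative_at[OF D(1)] by metis
  moreover have "f differentiable_on UNIV"
    using D(1) by (auto simp: differentiable_on_def differentiable_def)
  ultimately show ?case using Suc.IH[OF D(2)] by simp
qed

lemma flat_algebra_prod:
  "finite I \<Longrightarrow> (\<And>i. i \<in> I \<Longrightarrow> flat_algebra (f i)) \<Longrightarrow> flat_algebra (\<lambda>x. \<Prod>i\<in>I. f i x)"
  by (induction I rule: finite_induct) (auto intro: flat_algebra.const flat_algebra.mult)

text \<open>
  Inside the box all factors tend to 1 as \<open>n\<close> grows; at a point outside the box one factor is zero.
\<close>

definition box_approx :: "'a::euclidean_space \<Rightarrow> 'a \<Rightarrow> nat \<Rightarrow> 'a \<Rightarrow> real" where
  "box_approx a b n x = (\<Prod>i\<in>Basis. flat 0 (real (Suc n) * (x \<bullet> i - a \<bullet> i)) * flat 0 (real (Suc n) * (b \<bullet> i - x \<bullet> i)))"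

lemma flat_0_bounds: "0 \<le> flat 0 t" "flat 0 t \<le> 1"
  by (auto simp: flat_def)

lemma box_approx_eq_0: "x \<notin> box a b \<Longrightarrow> box_approx a b n x = 0"
  by (auto simp: box_approx_def mem_box flat_def not_less mult_le_0_iff intro!: prod_zero)

lemma box_approx_bounds: "0 \<le> box_approx a b n x" "box_approx a b n x \<le> 1"
  unfolding box_approx_def by (auto intro!: prod_nonneg prod_le_1 mult_nonneg_nonneg mult_le_one flat_0_bounds)

lemma test_function_box_approx: "test_function (box_approx a b n)"
  unfolding test_function_def
proof (intro conjI allI)
  fix k
  have "flat_algebra (\<lambda>x. flat 0 (real (Suc n) * (x \<bullet> i - a \<bullet> i)))" for i
    using flat_algebra.flat[of 0 "real (Suc n) *\<^sub>R i" "- real (Suc n) * (a \<bullet> i)"]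
    by (simp add: inner_commute algebra_simps)
  moreover have "flat_algebra (\<lambda>x. flat 0 (real (Suc n) * (b \<bullet> i - x \<bullet> i)))" for i
    using flat_algebra.flat[of 0 "- (real (Suc n) *\<^sub>R i)" "real (Suc n) * (b \<bullet> i)"]
    by (simp add: inner_commute algebra_simps)
  ultimately show "C_k k (box_approx a b n)"
    unfolding box_approx_def by (intro flat_algebra_C_k flat_algebra_prod flat_algebra.mult) auto
  have "closure {x. box_approx a b n x \<noteq> 0} \<subseteq> cbox a b"
  proof (rule closure_minimal)
    show "{x. box_approx a b n x \<noteq> 0} \<subseteq> cbox a b"
      using box_approx_eq_0[of _ a b n] box_subset_cbox[of a b] by blast
  qed (rule closed_cbox)
  thus "compact (closure {x. box_approx a b n x \<noteq> 0})"
    using compact_Int_closed[OF compact_cbox[of a b] closed_closure] by (metis inf.absorb_iff2)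
qed

lemma box_approx_tendsto: "(\<lambda>n. box_approx a b n x) \<longlonglongrightarrow> indicator (box a b) x"
proof (cases "x \<in> box a b")
  case True
  have lim: "(\<lambda>n. flat 0 (real (Suc n) * t)) \<longlonglongrightarrow> 1" if "t > 0" for t
  proof -
    have "(\<lambda>n. exp (- ((1 / t) * inverse (real (Suc n))))) \<longlonglongrightarrow> exp (- ((1 / t) * 0))"
      by (intro tendsto_intros LIMSEQ_inverse_real_of_nat)
    moreover have "flat 0 (real (Suc n) * t) = exp (- ((1 / t) * inverse (real (Suc n))))" for n
      using that by (simp add: flat_def mult_le_0_iff divide_simps)
    ultimately show ?thesis by simp
  qed
  have "(\<lambda>n. box_approx a b n x) \<longlonglongrightarrow> (\<Prod>i\<in>(Basis::'a set). 1 * 1)"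
    unfolding box_approx_def using True by (intro tendsto_prod tendsto_mult lim) (auto simp: mem_box)
  thus ?thesis using True by simp
qed (simp add: box_approx_eq_0)

text \<open>
  The positive and the negative part of \<open>g\<close> are densities of finite measures that agree on open boxes.
  These form an intersection-stable generator of the Borel sets, so the measures are equal.
\<close>

lemma AE_eq_0_if_box_integrals_0:
  fixes g :: "'a::euclidean_space \<Rightarrow> real"
  assumes g: "integrable lborel g"
    and zero: "\<And>a b. (\<integral>x\<in>box a b. g x \<partial>lborel) = 0"
  shows "AE x in lborel. g x = 0"
proof -
  have [measurable]: "g \<in> borel_measurable borel" using g by simp
  define M N where "M = density lborel (\<lambda>x. ennreal (g x))" and "N = density lborel (\<lambda>x. ennreal (- g x))"
  have emM: "emeasure M S = ennreal (\<integral>x. indicator S x * max 0 (g x) \<partial>lborel)"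
    and emN: "emeasure N S = ennreal (\<integral>x. indicator S x * max 0 (- g x) \<partial>lborel)"
    and int: "integrable lborel (\<lambda>x. indicator S x * max 0 (g x))" "integrable lborel (\<lambda>x. indicator S x * max 0 (- g x))"
    if [measurable]: "S \<in> sets borel" for S
  proof -
    show *: "integrable lborel (\<lambda>x. indicator S x * max 0 (g x))"
      by (rule Bochner_Integration.integrable_bound[OF g]) (auto simp: indicator_def)
    show **: "integrable lborel (\<lambda>x. indicator S x * max 0 (- g x))"
      by (rule Bochner_Integration.integrable_bound[OF g]) (auto simp: indicator_def)
    have "emeasure M S = (\<integral>\<^sup>+x. ennreal (indicator S x * max 0 (g x)) \<partial>lborel)"
      unfolding M_def by (subst emeasure_density) (auto intro!: nn_integral_cong simp: indicator_def max_def ennreal_neg)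
    thus "emeasure M S = ennreal (\<integral>x. indicator S x * max 0 (g x) \<partial>lborel)"
      by (subst nn_integral_eq_integral[symmetric, OF *]) (auto simp: indicator_def)
    have "emeasure N S = (\<integral>\<^sup>+x. ennreal (indicator S x * max 0 (- g x)) \<partial>lborel)"
      unfolding N_def by (subst emeasure_density) (auto intro!: nn_integral_cong simp: indicator_def max_def ennreal_neg)
    thus "emeasure N S = ennreal (\<integral>x. indicator S x * max 0 (- g x) \<partial>lborel)"
      by (subst nn_integral_eq_integral[symmetric, OF **]) (auto simp: indicator_def)
  qed
  have diff: "(\<integral>x. indicator S x * g x \<partial>lborel) =
      (\<integral>x. indicator S x * max 0 (g x) \<partial>lborel) - (\<integral>x. indicator S x * max 0 (- g x) \<partial>lborel)"
    if [measurable]: "S \<in> sets borel" for S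
    by (subst Bochner_Integration.integral_diff[symmetric, OF int[OF that]])
       (auto intro!: Bochner_Integration.integral_cong simp: indicator_def)
  have "M = N"
  proof (rule measure_eqI_generator_eq)
    show "Int_stable (range (\<lambda>(a, b). box a (b::'a)))"
      by (auto simp: Int_stable_def box_Int_box)
    show "range (\<lambda>(a, b). box a (b::'a)) \<subseteq> Pow UNIV" by simp
    show "sets M = sigma_sets UNIV (range (\<lambda>(a, b). box a (b::'a)))"
      "sets N = sigma_sets UNIV (range (\<lambda>(a, b). box a (b::'a)))"
      by (simp_all add: M_def N_def borel_eq_box)
    show "range (\<lambda>n::nat. box (- (real n *\<^sub>R One)) (real n *\<^sub>R One :: 'a)) \<subseteq> range (\<lambda>(a, b). box a b)" by auto
    show "(\<Union>n::nat. box (- (real n *\<^sub>R One)) (real n *\<^sub>R One :: 'a)) = UNIV" by (rule UN_box_eq_UNIV)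
    show "emeasure M (box (- (real n *\<^sub>R One)) (real n *\<^sub>R One :: 'a)) \<noteq> \<infinity>" for n by (simp add: emM)
    fix X assume "X \<in> range (\<lambda>(a, b). box a (b::'a))"
    then obtain a b where "X = box a b" by auto
    with zero[of a b] show "emeasure M X = emeasure N X"
      using diff[of X] by (simp add: emM emN set_lebesgue_integral_def)
  qed
  have "(\<integral>x\<in>S. g x \<partial>lborel) = (\<integral>x\<in>S. 0 \<partial>lborel)" if S: "S \<in> sets lborel" for S
  proof -
    have S': "S \<in> sets borel" using S by simp
    have "ennreal (\<integral>x. indicator S x * max 0 (g x) \<partial>lborel) = ennreal (\<integral>x. indicator S x * max 0 (- g x) \<partial>lborel)"
      using \<open>M = N\<close> emM[OF S'] emN[OF S'] by metis
    hence "(\<integral>x. indicator S x * max 0 (g x) \<partial>lborel) = (\<integral>x. indicator S x * max 0 (- g x) \<partial>lborel)"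
      by (subst (asm) ennreal_inj) (auto intro!: integral_nonneg_AE)
    thus ?thesis using diff[OF S'] by (simp add: set_lebesgue_integral_def)
  qed
  thus ?thesis using g by (intro density_unique_real) auto
qed

text \<open>
  Dominated convergence along \<^const>\<open>box_approx\<close> shows that \<open>g\<close> has integral zero over every box. As \<open>g\<close> need
  be neither integrable nor Borel measurable, the conclusion is drawn on each of the boxes that exhaust the
  space, for a Borel function that agrees with \<open>g\<close> almost everywhere there.
\<close>

theorem fundamental_lemma_calculus_of_variations:
  fixes g :: "'a::euclidean_space \<Rightarrow> real"
  assumes g: "locally_integrable g"
    and zero: "\<And>\<phi>. test_function \<phi> \<Longrightarrow> (\<integral>x. g x * \<phi> x \<partial>lebesgue) = 0"
  shows "AE x in lebesgue. g x = 0"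
proof -
  have int: "integrable lebesgue (\<lambda>x. indicator (cbox a b) x * g x)" for a b
    using g by (auto simp: locally_integrable_def set_integrable_def)
  have int': "integrable lebesgue (\<lambda>x. indicator (box a b) x * g x)" for a b
  proof -
    have "integrable lebesgue (\<lambda>x. indicator (box a b) x * (indicator (cbox a b) x * g x))"
      using integrable_mult_indicator[OF _ int[of a b], of "box a b"] by simp
    moreover have "indicator (box a b) x * (indicator (cbox a b) x * g x) = indicator (box a b) x * g x" for x
      using box_subset_cbox[of a b] by (auto simp: indicator_def)
    ultimately show ?thesis by simp
  qed
  have box0: "(\<integral>x. indicator (box a b) x * g x \<partial>lebesgue) = 0" for a b
  proof -
    have meas: "(\<lambda>x. box_approx a b n x * g x) \<in> borel_measurable lebesgue" for n
    proof -
      have "continuous_on UNIV (box_approx a b n)"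
        using test_function_box_approx[of a b n] unfolding test_function_def by (metis C_k.simps(1))
      hence "box_approx a b n \<in> borel_measurable borel" by (rule borel_measurable_continuous_onI)
      hence [measurable]: "box_approx a b n \<in> borel_measurable lebesgue" by (simp add: measurable_completion)
      have [measurable]: "(\<lambda>x. indicator (box a b) x * g x) \<in> borel_measurable lebesgue" using int' by simp
      have "(\<lambda>x. box_approx a b n x * (indicator (box a b) x * g x)) \<in> borel_measurable lebesgue" by measurable
      moreover have "box_approx a b n x * (indicator (box a b) x * g x) = box_approx a b n x * g x" for x
        by (cases "x \<in> box a b") (auto simp: box_approx_eq_0)
      ultimately show ?thesis by simp
    qed
    have "(\<lambda>n. \<integral>x. box_approx a b n x * g x \<partial>lebesgue) \<longlonglongrightarrow> (\<integral>x. indicator (box a b) x * g x \<partial>lebesgue)"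
    proof (rule integral_dominated_convergence[where w = "\<lambda>x. norm (indicator (box a b) x * g x)"])
      show "AE x in lebesgue. (\<lambda>n. box_approx a b n x * g x) \<longlonglongrightarrow> indicator (box a b) x * g x"
        by (intro AE_I2 tendsto_mult box_approx_tendsto tendsto_const)
      show "AE x in lebesgue. norm (box_approx a b n x * g x) \<le> norm (indicator (box a b) x * g x)" for n
      proof (rule AE_I2)
        fix x show "norm (box_approx a b n x * g x) \<le> norm (indicator (box a b) x * g x)"
          using box_approx_bounds[of a b n x]
          by (cases "x \<in> box a b") (auto simp: box_approx_eq_0 abs_mult intro: mult_left_le_one_le)
      qed
    qed (use int' meas in \<open>auto intro: integrable_norm borel_measurable_integrable\<close>)
    moreover have "(\<integral>x. box_approx a b n x * g x \<partial>lebesgue) = 0" for n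
      using zero[OF test_function_box_approx[of a b n]] by (simp add: mult.commute)
    ultimately show ?thesis by (simp add: LIMSEQ_const_iff)
  qed
  have "AE x in lebesgue. x \<in> box (- (real n *\<^sub>R One)) (real n *\<^sub>R One) \<longrightarrow> g x = 0" for n
  proof -
    let ?C = "box (- (real n *\<^sub>R One)) (real n *\<^sub>R One) :: 'a set"
    have "(\<lambda>x. indicator ?C x * g x) \<in> borel_measurable (completion lborel)" using int' by simp
    from completion_ex_borel_measurable_real[OF this]
    obtain h where h[measurable]: "h \<in> borel_measurable lborel" and ae: "AE x in lborel. indicator ?C x * g x = h x" by blast
    have ae': "AE x in lebesgue. indicator ?C x * g x = h x" using ae by (rule AE_completion)
    have hm[measurable]: "h \<in> borel_measurable lebesgue" using h by (simp add: measurable_completion)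
    have "integrable lebesgue h"
      using int'[of "- (real n *\<^sub>R One)" "real n *\<^sub>R One"] ae' by (subst integrable_cong_AE[symmetric]) auto
    hence "integrable lborel h" by (simp add: integrable_completion)
    moreover have "(\<integral>x\<in>box a b. h x \<partial>lborel) = 0" for a b
    proof -
      have "(\<integral>x\<in>box a b. h x \<partial>lborel) = (\<integral>x. indicator (box a b) x * h x \<partial>lebesgue)"
        by (simp add: set_lebesgue_integral_def integral_completion)
      also have "\<dots> = (\<integral>x. indicator (box a b \<inter> ?C) x * g x \<partial>lebesgue)"
      proof (rule integral_cong_AE)
        show "AE x in lebesgue. indicator (box a b) x * h x = indicator (box a b \<inter> ?C) x * g x"
          using ae' by eventually_elim (auto simp: indicator_inter_arith)
        show "(\<lambda>x. indicator (box a b \<inter> ?C) x * g x) \<in> borel_measurable lebesgue"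
          unfolding box_Int_box using int' by (intro borel_measurable_integrable) auto
        show "(\<lambda>x. indicator (box a b) x * h x) \<in> borel_measurable lebesgue"
          by (intro borel_measurable_times borel_measurable_indicator hm) simp
      qed
      also have "\<dots> = 0" unfolding box_Int_box by (rule box0)
      finally show ?thesis .
    qed
    ultimately have "AE x in lborel. h x = 0" by (rule AE_eq_0_if_box_integrals_0)
    hence "AE x in lebesgue. h x = 0" by (rule AE_completion)
    with ae' show ?thesis by eventually_elim auto
  qed
  hence "AE x in lebesgue. \<forall>n::nat. x \<in> box (- (real n *\<^sub>R One)) (real n *\<^sub>R One) \<longrightarrow> g x = 0"
    by (rule AE_all_countable[THEN iffD2, rule_format])
  thus ?thesis
  proof eventually_elim
    case (elim x)
    have "x \<in> (\<Union>n::nat. box (- (real n *\<^sub>R One)) (real n *\<^sub>R One))" by (simp add: UN_box_eq_UNIV)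
    thus ?case using elim by blast
  qed
qed


section \<open>Square integrable functions\<close>

lemma square_integrable_measurable: "square_integrable u \<Longrightarrow> u \<in> borel_measurable lebesgue"
  by (simp add: square_integrable_def)

lemma square_integrable_mult:
  assumes "square_integrable u" "square_integrable v"
  shows "integrable lebesgue (\<lambda>x. u x * v x)"
proof (rule Bochner_Integration.integrable_bound[where f = "\<lambda>x. (u x)\<^sup>2 + (v x)\<^sup>2"])
  show "integrable lebesgue (\<lambda>x. (u x)\<^sup>2 + (v x)\<^sup>2)"
    using assms by (simp add: square_integrable_def)
  show "(\<lambda>x. u x * v x) \<in> borel_measurable lebesgue"
    by (intro borel_measurable_times square_integrable_measurable assms)
  have "\<bar>a * b\<bar> \<le> a\<^sup>2 + b\<^sup>2" for a b :: real
  proof -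
    have "0 \<le> (\<bar>a\<bar> - \<bar>b\<bar>)\<^sup>2" by simp
    hence "2 * (\<bar>a\<bar> * \<bar>b\<bar>) \<le> a\<^sup>2 + b\<^sup>2" by (simp add: power2_diff)
    moreover have "0 \<le> \<bar>a\<bar> * \<bar>b\<bar>" by simp
    ultimately show ?thesis unfolding abs_mult by linarith
  qed
  thus "AE x in lebesgue. norm (u x * v x) \<le> norm ((u x)\<^sup>2 + (v x)\<^sup>2)" by auto
qed

lemma square_integrable_scale: "square_integrable u \<Longrightarrow> square_integrable (\<lambda>x. c * u x)"
  by (auto simp: square_integrable_def power_mult_distrib intro: borel_measurable_times)

lemma square_integrable_add:
  assumes "square_integrable u" "square_integrable v"
  shows "square_integrable (\<lambda>x. u x + v x)"
  unfolding square_integrable_def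
proof
  show "(\<lambda>x. u x + v x) \<in> borel_measurable lebesgue"
    by (intro borel_measurable_add square_integrable_measurable assms)
  have "integrable lebesgue (\<lambda>x. (u x)\<^sup>2 + (v x)\<^sup>2 + 2 * (u x * v x))"
    using assms square_integrable_mult[OF assms] by (simp add: square_integrable_def)
  thus "integrable lebesgue (\<lambda>x. (u x + v x)\<^sup>2)"
    by (simp add: power2_sum mult.assoc)
qed

lemma square_integrable_sum:
  "finite I \<Longrightarrow> (\<And>i. i \<in> I \<Longrightarrow> square_integrable (u i)) \<Longrightarrow> square_integrable (\<lambda>x. \<Sum>i\<in>I. u i x)"
proof (induction I rule: finite_induct)
  case empty
  show ?case by (simp add: square_integrable_def)
next
  case (insert i I)
  thus ?case by (simp add: square_integrable_add)
qed

lemma borel_measurable_lebesgue_affine: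
  fixes A :: "real^'d^'d::finite"
  assumes "invertible A" "f \<in> borel_measurable lebesgue"
  shows "(\<lambda>x. f (A *v x + b)) \<in> borel_measurable lebesgue"
  using measurable_compose[OF lebesgue_affine_matrix(1)[OF assms(1)] assms(2)] .

lemma integrable_lebesgue_affine:
  fixes A :: "real^'d^'d::finite" and f :: "real^'d \<Rightarrow> real"
  assumes "invertible A" "integrable lebesgue f"
  shows "integrable lebesgue (\<lambda>x. f (A *v x + b))"
proof -
  have "f \<in> borel_measurable lebesgue" using assms(2) by simp
  thus ?thesis using lebesgue_affine_change_of_variables[OF assms(1), of b] assms(2) by blast
qed

lemma square_integrable_affine:
  fixes A :: "real^'d^'d::finite"
  assumes "invertible A" "square_integrable u"
  shows "square_integrable (\<lambda>x. u (A *v x + b))"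
  using assms integrable_lebesgue_affine[of A "\<lambda>x. (u x)\<^sup>2" b] borel_measurable_lebesgue_affine[of A u b]
  by (simp add: square_integrable_def)

section \<open>Calculus of test functions\<close>

lemma test_function_continuous:
  assumes "test_function \<phi>"
  shows "continuous_on UNIV \<phi>"
proof -
  have "C_k 0 \<phi>" using assms unfolding test_function_def by blast
  thus ?thesis by simp
qed

lemma test_function_has_derivative:
  assumes "test_function \<phi>"
  shows "(\<phi> has_derivative frechet_derivative \<phi> (at x)) (at x)"
proof -
  have "C_k (Suc 0) \<phi>" using assms unfolding test_function_def by blast
  thus ?thesis by (simp add: differentiable_on_def frechet_derivative_works[symmetric])
qed

lemma test_function_derivative:
  assumes "test_function \<phi>"
  shows "test_function (\<lambda>x. frechet_derivative \<phi> (at x) v)"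
  unfolding test_function_def
proof
  show "\<forall>k. C_k k (\<lambda>x. frechet_derivative \<phi> (at x) v)"
  proof
    fix k
    have "C_k (Suc k) \<phi>" using assms unfolding test_function_def by blast
    thus "C_k k (\<lambda>x. frechet_derivative \<phi> (at x) v)" by simp
  qed
  have "frechet_derivative \<phi> (at x) v = 0" if x: "x \<notin> closure {x. \<phi> x \<noteq> 0}" for x
  proof -
    have "eventually (\<lambda>y. y \<in> - closure {x. \<phi> x \<noteq> 0}) (nhds x)"
      using x by (intro eventually_nhds_in_open) auto
    hence "eventually (\<lambda>y. 0 = \<phi> y) (nhds x)"
      by eventually_elim (use closure_subset[of "{x. \<phi> x \<noteq> 0}"] in auto)
    hence "eventually (\<lambda>y. 0 = \<phi> y) (at x)" "0 = \<phi> x"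
      by (simp_all add: eventually_nhds_conv_at)
    hence "(\<phi> has_derivative (\<lambda>_. 0)) (at x)"
      by (intro has_derivative_transform_eventually[OF has_derivative_const]) auto
    hence "frechet_derivative \<phi> (at x) = (\<lambda>_. 0)" by (metis frechet_derivative_at)
    thus ?thesis by simp
  qed
  hence "closure {x. frechet_derivative \<phi> (at x) v \<noteq> 0} \<subseteq> closure {x. \<phi> x \<noteq> 0}"
    by (intro closure_minimal) auto
  moreover have "compact (closure {x. \<phi> x \<noteq> 0})" using assms by (simp add: test_function_def)
  ultimately show "compact (closure {x. frechet_derivative \<phi> (at x) v \<noteq> 0})"
    by (metis closed_closure compact_Int_closed inf.absorb_iff2)
qed

lemma C_k_affine:
  fixes \<phi> :: "real^'d::finite \<Rightarrow> real"
  shows "C_k k \<phi> \<Longrightarrow> C_k k (\<lambda>x. \<phi> (A *v x + b))"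
proof (induction k arbitrary: \<phi>)
  case 0
  thus ?case
    by (auto intro!: continuous_on_compose2[of UNIV \<phi>] continuous_intros)
next
  case (Suc k)
  have aff: "((\<lambda>x. A *v x + b) has_derivative (\<lambda>v. A *v v)) (at x)" for x
    by (auto intro!: derivative_eq_intros bounded_linear_imp_has_derivative)
  have D: "((\<lambda>x. \<phi> (A *v x + b)) has_derivative (\<lambda>v. frechet_derivative \<phi> (at (A *v x + b)) (A *v v))) (at x)" for x
  proof -
    have "(\<phi> has_derivative frechet_derivative \<phi> (at (A *v x + b))) (at (A *v x + b))"
      using Suc.prems by (auto simp: differentiable_on_def frechet_derivative_works)
    from has_derivative_compose[OF aff this] show ?thesis .
  qed
  hence "frechet_derivative (\<lambda>x. \<phi> (A *v x + b)) (at x) v = frechet_derivative \<phi> (at (A *v x + b)) (A *v v)" for x v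
    by (metis frechet_derivative_at)
  moreover have "(\<lambda>x. \<phi> (A *v x + b)) differentiable_on UNIV"
    using D by (auto simp: differentiable_on_def differentiable_def)
  moreover have "C_k k (\<lambda>x. frechet_derivative \<phi> (at (A *v x + b)) (A *v v))" for v
    using Suc.IH[of "\<lambda>x. frechet_derivative \<phi> (at x) (A *v v)"] Suc.prems by simp
  ultimately show ?case by simp
qed

lemma test_function_affine:
  fixes A B :: "real^'d^'d::finite"
  assumes \<phi>: "test_function \<phi>" and BA: "B ** A = mat 1"
  shows "test_function (\<lambda>x. \<phi> (A *v x + b))"
  unfolding test_function_def
proof
  show "\<forall>k. C_k k (\<lambda>x. \<phi> (A *v x + b))" using \<phi> by (simp add: test_function_def C_k_affine)
  let ?K = "(\<lambda>z. B *v z - B *v b) ` closure {x. \<phi> x \<noteq> 0}"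
  have K: "compact ?K" using \<phi> unfolding test_function_def
    by (intro compact_continuous_image continuous_intros) auto
  have "{x. \<phi> (A *v x + b) \<noteq> 0} \<subseteq> ?K"
  proof
    fix x assume "x \<in> {x. \<phi> (A *v x + b) \<noteq> 0}"
    hence "A *v x + b \<in> closure {x. \<phi> x \<noteq> 0}" using closure_subset[of "{x. \<phi> x \<noteq> 0}"] by auto
    moreover have "x = B *v (A *v x + b) - B *v b"
      by (simp add: matrix_vector_right_distrib matrix_vector_mul_assoc BA)
    ultimately show "x \<in> ?K" by blast
  qed
  hence "closure {x. \<phi> (A *v x + b) \<noteq> 0} \<subseteq> ?K"
    using K by (intro closure_minimal compact_imp_closed)
  thus "compact (closure {x. \<phi> (A *v x + b) \<noteq> 0})"
    using K by (metis closed_closure compact_Int_closed inf.absorb_iff2)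
qed

lemma locally_integrable_mult_test_function:
  assumes f: "locally_integrable f" and \<phi>: "test_function \<phi>"
  shows "integrable lebesgue (\<lambda>x. f x * \<phi> x)"
proof -
  define K where "K = closure {x. \<phi> x \<noteq> 0}"
  have K: "compact K" using \<phi> by (simp add: K_def test_function_def)
  have int: "integrable lebesgue (\<lambda>x. indicator K x * f x)"
    using f K by (simp add: locally_integrable_def set_integrable_def)
  have "bounded (\<phi> ` K)"
    using test_function_continuous[OF \<phi>] K
    by (intro compact_imp_bounded compact_continuous_image) (auto intro: continuous_on_subset)
  then obtain C where C: "\<And>x. x \<in> K \<Longrightarrow> \<bar>\<phi> x\<bar> \<le> C" unfolding bounded_iff by auto
  have out: "\<phi> x = 0" if "x \<notin> K" for x
    using that closure_subset[of "{x. \<phi> x \<noteq> 0}"] unfolding K_def by auto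
  have meas: "\<phi> \<in> borel_measurable lebesgue"
    using borel_measurable_continuous_onI[OF test_function_continuous[OF \<phi>]] by (simp add: measurable_completion)
  have eq: "f x * \<phi> x = (indicator K x * f x) * \<phi> x" for x using out[of x] by (auto simp: indicator_def)
  show ?thesis
  proof (rule Bochner_Integration.integrable_bound[where f = "\<lambda>x. C * (indicator K x * f x)"])
    show "integrable lebesgue (\<lambda>x. C * (indicator K x * f x))" using int by simp
    have "(\<lambda>x. (indicator K x * f x) * \<phi> x) \<in> borel_measurable lebesgue"
      by (intro borel_measurable_times[OF borel_measurable_integrable[OF int] meas])
    thus "(\<lambda>x. f x * \<phi> x) \<in> borel_measurable lebesgue" by (simp only: eq[symmetric])
    show "AE x in lebesgue. norm (f x * \<phi> x) \<le> norm (C * (indicator K x * f x))"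
    proof (rule AE_I2)
      fix x show "norm (f x * \<phi> x) \<le> norm (C * (indicator K x * f x))"
      proof (cases "x \<in> K")
        case True
        have "\<bar>f x\<bar> * \<bar>\<phi> x\<bar> \<le> \<bar>f x\<bar> * \<bar>C\<bar>" using C[OF True] by (intro mult_left_mono) auto
        thus ?thesis using True by (simp add: abs_mult mult.commute)
      qed (simp add: out)
    qed
  qed
qed

lemma locally_integrable_add:
  "locally_integrable f \<Longrightarrow> locally_integrable g \<Longrightarrow> locally_integrable (\<lambda>x. f x + g x)"
  by (simp add: locally_integrable_def set_integrable_def distrib_left)

lemma locally_integrable_scale:
  "locally_integrable f \<Longrightarrow> locally_integrable (\<lambda>x. c * f x)"
  by (simp add: locally_integrable_def set_integrable_def mult.left_commute)

lemma locally_integrable_sum: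
  "finite I \<Longrightarrow> (\<And>i. i \<in> I \<Longrightarrow> locally_integrable (f i)) \<Longrightarrow> locally_integrable (\<lambda>x. \<Sum>i\<in>I. f i x)"
  by (induction I rule: finite_induct) (simp_all add: locally_integrable_add, simp add: locally_integrable_def set_integrable_def)

lemma locally_integrable_affine:
  fixes A :: "real^'d^'d::finite"
  assumes A: "invertible A" and f: "locally_integrable f"
  shows "locally_integrable (\<lambda>x. f (A *v x + b))"
  unfolding locally_integrable_def set_integrable_def
proof (intro allI impI)
  fix K :: "(real^'d) set" assume K: "compact K"
  let ?T = "\<lambda>x. A *v x + b"
  have "compact (?T ` K)" using K by (intro compact_continuous_image continuous_intros)
  hence "integrable lebesgue (\<lambda>x. indicator (?T ` K) x * f x)"
    using f by (simp add: locally_integrable_def set_integrable_def)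
  from integrable_lebesgue_affine[OF A this, of b]
  have "integrable lebesgue (\<lambda>x. indicator (?T ` K) (?T x) * f (?T x))" .
  moreover have "?T x \<in> ?T ` K \<longleftrightarrow> x \<in> K" for x
  proof -
    have "inj ((*v) A)" using A invertible_left_inverse matrix_left_invertible_injective by blast
    thus ?thesis by (auto simp: inj_eq)
  qed
  ultimately show "integrable lebesgue (\<lambda>x. indicator K x *\<^sub>R f (?T x))"
    by (simp add: indicator_def)
qed

section \<open>Weak derivatives\<close>

lemma has_weak_pderiv_unique:
  assumes "has_weak_pderiv i f g" "has_weak_pderiv i f g'"
  shows "AE x in lebesgue. g x = g' x"
proof -
  have li: "locally_integrable g" "locally_integrable g'" using assms by (auto simp: has_weak_pderiv_def)
  have "AE x in lebesgue. g x + (-1) * g' x = 0"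
  proof (rule fundamental_lemma_calculus_of_variations)
    show "locally_integrable (\<lambda>x. g x + (-1) * g' x)"
      by (intro locally_integrable_add locally_integrable_scale li)
    fix \<phi> :: "real^'a \<Rightarrow> real" assume \<phi>: "test_function \<phi>"
    have parts: "(\<integral>x. f x * frechet_derivative \<phi> (at x) (axis i 1) \<partial>lebesgue) = - (\<integral>x. k x * \<phi> x \<partial>lebesgue)"
      if "has_weak_pderiv i f k" for k using that \<phi> unfolding has_weak_pderiv_def by blast
    have "(\<integral>x. g x * \<phi> x \<partial>lebesgue) = (\<integral>x. g' x * \<phi> x \<partial>lebesgue)"
      using parts[OF assms(1)] parts[OF assms(2)] by linarith
    thus "(\<integral>x. (g x + (-1) * g' x) * \<phi> x \<partial>lebesgue) = 0"
      using locally_integrable_mult_test_function[OF li(1) \<phi>] locally_integrable_mult_test_function[OF li(2) \<phi>]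
      by (simp add: left_diff_distrib)
  qed
  thus ?thesis by simp
qed

lemma has_weak_pderiv_cong_AE:
  assumes h: "has_weak_pderiv i f g" and f': "locally_integrable f'" and eq: "AE x in lebesgue. f x = f' x"
  shows "has_weak_pderiv i f' g"
  unfolding has_weak_pderiv_def
proof (intro conjI allI impI)
  show "locally_integrable g" using h by (simp add: has_weak_pderiv_def)
  fix \<phi> :: "real^'a \<Rightarrow> real" assume \<phi>: "test_function \<phi>"
  let ?D = "\<lambda>x. frechet_derivative \<phi> (at x) (axis i 1)"
  have f: "locally_integrable f" using h by (simp add: has_weak_pderiv_def)
  have "(\<integral>x. f' x * ?D x \<partial>lebesgue) = (\<integral>x. f x * ?D x \<partial>lebesgue)"
  proof (rule integral_cong_AE)
    show "(\<lambda>x. f' x * ?D x) \<in> borel_measurable lebesgue" "(\<lambda>x. f x * ?D x) \<in> borel_measurable lebesgue"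
      using locally_integrable_mult_test_function[OF f' test_function_derivative[OF \<phi>]]
        locally_integrable_mult_test_function[OF f test_function_derivative[OF \<phi>]] by simp_all
    show "AE x in lebesgue. f' x * ?D x = f x * ?D x" using eq by eventually_elim simp
  qed
  thus "(\<integral>x. f' x * ?D x \<partial>lebesgue) = - (\<integral>x. g x * \<phi> x \<partial>lebesgue)"
    using h \<phi> by (simp add: has_weak_pderiv_def)
qed (rule f')

lemma has_weak_pderiv_scale:
  "has_weak_pderiv i f g \<Longrightarrow> has_weak_pderiv i (\<lambda>x. c * f x) (\<lambda>x. c * g x)"
  by (simp add: has_weak_pderiv_def locally_integrable_scale mult.assoc)

lemma has_weak_pderiv_sum:
  fixes f g :: "'l \<Rightarrow> real^'d::finite \<Rightarrow> real"
  assumes I: "finite I" and h: "\<And>l. l \<in> I \<Longrightarrow> has_weak_pderiv i (f l) (g l)"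
  shows "has_weak_pderiv i (\<lambda>x. \<Sum>l\<in>I. f l x) (\<lambda>x. \<Sum>l\<in>I. g l x)"
  unfolding has_weak_pderiv_def
proof (intro conjI allI impI)
  have li: "locally_integrable (f l)" "locally_integrable (g l)" if "l \<in> I" for l
    using h[OF that] by (auto simp: has_weak_pderiv_def)
  show "locally_integrable (\<lambda>x. \<Sum>l\<in>I. f l x)" "locally_integrable (\<lambda>x. \<Sum>l\<in>I. g l x)"
    using I li by (auto intro: locally_integrable_sum)
  fix \<phi> :: "real^'d \<Rightarrow> real" assume \<phi>: "test_function \<phi>"
  let ?D = "\<lambda>x. frechet_derivative \<phi> (at x) (axis i 1)"
  have "(\<integral>x. (\<Sum>l\<in>I. f l x) * ?D x \<partial>lebesgue) = (\<Sum>l\<in>I. \<integral>x. f l x * ?D x \<partial>lebesgue)"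
    unfolding sum_distrib_right
    by (intro Bochner_Integration.integral_sum locally_integrable_mult_test_function li test_function_derivative \<phi>)
  also have "\<dots> = (\<Sum>l\<in>I. - (\<integral>x. g l x * \<phi> x \<partial>lebesgue))"
    using h \<phi> by (intro sum.cong) (auto simp: has_weak_pderiv_def)
  also have "\<dots> = - (\<integral>x. (\<Sum>l\<in>I. g l x) * \<phi> x \<partial>lebesgue)"
    unfolding sum_distrib_right sum_negf
    by (subst Bochner_Integration.integral_sum) (auto intro: locally_integrable_mult_test_function li \<phi>)
  finally show "(\<integral>x. (\<Sum>l\<in>I. f l x) * ?D x \<partial>lebesgue) = - (\<integral>x. (\<Sum>l\<in>I. g l x) * \<phi> x \<partial>lebesgue)" .
qed

text \<open>
  The chain rule by duality. A test function \<open>\<psi>\<close> is of the form \<open>\<phi> (A x + b)\<close> with a test function \<open>\<phi>\<close>, to which the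
  classical chain rule applies, and substituting \<open>A x + b\<close> multiplies both sides of the defining identity for
  \<open>\<phi>\<close> by the same constant.
\<close>

theorem has_weak_pderiv_affine:
  fixes A :: "real^'d^'d::finite"
  assumes A: "invertible A" and h: "\<And>k. has_weak_pderiv k f (g k)"
  shows "has_weak_pderiv i (\<lambda>x. f (A *v x + b)) (\<lambda>x. \<Sum>k\<in>UNIV. A $ k $ i * g k (A *v x + b))"
  unfolding has_weak_pderiv_def
proof (intro conjI allI impI)
  have li: "locally_integrable f" "locally_integrable (g k)" for k using h by (auto simp: has_weak_pderiv_def)
  show "locally_integrable (\<lambda>x. f (A *v x + b))" by (rule locally_integrable_affine[OF A li(1)])
  show "locally_integrable (\<lambda>x. \<Sum>k\<in>UNIV. A $ k $ i * g k (A *v x + b))"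
    by (intro locally_integrable_sum locally_integrable_scale locally_integrable_affine A li) simp
  fix \<psi> :: "real^'d \<Rightarrow> real" assume \<psi>: "test_function \<psi>"
  obtain B where AB: "A ** B = mat 1" and BA: "B ** A = mat 1" using A unfolding invertible_def by blast
  define \<phi> where "\<phi> z = \<psi> (B *v z + - (B *v b))" for z
  have \<phi>: "test_function \<phi>" unfolding \<phi>_def by (rule test_function_affine[OF \<psi> AB])
  have \<psi>\<phi>: "\<psi> x = \<phi> (A *v x + b)" for x
    by (simp add: \<phi>_def matrix_vector_right_distrib matrix_vector_mul_assoc BA)
  let ?D = "\<lambda>k z. frechet_derivative \<phi> (at z) (axis k 1)"
  have deriv: "frechet_derivative \<psi> (at x) (axis i 1) = (\<Sum>k\<in>UNIV. A $ k $ i * ?D k (A *v x + b))" for x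
  proof -
    have aff: "((\<lambda>x. A *v x + b) has_derivative (\<lambda>v. A *v v)) (at x)"
      by (auto intro!: derivative_eq_intros bounded_linear_imp_has_derivative)
    have D\<phi>: "(\<phi> has_derivative frechet_derivative \<phi> (at (A *v x + b))) (at (A *v x + b))"
      by (rule test_function_has_derivative[OF \<phi>])
    have "((\<lambda>x. \<phi> (A *v x + b)) has_derivative (\<lambda>v. frechet_derivative \<phi> (at (A *v x + b)) (A *v v))) (at x)"
      by (rule has_derivative_compose[OF aff D\<phi>])
    hence "(\<psi> has_derivative (\<lambda>v. frechet_derivative \<phi> (at (A *v x + b)) (A *v v))) (at x)"
      unfolding \<psi>\<phi>[symmetric] .
    hence "frechet_derivative \<psi> (at x) (axis i 1) = frechet_derivative \<phi> (at (A *v x + b)) (A *v axis i 1)"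
      by (metis frechet_derivative_at)
    also have "A *v axis i 1 = (\<Sum>k\<in>UNIV. A $ k $ i *\<^sub>R axis k 1)"
      using basis_expansion[of "column i A", symmetric]
      by (simp add: matrix_vector_mult_basis scalar_mult_eq_scaleR) (simp add: column_def)
    also have "frechet_derivative \<phi> (at (A *v x + b)) \<dots> = (\<Sum>k\<in>UNIV. A $ k $ i * ?D k (A *v x + b))"
      using has_derivative_linear[OF D\<phi>] by (simp add: linear_sum linear_scale)
    finally show ?thesis .
  qed
  obtain c where c: "c > 0" "\<And>F::real^'d \<Rightarrow> real. F \<in> borel_measurable lebesgue \<Longrightarrow>
      (\<integral>x. F (A *v x + b) \<partial>lebesgue) = c * (\<integral>x. F x \<partial>lebesgue)"
    using lebesgue_affine_change_of_variables[OF A, of b] by blast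
  have intD: "integrable lebesgue (\<lambda>x. f x * ?D k x)" for k
    by (rule locally_integrable_mult_test_function[OF li(1) test_function_derivative[OF \<phi>]])
  have intg: "integrable lebesgue (\<lambda>x. g k x * \<phi> x)" for k
    by (rule locally_integrable_mult_test_function[OF li(2) \<phi>])
  have "(\<integral>x. f (A *v x + b) * frechet_derivative \<psi> (at x) (axis i 1) \<partial>lebesgue)
      = (\<integral>x. (\<lambda>z. \<Sum>k\<in>UNIV. A $ k $ i * (f z * ?D k z)) (A *v x + b) \<partial>lebesgue)"
    unfolding deriv by (simp add: sum_distrib_left mult_ac)
  also have "\<dots> = c * (\<integral>z. (\<Sum>k\<in>UNIV. A $ k $ i * (f z * ?D k z)) \<partial>lebesgue)"
    using intD by (intro c(2)) (intro borel_measurable_sum borel_measurable_times borel_measurable_const borel_measurable_integrable)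
  also have "(\<integral>z. (\<Sum>k\<in>UNIV. A $ k $ i * (f z * ?D k z)) \<partial>lebesgue)
      = (\<Sum>k\<in>UNIV. A $ k $ i * (\<integral>z. f z * ?D k z \<partial>lebesgue))"
    using intD by simp
  also have "\<dots> = (\<Sum>k\<in>UNIV. A $ k $ i * - (\<integral>z. g k z * \<phi> z \<partial>lebesgue))"
    using h \<phi> by (simp add: has_weak_pderiv_def)
  also have "\<dots> = - (\<integral>z. (\<Sum>k\<in>UNIV. A $ k $ i * (g k z * \<phi> z)) \<partial>lebesgue)"
    using intg by (simp add: sum_negf)
  also have "c * \<dots> = - (\<integral>x. (\<lambda>z. \<Sum>k\<in>UNIV. A $ k $ i * (g k z * \<phi> z)) (A *v x + b) \<partial>lebesgue)"
    using intg by (subst c(2)) (auto intro!: borel_measurable_sum borel_measurable_times)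
  also have "\<dots> = - (\<integral>x. (\<Sum>k\<in>UNIV. A $ k $ i * g k (A *v x + b)) * \<psi> x \<partial>lebesgue)"
    by (simp only: \<psi>\<phi> sum_distrib_right mult.assoc)
  finally show "(\<integral>x. f (A *v x + b) * frechet_derivative \<psi> (at x) (axis i 1) \<partial>lebesgue)
      = - (\<integral>x. (\<Sum>k\<in>UNIV. A $ k $ i * g k (A *v x + b)) * \<psi> x \<partial>lebesgue)" .
qed

text \<open>
  A function together with representatives of its weak gradient and Hessian, all square integrable. The
  representatives chosen by \<^const>\<open>weak_pderiv\<close> need not respect sums or substitutions pointwise, whereas the
  derivatives of sums, multiples and substitutions below are given by formulas.
\<close>

definition weak_jet where
  "weak_jet f g h \<longleftrightarrow> square_integrable f \<and>
     (\<forall>i. square_integrable (g i) \<and> has_weak_pderiv i f (g i)) \<and>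
     (\<forall>i j. square_integrable (h i j) \<and> has_weak_pderiv i (g j) (h i j))"

lemma weak_jetD:
  assumes "weak_jet f g h"
  shows "square_integrable f" "square_integrable (g i)" "square_integrable (h i j)"
    "has_weak_pderiv i f (g i)" "has_weak_pderiv i (g j) (h i j)"
  using assms by (auto simp: weak_jet_def)

lemma W2_imp_weak_jet:
  assumes "f \<in> W2 2"
  shows "\<exists>g h. weak_jet f g h"
proof -
  have "square_integrable f" "\<forall>i. \<exists>g. g \<in> W2 (Suc 0) \<and> has_weak_pderiv i f g"
    using assms by (auto simp: numeral_2_eq_2)
  then obtain g where g: "\<And>i. g i \<in> W2 (Suc 0)" "\<And>i. has_weak_pderiv i f (g i)" by metis
  have gs: "square_integrable (g i)" for i using g(1)[of i] by simp
  have "\<forall>j i. \<exists>h. square_integrable h \<and> has_weak_pderiv i (g j) h" using g(1) by auto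
  then obtain h where h: "\<And>j i. square_integrable (h j i) \<and> has_weak_pderiv i (g j) (h j i)" by metis
  have "weak_jet f g (\<lambda>i j. h j i)"
    using \<open>square_integrable f\<close> g gs h by (simp add: weak_jet_def)
  thus ?thesis by blast
qed

text \<open>
  Weak derivatives are unique up to null sets. For the Hessian this is used twice: the chosen second
  derivative is taken of the chosen first derivative, which must first be replaced by \<open>g j\<close>.
\<close>

lemma curv_weak_jet:
  assumes "weak_jet f g h"
  shows "AE y in lebesgue. curv f y $ i $ j = g i y * g j y - f y * h i j y"
proof -
  have w: "has_weak_pderiv k f (weak_pderiv k f)" for k
    unfolding weak_pderiv_def by (rule someI[of _ "g k"]) (rule weak_jetD(4)[OF assms])
  have ae: "AE y in lebesgue. g k y = weak_pderiv k f y" for k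
    by (rule has_weak_pderiv_unique[OF weak_jetD(4)[OF assms] w])
  have "has_weak_pderiv i (weak_pderiv j f) (h i j)"
    using weak_jetD(5)[OF assms] _ ae by (rule has_weak_pderiv_cong_AE) (use w[of j] in \<open>simp add: has_weak_pderiv_def\<close>)
  moreover from this have "has_weak_pderiv i (weak_pderiv j f) (weak_pderiv i (weak_pderiv j f))"
    unfolding weak_pderiv_def[of i] by (rule someI[of "has_weak_pderiv i (weak_pderiv j f)"])
  ultimately have "AE y in lebesgue. h i j y = weak_pderiv i (weak_pderiv j f) y"
    by (rule has_weak_pderiv_unique)
  with ae[of i] ae[of j] show ?thesis
    by eventually_elim (simp add: curv_def weak_grad_def weak_hessian_def)
qed

lemma weak_jet_scale:
  assumes "weak_jet f g h"
  shows "weak_jet (\<lambda>x. c * f x) (\<lambda>i x. c * g i x) (\<lambda>i j x. c * h i j x)"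
  unfolding weak_jet_def
proof (intro conjI allI)
  note D = weak_jetD[OF assms]
  show "square_integrable (\<lambda>x. c * f x)" by (rule square_integrable_scale[OF D(1)])
  show "square_integrable (\<lambda>x. c * g i x)" for i by (rule square_integrable_scale[OF D(2)])
  show "square_integrable (\<lambda>x. c * h i j x)" for i j by (rule square_integrable_scale[OF D(3)])
  show "has_weak_pderiv i (\<lambda>x. c * f x) (\<lambda>x. c * g i x)" for i by (rule has_weak_pderiv_scale[OF D(4)])
  show "has_weak_pderiv i (\<lambda>x. c * g j x) (\<lambda>x. c * h i j x)" for i j by (rule has_weak_pderiv_scale[OF D(5)])
qed

lemma weak_jet_sum:
  assumes "finite I" "\<And>l. l \<in> I \<Longrightarrow> weak_jet (f l) (g l) (h l)"
  shows "weak_jet (\<lambda>x. \<Sum>l\<in>I. f l x) (\<lambda>i x. \<Sum>l\<in>I. g l i x) (\<lambda>i j x. \<Sum>l\<in>I. h l i j x)"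
  unfolding weak_jet_def
proof (intro conjI allI)
  note D = weak_jetD[OF assms(2)]
  show "square_integrable (\<lambda>x. \<Sum>l\<in>I. f l x)" by (rule square_integrable_sum[OF assms(1)]) (rule D(1))
  show "square_integrable (\<lambda>x. \<Sum>l\<in>I. g l i x)" for i by (rule square_integrable_sum[OF assms(1)]) (rule D(2))
  show "square_integrable (\<lambda>x. \<Sum>l\<in>I. h l i j x)" for i j by (rule square_integrable_sum[OF assms(1)]) (rule D(3))
  show "has_weak_pderiv i (\<lambda>x. \<Sum>l\<in>I. f l x) (\<lambda>x. \<Sum>l\<in>I. g l i x)" for i
    by (rule has_weak_pderiv_sum[OF assms(1)]) (rule D(4))
  show "has_weak_pderiv i (\<lambda>x. \<Sum>l\<in>I. g l j x) (\<lambda>x. \<Sum>l\<in>I. h l i j x)" for i j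
    by (rule has_weak_pderiv_sum[OF assms(1)]) (rule D(5))
qed

lemma weak_jet_affine:
  fixes A :: "real^'d^'d::finite"
  assumes A: "invertible A" and jet: "weak_jet f g h"
  shows "weak_jet (\<lambda>x. f (A *v x + b)) (\<lambda>i x. \<Sum>k\<in>UNIV. A $ k $ i * g k (A *v x + b))
     (\<lambda>i j x. \<Sum>l\<in>UNIV. A $ l $ j * (\<Sum>k\<in>UNIV. A $ k $ i * h k l (A *v x + b)))"
  unfolding weak_jet_def
proof (intro conjI allI)
  note D = weak_jetD[OF jet]
  show "square_integrable (\<lambda>x. f (A *v x + b))" by (rule square_integrable_affine[OF A D(1)])
  show "square_integrable (\<lambda>x. \<Sum>k\<in>UNIV. A $ k $ i * g k (A *v x + b))" for i
    by (rule square_integrable_sum[OF finite], rule square_integrable_scale, rule square_integrable_affine[OF A D(2)])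
  show "square_integrable (\<lambda>x. \<Sum>l\<in>UNIV. A $ l $ j * (\<Sum>k\<in>UNIV. A $ k $ i * h k l (A *v x + b)))" for i j
    by (rule square_integrable_sum[OF finite], rule square_integrable_scale,
        rule square_integrable_sum[OF finite], rule square_integrable_scale, rule square_integrable_affine[OF A D(3)])
  show "has_weak_pderiv i (\<lambda>x. f (A *v x + b)) (\<lambda>x. \<Sum>k\<in>UNIV. A $ k $ i * g k (A *v x + b))" for i
    by (rule has_weak_pderiv_affine[OF A]) (rule D(4))
  show "has_weak_pderiv i (\<lambda>x. \<Sum>k\<in>UNIV. A $ k $ j * g k (A *v x + b))
     (\<lambda>x. \<Sum>l\<in>UNIV. A $ l $ j * (\<Sum>k\<in>UNIV. A $ k $ i * h k l (A *v x + b)))" for i j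
    by (rule has_weak_pderiv_sum[OF finite], rule has_weak_pderiv_scale, rule has_weak_pderiv_affine[OF A], rule D(5))
qed

lemma weak_jet_translate:
  fixes f :: "real^'d::finite \<Rightarrow> real"
  assumes "weak_jet f g h"
  shows "weak_jet (\<lambda>x. f (x + b)) (\<lambda>i x. g i (x + b)) (\<lambda>i j x. h i j (x + b))"
proof -
  have s: "(\<Sum>k\<in>UNIV. (mat 1 :: real^'d^'d) $ k $ i * u k) = u i" for i and u :: "'d \<Rightarrow> real"
  proof -
    have "(\<Sum>k\<in>UNIV. (mat 1 :: real^'d^'d) $ k $ i * u k) = (\<Sum>k\<in>UNIV. if k = i then u k else 0)"
      by (intro sum.cong refl) (simp add: mat_def)
    thus ?thesis by simp
  qed
  show ?thesis
    using weak_jet_affine[OF spd_invertible[OF spd_mat_1] assms, of b] by (simp add: s)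
qed


section \<open>The right-hand side of the equation as a quotient of Gaussian integrals\<close>

text \<open>
  For symmetric positive definite \<open>N\<close> this is, up to a constant factor, the squared Gaussian with
  covariance \<open>N\<^sup>-\<^sup>2\<close>.
\<close>

definition gauss_kernel :: "real^'d^'d::finite \<Rightarrow> real^'d \<Rightarrow> real" where
  "gauss_kernel N z = exp (- (norm (N *v z))\<^sup>2)"

lemma gauss_kernel_bounds: "0 < gauss_kernel N z" "gauss_kernel N z \<le> 1"
  by (simp_all add: gauss_kernel_def)

lemma abs_gauss_kernel [simp]: "\<bar>gauss_kernel N z\<bar> = gauss_kernel N z"
  by (simp add: gauss_kernel_def)

lemma matrix_inv_eqI:
  fixes A B :: "real^'d^'d::finite"
  assumes "A ** B = mat 1" "B ** A = mat 1"
  shows "matrix_inv A = B"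
proof -
  have "A ** matrix_inv A = mat 1 \<and> matrix_inv A ** A = mat 1"
    unfolding matrix_inv_def by (rule someI[of _ B]) (use assms in simp)
  hence "B ** (A ** matrix_inv A) = B" by simp
  thus ?thesis using assms(2) by (simp add: matrix_mul_assoc)
qed

lemma matrix_inv_matrix_inv:
  fixes A :: "real^'d^'d::finite"
  assumes "invertible A"
  shows "matrix_inv (matrix_inv A) = A" "invertible (matrix_inv A)"
proof -
  obtain B where B: "A ** B = mat 1" "B ** A = mat 1" using assms unfolding invertible_def by blast
  hence inv: "matrix_inv A = B" by (rule matrix_inv_eqI)
  show "matrix_inv (matrix_inv A) = A" unfolding inv using B by (intro matrix_inv_eqI)
  show "invertible (matrix_inv A)" unfolding inv using B unfolding invertible_def by blast
qed

lemma gauss_square_eq_kernel: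
  fixes N :: "real^'d^'d::finite"
  assumes "spd N"
  shows "\<exists>c>0. \<forall>z. (gauss (matrix_inv (N ** N)) z)\<^sup>2 = c * gauss_kernel N z"
proof -
  have inv: "invertible (N ** N)" by (intro spd_invertible spd_square assms)
  define c where "c = ((2 * pi) powr (- real CARD('d) / 2) * \<bar>det (matrix_inv (N ** N))\<bar> powr (- 1 / 2))\<^sup>2"
  have "det (matrix_inv (N ** N)) \<noteq> 0"
    using matrix_inv_matrix_inv(2)[OF inv] by (simp add: invertible_det_nz)
  hence "c > 0" by (simp add: c_def)
  moreover have "(gauss (matrix_inv (N ** N)) z)\<^sup>2 = c * gauss_kernel N z" for z
  proof -
    have "z \<bullet> ((N ** N) *v z) = (norm (N *v z))\<^sup>2"
      by (simp add: matrix_vector_mul_assoc[symmetric] spd_inner_transfer[OF assms, symmetric] power2_norm_eq_inner)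
    thus ?thesis
      by (simp add: gauss_def c_def gauss_kernel_def power_mult_distrib matrix_inv_matrix_inv(1)[OF inv] exp_double[symmetric])
  qed
  ultimately show ?thesis by blast
qed

text \<open>
  This uses that Lebesgue measure is complete.
\<close>

lemma lebesgue_measurable_cong_AE:
  fixes f g :: "'a::euclidean_space \<Rightarrow> real"
  assumes f: "f \<in> borel_measurable lebesgue" and eq: "AE x in lebesgue. f x = g x"
  shows "g \<in> borel_measurable lebesgue"
proof (rule measurableI)
  fix S :: "real set" assume "S \<in> sets borel"
  hence S: "f -` S \<inter> space lebesgue \<in> sets lebesgue" using f by (rule measurable_sets[rotated])
  have "AE x in lebesgue. x \<in> f -` S \<inter> space lebesgue \<longleftrightarrow> x \<in> g -` S \<inter> space lebesgue"
    using eq by eventually_elim auto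
  thus "g -` S \<inter> space lebesgue \<in> sets lebesgue"
    by (rule completion.in_sets_AE[OF _ S]) simp
qed simp

lemma gauss_kernel_continuous: "continuous_on UNIV (\<lambda>y. gauss_kernel N (x - y))"
proof -
  have "continuous_on UNIV (\<lambda>y. N *v x - N *v y)"
    by (intro continuous_on_diff continuous_on_const matrix_vector_mult_linear_continuous_on)
  thus ?thesis
    unfolding gauss_kernel_def matrix_vector_mult_diff_distrib
    by (intro continuous_on_exp continuous_on_minus continuous_on_power continuous_on_norm)
qed

lemma gauss_kernel_measurable: "(\<lambda>y. gauss_kernel N (x - y)) \<in> borel_measurable lebesgue"
  using borel_measurable_continuous_onI[OF gauss_kernel_continuous, of N x] by (simp add: measurable_completion)

lemma integrable_mult_gauss_kernel:
  assumes F: "integrable lebesgue F"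
  shows "integrable lebesgue (\<lambda>y. F y * gauss_kernel N (x - y))"
proof (rule Bochner_Integration.integrable_bound[OF F])
  show "(\<lambda>y. F y * gauss_kernel N (x - y)) \<in> borel_measurable lebesgue"
    by (intro borel_measurable_times gauss_kernel_measurable borel_measurable_integrable F)
  have "\<bar>F y\<bar> * gauss_kernel N (x - y) \<le> \<bar>F y\<bar>" for y
    using gauss_kernel_bounds[of N "x - y"] by (intro mult_right_le_one_le) auto
  thus "AE y in lebesgue. norm (F y * gauss_kernel N (x - y)) \<le> norm (F y)"
    by (simp add: abs_mult)
qed

definition kernel_mean :: "real^'d^'d::finite \<Rightarrow> real^'d \<Rightarrow> (real^'d \<Rightarrow> real) \<Rightarrow> real" where
  "kernel_mean N x F = (\<integral>y. F y * gauss_kernel N (x - y) \<partial>lebesgue)"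

definition jet_rhs where
  "jet_rhs lam f g h x M = (1 / 2) *\<^sub>R ((lam *\<^sub>R M) ** (lam *\<^sub>R M)) +
     (1 / (2 * kernel_mean (lam *\<^sub>R M) x (\<lambda>y. (f y)\<^sup>2))) *\<^sub>R
       (\<chi> i j. kernel_mean (lam *\<^sub>R M) x (\<lambda>y. g i y * g j y - f y * h i j y))"

lemma weak_jet_integrable:
  assumes "weak_jet f g h"
  shows "integrable lebesgue (\<lambda>y. (f y)\<^sup>2)" "integrable lebesgue (\<lambda>y. g i y * g j y - f y * h i j y)"
proof -
  note D = weak_jetD[OF assms]
  show "integrable lebesgue (\<lambda>y. (f y)\<^sup>2)" using D(1) by (simp add: square_integrable_def)
  show "integrable lebesgue (\<lambda>y. g i y * g j y - f y * h i j y)"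
    by (intro Bochner_Integration.integrable_diff square_integrable_mult D)
qed

theorem eq_rhs_eq_jet_rhs:
  assumes lam: "0 < lam" and M: "spd M" and jet: "weak_jet f g h"
  shows "eq_rhs lam f x M = jet_rhs lam f g h x M"
proof -
  define N where "N = lam *\<^sub>R M"
  have N: "spd N" unfolding N_def by (rule spd_scaleR[OF M lam])
  obtain c where c: "c > 0" "\<And>z. (gauss (matrix_inv (N ** N)) z)\<^sup>2 = c * gauss_kernel N z"
    using gauss_square_eq_kernel[OF N] by blast
  have den: "conv (\<lambda>y. (f y)\<^sup>2) (\<lambda>y. (gauss (matrix_inv (N ** N)) y)\<^sup>2) x = c * kernel_mean N x (\<lambda>y. (f y)\<^sup>2)"
    by (simp add: conv_def c kernel_mean_def mult.left_commute)
  have num: "conv (\<lambda>y. curv f y $ i $ j) (\<lambda>y. (gauss (matrix_inv (N ** N)) y)\<^sup>2) x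
      = c * kernel_mean N x (\<lambda>y. g i y * g j y - f y * h i j y)" for i j
  proof -
    note ae = curv_weak_jet[OF jet, of i j]
    note int = weak_jet_integrable(2)[OF jet, of i j]
    have ae': "AE y in lebesgue. g i y * g j y - f y * h i j y = curv f y $ i $ j"
      using ae by eventually_elim simp
    have meas: "(\<lambda>y. curv f y $ i $ j) \<in> borel_measurable lebesgue"
      by (rule lebesgue_measurable_cong_AE[OF borel_measurable_integrable[OF int] ae'])
    have "conv (\<lambda>y. curv f y $ i $ j) (\<lambda>y. (gauss (matrix_inv (N ** N)) y)\<^sup>2) x
        = c * (\<integral>y. curv f y $ i $ j * gauss_kernel N (x - y) \<partial>lebesgue)"
      by (simp add: conv_def c mult.left_commute)
    also have "(\<integral>y. curv f y $ i $ j * gauss_kernel N (x - y) \<partial>lebesgue)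
        = (\<integral>y. (g i y * g j y - f y * h i j y) * gauss_kernel N (x - y) \<partial>lebesgue)"
    proof (rule integral_cong_AE)
      show "(\<lambda>y. curv f y $ i $ j * gauss_kernel N (x - y)) \<in> borel_measurable lebesgue"
        by (intro borel_measurable_times meas gauss_kernel_measurable)
      show "(\<lambda>y. (g i y * g j y - f y * h i j y) * gauss_kernel N (x - y)) \<in> borel_measurable lebesgue"
        by (rule borel_measurable_integrable[OF integrable_mult_gauss_kernel[OF int]])
      show "AE y in lebesgue. curv f y $ i $ j * gauss_kernel N (x - y)
          = (g i y * g j y - f y * h i j y) * gauss_kernel N (x - y)"
        using ae by eventually_elim simp
    qed
    finally show ?thesis by (simp add: kernel_mean_def)
  qed
  have "(1 / (2 * (c * kernel_mean N x (\<lambda>y. (f y)\<^sup>2)))) *\<^sub>R mconv (curv f) (\<lambda>y. (gauss (matrix_inv (N ** N)) y)\<^sup>2) x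
     = (1 / (2 * kernel_mean N x (\<lambda>y. (f y)\<^sup>2))) *\<^sub>R
       (\<chi> i j. kernel_mean N x (\<lambda>y. g i y * g j y - f y * h i j y))"
    using c(1) by (simp add: vec_eq_iff mconv_def num)
  thus ?thesis
    unfolding eq_rhs_def jet_rhs_def Let_def N_def[symmetric] den by simp
qed

lemma kernel_mean_translate:
  assumes "integrable lebesgue F"
  shows "kernel_mean N x (\<lambda>y. F (y + b)) = kernel_mean N (x + b) F"
proof -
  have "(\<integral>y. (\<lambda>z. F z * gauss_kernel N (x + b - z)) (y + b) \<partial>lebesgue)
      = (\<integral>z. F z * gauss_kernel N (x + b - z) \<partial>lebesgue)"
    by (rule lebesgue_integral_translate(1))
       (rule borel_measurable_integrable[OF integrable_mult_gauss_kernel[OF assms]])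
  thus ?thesis by (simp add: kernel_mean_def)
qed

lemma eq_rhs_translate:
  assumes lam: "0 < lam" and M: "spd M" and jet: "weak_jet f g h"
  shows "eq_rhs lam (\<lambda>y. f (y + b)) x M = eq_rhs lam f (x + b) M"
proof -
  have "kernel_mean N x (\<lambda>y. (f (y + b))\<^sup>2) = kernel_mean N (x + b) (\<lambda>y. (f y)\<^sup>2)" for N
    by (rule kernel_mean_translate[OF weak_jet_integrable(1)[OF jet]])
  moreover have "kernel_mean N x (\<lambda>y. g i (y + b) * g j (y + b) - f (y + b) * h i j (y + b))
      = kernel_mean N (x + b) (\<lambda>y. g i y * g j y - f y * h i j y)" for N i j
    by (rule kernel_mean_translate[OF weak_jet_integrable(2)[OF jet]])
  ultimately show ?thesis
    by (simp only: eq_rhs_eq_jet_rhs[OF lam M jet] eq_rhs_eq_jet_rhs[OF lam M weak_jet_translate[OF jet]] jet_rhs_def)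
qed

lemma kernel_mean_cmult: "kernel_mean N x (\<lambda>y. c * F y) = c * kernel_mean N x F"
  unfolding kernel_mean_def mult.assoc by (rule integral_mult_right_zero)

lemma eq_rhs_scale:
  assumes lam: "0 < lam" and M: "spd M" and jet: "weak_jet f g h" and c: "c \<noteq> 0"
  shows "eq_rhs lam (\<lambda>y. c * f y) x M = eq_rhs lam f x M"
proof -
  have sq: "(\<lambda>y. (c * f y)\<^sup>2) = (\<lambda>y. c\<^sup>2 * (f y)\<^sup>2)" by (simp only: power_mult_distrib)
  have cu: "(\<lambda>y. (c * g i y) * (c * g j y) - (c * f y) * (c * h i j y)) = (\<lambda>y. c\<^sup>2 * (g i y * g j y - f y * h i j y))" for i j
    by (simp add: power2_eq_square algebra_simps)
  have cancel: "(1 / (2 * (c\<^sup>2 * D))) *\<^sub>R (\<chi> i j. c\<^sup>2 * Q i j) = (1 / (2 * D)) *\<^sub>R (\<chi> i j. Q i j)"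
    for D :: real and Q :: "'a \<Rightarrow> 'a \<Rightarrow> real"
    using c by (simp add: vec_eq_iff)
  show ?thesis
    by (simp only: eq_rhs_eq_jet_rhs[OF lam M jet] eq_rhs_eq_jet_rhs[OF lam M weak_jet_scale[OF jet]] jet_rhs_def
        sq cu kernel_mean_cmult cancel)
qed

lemma kernel_mean_sum:
  assumes "finite I" "\<And>i. i \<in> I \<Longrightarrow> integrable lebesgue (F i)"
  shows "kernel_mean N x (\<lambda>y. \<Sum>i\<in>I. F i y) = (\<Sum>i\<in>I. kernel_mean N x (F i))"
  unfolding kernel_mean_def sum_distrib_right
  by (rule Bochner_Integration.integral_sum) (rule integrable_mult_gauss_kernel[OF assms(2)])

lemma matrix_triple_product_component:
  fixes A X :: "real^'d^'d::finite"
  shows "(transpose A ** X ** A) $ i $ j = (\<Sum>k\<in>UNIV. \<Sum>l\<in>UNIV. A $ k $ i * A $ l $ j * X $ k $ l)"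
proof -
  have "(transpose A ** X ** A) $ i $ j = (\<Sum>l\<in>UNIV. \<Sum>k\<in>UNIV. A $ k $ i * X $ k $ l * A $ l $ j)"
    by (simp add: matrix_matrix_mult_def transpose_def sum_distrib_right)
  also have "\<dots> = (\<Sum>k\<in>UNIV. \<Sum>l\<in>UNIV. A $ k $ i * A $ l $ j * X $ k $ l)"
    by (subst sum.swap) (simp add: mult_ac)
  finally show ?thesis .
qed

text \<open>
  Write \<open>N = lam M\<close> and \<open>N' = lam M'\<close>. The assumption on \<open>M'\<close> says \<open>|N' z| = |N (A z)|\<close>, so the window of \<open>M'\<close>
  at \<open>x\<close> is the window of \<open>M\<close> at \<open>A x\<close> composed with \<open>A\<close>. The substitution \<open>y \<mapsto> A y\<close> contributes the same constant
  to numerator and denominator, and the second-order chain rule contributes the congruence by \<open>A\<close>.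
\<close>

theorem eq_rhs_linear:
  fixes A :: "real^'d^'d::finite"
  assumes lam: "0 < lam" and M: "spd M" and M': "spd M'" and A: "invertible A" and jet: "weak_jet f g h"
    and sq: "M' ** M' = transpose A ** (M ** M) ** A"
  shows "eq_rhs lam (\<lambda>y. f (A *v y)) x M' = transpose A ** eq_rhs lam f (A *v x) M ** A"
proof -
  define N N' where "N = lam *\<^sub>R M" and "N' = lam *\<^sub>R M'"
  have N: "spd N" "spd N'" unfolding N_def N'_def by (intro spd_scaleR M M' lam)+
  have NN: "N' ** N' = transpose A ** (N ** N) ** A"
  proof -
    have square: "(lam *\<^sub>R K) ** (lam *\<^sub>R K) = (lam * lam) *\<^sub>R (K ** K)" for K :: "real^'d^'d"
      by (simp add: vec_eq_iff matrix_matrix_mult_def sum_distrib_left mult_ac)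
    have "transpose A ** ((lam * lam) *\<^sub>R (M ** M)) ** A = (lam * lam) *\<^sub>R (transpose A ** (M ** M) ** A)"
      by (simp add: vec_eq_iff matrix_triple_product_component sum_distrib_left mult_ac)
    thus ?thesis unfolding N_def N'_def square sq by (rule sym)
  qed
  have normsq: "(norm (K *v z))\<^sup>2 = z \<bullet> ((K ** K) *v z)" if "spd K" for K :: "real^'d^'d" and z
    by (simp add: matrix_vector_mul_assoc[symmetric] spd_inner_transfer[OF that, symmetric] power2_norm_eq_inner)
  have kernel: "gauss_kernel N' z = gauss_kernel N (A *v z)" for z
  proof -
    have "z \<bullet> ((N' ** N') *v z) = (A *v z) \<bullet> ((N ** N) *v (A *v z))"
      unfolding NN by (simp add: matrix_vector_mul_assoc[symmetric] inner_matrix_transpose_right del: transpose_matrix_vector)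
    thus ?thesis by (simp add: gauss_kernel_def normsq N)
  qed
  obtain c where c: "c > 0" "\<And>F::real^'d \<Rightarrow> real. F \<in> borel_measurable lebesgue \<Longrightarrow>
      (\<integral>x. F (A *v x + 0) \<partial>lebesgue) = c * (\<integral>x. F x \<partial>lebesgue)"
    using lebesgue_affine_change_of_variables[OF A, of 0] by blast
  have mean: "kernel_mean N' x (\<lambda>y. F (A *v y)) = c * kernel_mean N (A *v x) F" if "integrable lebesgue F" for F
    using c(2)[OF borel_measurable_integrable[OF integrable_mult_gauss_kernel[OF that, of N "A *v x"]]]
    by (simp add: kernel_mean_def kernel matrix_vector_mult_diff_distrib)
  define F where "F k l y = g k y * g l y - f y * h k l y" for k l y
  have F: "integrable lebesgue (F k l)" for k l unfolding F_def by (rule weak_jet_integrable(2)[OF jet])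
  have FA: "integrable lebesgue (\<lambda>y. F k l (A *v y))" for k l
    using integrable_lebesgue_affine[OF A F, of k l 0] by simp
  let ?g = "\<lambda>i y. \<Sum>k\<in>UNIV. A $ k $ i * g k (A *v y)"
  let ?h = "\<lambda>i j y. \<Sum>l\<in>UNIV. A $ l $ j * (\<Sum>k\<in>UNIV. A $ k $ i * h k l (A *v y))"
  have jet': "weak_jet (\<lambda>y. f (A *v y)) ?g ?h"
    using weak_jet_affine[OF A jet, of 0] by simp
  have curv': "?g i y * ?g j y - f (A *v y) * ?h i j y
      = (\<Sum>k\<in>UNIV. \<Sum>l\<in>UNIV. A $ k $ i * A $ l $ j * F k l (A *v y))" for i j y
  proof -
    have "?g i y * ?g j y = (\<Sum>k\<in>UNIV. \<Sum>l\<in>UNIV. A $ k $ i * A $ l $ j * (g k (A *v y) * g l (A *v y)))"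
      by (simp add: sum_product mult_ac)
    moreover have "f (A *v y) * ?h i j y = (\<Sum>k\<in>UNIV. \<Sum>l\<in>UNIV. A $ k $ i * A $ l $ j * (f (A *v y) * h k l (A *v y)))"
      by (subst sum.swap) (simp add: sum_distrib_left mult_ac)
    ultimately show ?thesis
      by (simp add: F_def right_diff_distrib sum_subtractf)
  qed
  have num: "kernel_mean N' x (\<lambda>y. ?g i y * ?g j y - f (A *v y) * ?h i j y)
      = c * (\<Sum>k\<in>UNIV. \<Sum>l\<in>UNIV. A $ k $ i * A $ l $ j * kernel_mean N (A *v x) (F k l))" for i j
  proof -
    have "kernel_mean N' x (\<lambda>y. ?g i y * ?g j y - f (A *v y) * ?h i j y)
        = (\<Sum>k\<in>UNIV. \<Sum>l\<in>UNIV. A $ k $ i * A $ l $ j * kernel_mean N' x (\<lambda>y. F k l (A *v y)))"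
      unfolding curv'
      by (subst kernel_mean_sum, simp, intro Bochner_Integration.integrable_sum integrable_mult_right FA,
          intro sum.cong refl, subst kernel_mean_sum, simp, intro integrable_mult_right FA)
         (simp add: kernel_mean_cmult)
    thus ?thesis by (simp add: mean[OF F] sum_distrib_left mult_ac)
  qed
  have den: "kernel_mean N' x (\<lambda>y. (f (A *v y))\<^sup>2) = c * kernel_mean N (A *v x) (\<lambda>y. (f y)\<^sup>2)"
    by (rule mean[OF weak_jet_integrable(1)[OF jet]])
  define Q where "Q = (\<chi> k l. kernel_mean N (A *v x) (F k l))"
  define D where "D = kernel_mean N (A *v x) (\<lambda>y. (f y)\<^sup>2)"
  have L: "eq_rhs lam (\<lambda>y. f (A *v y)) x M' = (1 / 2) *\<^sub>R (N' ** N') +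
      (1 / (2 * (c * D))) *\<^sub>R (c *\<^sub>R (transpose A ** Q ** A))"
  proof -
    have "(\<chi> i j. kernel_mean N' x (\<lambda>y. ?g i y * ?g j y - f (A *v y) * ?h i j y)) = c *\<^sub>R (transpose A ** Q ** A)"
      by (simp add: vec_eq_iff num matrix_triple_product_component Q_def)
    thus ?thesis unfolding eq_rhs_eq_jet_rhs[OF lam M' jet'] jet_rhs_def N'_def[symmetric] den D_def[symmetric] by simp
  qed
  have R: "eq_rhs lam f (A *v x) M = (1 / 2) *\<^sub>R (N ** N) + (1 / (2 * D)) *\<^sub>R Q"
    unfolding eq_rhs_eq_jet_rhs[OF lam M jet] jet_rhs_def N_def[symmetric] D_def Q_def F_def by simp
  have lin: "transpose A ** (a *\<^sub>R X + b *\<^sub>R Y) ** A = a *\<^sub>R (transpose A ** X ** A) + b *\<^sub>R (transpose A ** Y ** A)"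
    for a b and X Y :: "real^'d^'d"
    by (simp add: vec_eq_iff matrix_triple_product_component sum.distrib sum_distrib_left algebra_simps)
  show ?thesis unfolding L R lin NN using c(1) by simp
qed

section \<open>Limits\<close>

lemma matrix_vector_mult_tendsto:
  fixes A :: "nat \<Rightarrow> real^'n^'m::finite"
  assumes "A \<longlonglongrightarrow> L" "x \<longlonglongrightarrow> y"
  shows "(\<lambda>n. A n *v x n) \<longlonglongrightarrow> L *v y"
  by (rule vec_tendstoI) (simp add: matrix_vector_mult_def, intro tendsto_intros assms)

lemma matrix_mult_tendsto:
  fixes A :: "nat \<Rightarrow> real^'n^'m::finite" and B :: "nat \<Rightarrow> real^'k::finite^'n"
  assumes "A \<longlonglongrightarrow> L" "B \<longlonglongrightarrow> K"
  shows "(\<lambda>n. A n ** B n) \<longlonglongrightarrow> L ** K"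
  by (rule vec_tendstoI, rule vec_tendstoI) (simp add: matrix_matrix_mult_def, intro tendsto_intros assms)

lemma gauss_kernel_tendsto:
  assumes "N \<longlonglongrightarrow> L" "z \<longlonglongrightarrow> w"
  shows "(\<lambda>n. gauss_kernel (N n) (z n)) \<longlonglongrightarrow> gauss_kernel L w"
  unfolding gauss_kernel_def by (intro tendsto_intros matrix_vector_mult_tendsto assms)

text \<open>
  For \<open>N n\<close> close to \<open>L\<close>, \<open>|N n z|\<close> is at least half of the coercivity constant of \<open>L\<close> times \<open>|z|\<close>.
\<close>

lemma gauss_kernel_tendsto_0:
  fixes N :: "nat \<Rightarrow> real^'d^'d::finite"
  assumes N: "N \<longlonglongrightarrow> L" and L: "spd L" and z: "filterlim (\<lambda>n. norm (z n)) at_top sequentially"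
  shows "(\<lambda>n. gauss_kernel (N n) (z n)) \<longlonglongrightarrow> 0"
proof -
  obtain c where c: "c > 0" "\<And>v. c * (norm v)\<^sup>2 \<le> v \<bullet> (L *v v)" using spd_coercive[OF L] by blast
  have lower: "c * norm v \<le> norm (L *v v)" for v
  proof (cases "v = 0")
    case False
    have "c * (norm v)\<^sup>2 \<le> norm v * norm (L *v v)"
      using c(2)[of v] Cauchy_Schwarz_ineq2[of v "L *v v"] by linarith
    thus ?thesis using False by (simp add: power2_eq_square mult.left_commute[of c])
  qed simp
  have "(\<lambda>n. norm (N n - L)) \<longlonglongrightarrow> 0" using N by (simp add: LIM_zero_iff tendsto_norm_zero_iff)
  hence "eventually (\<lambda>n. norm (N n - L) < c / 2) sequentially"
    by (rule order_tendstoD) (use c in simp)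
  hence ev: "eventually (\<lambda>n. c / 2 * norm (z n) \<le> norm (N n *v z n)) sequentially"
  proof eventually_elim
    case (elim n)
    have "norm ((N n - L) *v z n) \<le> c / 2 * norm (z n)"
      using norm_matrix_vector_le[of "N n - L" "z n"] elim
      by (meson less_imp_le mult_right_mono norm_ge_zero order_trans)
    moreover have "norm (L *v z n) \<le> norm (N n *v z n) + norm ((N n - L) *v z n)"
      using norm_triangle_ineq4[of "N n *v z n" "(N n - L) *v z n"] by (simp add: matrix_vector_mult_diff_rdistrib)
    ultimately show ?case using lower[of "z n"] by argo
  qed
  have "filterlim (\<lambda>n. c / 2 * norm (z n)) at_top sequentially"
    by (rule filterlim_tendsto_pos_mult_at_top[OF tendsto_const _ z]) (use c in simp)
  hence inf: "filterlim (\<lambda>n. norm (N n *v z n)) at_top sequentially"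
    by (rule filterlim_at_top_mono[OF _ ev])
  have "filterlim (\<lambda>n. (norm (N n *v z n))\<^sup>2) at_top sequentially"
    by (rule filterlim_pow_at_top[OF _ inf]) simp
  hence "filterlim (\<lambda>n. - (norm (N n *v z n))\<^sup>2) at_bot sequentially"
    by (simp add: filterlim_uminus_at_top)
  from filterlim_compose[OF exp_at_bot this] show ?thesis by (simp add: gauss_kernel_def)
qed

lemma kernel_mean_tendsto:
  fixes N :: "nat \<Rightarrow> real^'d^'d::finite"
  assumes F: "integrable lebesgue F" and N: "N \<longlonglongrightarrow> L" and x: "x \<longlonglongrightarrow> x'"
  shows "(\<lambda>n. kernel_mean (N n) (x n) F) \<longlonglongrightarrow> kernel_mean L x' F"
  unfolding kernel_mean_def
proof (rule integral_dominated_convergence[where w = "\<lambda>y. norm (F y)"])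
  show "AE y in lebesgue. (\<lambda>n. F y * gauss_kernel (N n) (x n - y)) \<longlonglongrightarrow> F y * gauss_kernel L (x' - y)"
    by (intro AE_I2 tendsto_intros gauss_kernel_tendsto N x)
  show "AE y in lebesgue. norm (F y * gauss_kernel (N n) (x n - y)) \<le> norm (F y)" for n
    by (intro AE_I2) (simp add: abs_mult gauss_kernel_bounds less_imp_le mult_right_le_one_le)
qed (use F in \<open>auto intro: borel_measurable_integrable integrable_mult_gauss_kernel\<close>)

text \<open>
  The mass of \<open>u\<^sup>2\<close> escapes to infinity, so its integral \<open>a n\<close> against the window tends to zero. The second
  factor is merely bounded in mean square. Hence the product is split by
  \<open>|p q k| \<le> p\<^sup>2 k / d + d q\<^sup>2\<close>, valid for \<open>0 < k \<le> 1\<close> and \<open>d > 0\<close>, with a weight \<open>d\<close> that tends to zero while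
  \<open>a n / d\<close> does so too.
\<close>

lemma kernel_mean_escaping_tendsto_0:
  fixes N :: "nat \<Rightarrow> real^'d^'d::finite"
  assumes u: "square_integrable u" and v: "square_integrable v"
    and N: "N \<longlonglongrightarrow> L" and L: "spd L" and x: "x \<longlonglongrightarrow> x'"
    and c: "filterlim (\<lambda>n. norm (c n)) at_top sequentially"
  shows "(\<lambda>n. kernel_mean (N n) (x n) (\<lambda>y. u (y + c n) * v (y + e n))) \<longlonglongrightarrow> 0"
proof -
  define a where "a n = kernel_mean (N n) (x n + c n) (\<lambda>y. (u y)\<^sup>2)" for n
  define V where "V = (\<integral>y. (v y)\<^sup>2 \<partial>lebesgue)"
  have u2: "integrable lebesgue (\<lambda>y. (u y)\<^sup>2)" and v2: "integrable lebesgue (\<lambda>y. (v y)\<^sup>2)"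
    using u v by (auto simp: square_integrable_def)
  have a0: "a \<longlonglongrightarrow> 0"
  proof -
    have "(\<lambda>n. kernel_mean (N n) (x n + c n) (\<lambda>y. (u y)\<^sup>2)) \<longlonglongrightarrow> integral\<^sup>L lebesgue (\<lambda>y::real^'d. 0)"
      unfolding kernel_mean_def
    proof (rule integral_dominated_convergence[where w = "\<lambda>y. (u y)\<^sup>2"])
      show "AE y in lebesgue. (\<lambda>n. (u y)\<^sup>2 * gauss_kernel (N n) (x n + c n - y)) \<longlonglongrightarrow> 0"
      proof (intro AE_I2 tendsto_mult_right_zero gauss_kernel_tendsto_0[OF N L])
        fix y
        have "(\<lambda>n. - norm (x n - y)) \<longlonglongrightarrow> - norm (x' - y)" by (intro tendsto_intros x)
        from filterlim_tendsto_add_at_top[OF this c]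
        have "filterlim (\<lambda>n. - norm (x n - y) + norm (c n)) at_top sequentially" .
        thus "filterlim (\<lambda>n. norm (x n + c n - y)) at_top sequentially"
        proof (rule filterlim_at_top_mono)
          show "\<forall>\<^sub>F n in sequentially. - norm (x n - y) + norm (c n) \<le> norm (x n + c n - y)"
          proof (intro always_eventually allI)
            fix n
            have "norm (c n) \<le> norm (x n + c n - y) + norm (x n - y)"
              using norm_triangle_ineq4[of "x n + c n - y" "x n - y"] by simp
            thus "- norm (x n - y) + norm (c n) \<le> norm (x n + c n - y)" by simp
          qed
        qed
      qed
      show "AE y in lebesgue. norm ((u y)\<^sup>2 * gauss_kernel (N n) (x n + c n - y)) \<le> (u y)\<^sup>2" for n
        by (intro AE_I2) (simp add: abs_mult gauss_kernel_bounds less_imp_le mult_right_le_one_le)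
    qed (use u2 in \<open>auto intro: borel_measurable_integrable integrable_mult_gauss_kernel\<close>)
    thus ?thesis by (simp add: a_def[abs_def])
  qed
  have a_nonneg: "a n \<ge> 0" for n unfolding a_def kernel_mean_def
    by (intro integral_nonneg_AE AE_I2) (simp add: gauss_kernel_bounds less_imp_le)
  \<comment> \<open>About \<open>sqrt (a n)\<close>, which balances both terms; the second summand keeps \<open>d n\<close> positive if \<open>a n = 0\<close>.\<close>
  define d where "d n = sqrt (a n) + inverse (real (Suc n))" for n
  have d: "d n > 0" for n using a_nonneg[of n] by (simp add: d_def add_nonneg_pos)
  have bound: "norm (kernel_mean (N n) (x n) (\<lambda>y. u (y + c n) * v (y + e n))) \<le> sqrt (a n) + d n * V" for n
  proof -
    let ?k = "\<lambda>y. gauss_kernel (N n) (x n - y)"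
    have uc: "integrable lebesgue (\<lambda>y. (u (y + c n))\<^sup>2)"
      using lebesgue_integral_translate(2)[of "\<lambda>y. (u y)\<^sup>2" "c n"] u2 by simp
    have ve: "integrable lebesgue (\<lambda>y. (v (y + e n))\<^sup>2)"
      using lebesgue_integral_translate(2)[of "\<lambda>y. (v y)\<^sup>2" "e n"] v2 by simp
    have Vn: "(\<integral>y. (v (y + e n))\<^sup>2 \<partial>lebesgue) = V"
      unfolding V_def using lebesgue_integral_translate(1)[of "\<lambda>y. (v y)\<^sup>2" "e n"] v2 by simp
    have "norm (kernel_mean (N n) (x n) (\<lambda>y. u (y + c n) * v (y + e n)))
        \<le> (\<integral>y. (1 / d n) * ((u (y + c n))\<^sup>2 * ?k y) + d n * (v (y + e n))\<^sup>2 \<partial>lebesgue)"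
      unfolding kernel_mean_def
    proof (rule Bochner_Integration.integral_norm_bound_integral)
      have "square_integrable (\<lambda>y. u (y + c n))" "square_integrable (\<lambda>y. v (y + e n))"
        using square_integrable_affine[OF spd_invertible[OF spd_mat_1] u, of "c n"]
          square_integrable_affine[OF spd_invertible[OF spd_mat_1] v, of "e n"] by simp_all
      thus "integrable lebesgue (\<lambda>y. u (y + c n) * v (y + e n) * ?k y)"
        by (intro integrable_mult_gauss_kernel square_integrable_mult)
      show "integrable lebesgue (\<lambda>y. (1 / d n) * ((u (y + c n))\<^sup>2 * ?k y) + d n * (v (y + e n))\<^sup>2)"
        by (intro Bochner_Integration.integrable_add integrable_mult_right integrable_mult_gauss_kernel uc ve)
      fix y
      have am: "\<bar>p * q * k\<bar> \<le> (1 / d n) * (p\<^sup>2 * k) + d n * q\<^sup>2" if k: "0 < k" "k \<le> 1" for p q k :: real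
      proof -
        have "0 \<le> (\<bar>p\<bar> - d n * \<bar>q\<bar>)\<^sup>2" by simp
        hence "2 * d n * (\<bar>p\<bar> * \<bar>q\<bar>) \<le> p\<^sup>2 + (d n)\<^sup>2 * q\<^sup>2"
          by (simp add: power2_diff power_mult_distrib algebra_simps)
        moreover have "0 \<le> d n * (\<bar>p\<bar> * \<bar>q\<bar>)" using d[of n] by simp
        ultimately have "d n * (\<bar>p\<bar> * \<bar>q\<bar>) \<le> p\<^sup>2 + (d n)\<^sup>2 * q\<^sup>2" by linarith
        hence "\<bar>p\<bar> * \<bar>q\<bar> \<le> (p\<^sup>2 + (d n)\<^sup>2 * q\<^sup>2) / d n" using d[of n] by (simp add: pos_le_divide_eq mult.commute)
        also have "\<dots> = (1 / d n) * p\<^sup>2 + d n * q\<^sup>2" using d[of n] by (simp add: add_divide_distrib power2_eq_square)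
        finally have "\<bar>p\<bar> * \<bar>q\<bar> * k \<le> ((1 / d n) * p\<^sup>2 + d n * q\<^sup>2) * k" using k by (intro mult_right_mono) auto
        also have "\<dots> = (1 / d n) * (p\<^sup>2 * k) + d n * q\<^sup>2 * k" by (simp add: distrib_right mult.assoc)
        also have "d n * q\<^sup>2 * k \<le> d n * q\<^sup>2" using k d[of n] by (intro mult_right_le_one_le) auto
        finally show ?thesis using k by (simp add: abs_mult)
      qed
      show "norm (u (y + c n) * v (y + e n) * ?k y) \<le> (1 / d n) * ((u (y + c n))\<^sup>2 * ?k y) + d n * (v (y + e n))\<^sup>2"
        using am[OF gauss_kernel_bounds, of "u (y + c n)" "v (y + e n)"] by simp
    qed
    also have "\<dots> = (1 / d n) * kernel_mean (N n) (x n) (\<lambda>y. (u (y + c n))\<^sup>2) + d n * V"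
      unfolding kernel_mean_def
      by (subst Bochner_Integration.integral_add[OF
            integrable_mult_right[OF integrable_mult_gauss_kernel[OF uc]] integrable_mult_right[OF ve]])
         (simp only: integral_mult_right_zero Vn)
    also have "kernel_mean (N n) (x n) (\<lambda>y. (u (y + c n))\<^sup>2) = a n"
      unfolding a_def by (rule kernel_mean_translate[OF u2])
    also have "(1 / d n) * a n \<le> sqrt (a n)"
    proof -
      have "a n = sqrt (a n) * sqrt (a n)" using a_nonneg[of n] by simp
      also have "\<dots> \<le> sqrt (a n) * d n" using a_nonneg[of n] by (intro mult_left_mono) (auto simp: d_def)
      finally show ?thesis using d[of n] by (simp add: divide_le_eq)
    qed
    finally show ?thesis by simp
  qed
  have "(\<lambda>n. sqrt (a n) + d n * V) \<longlonglongrightarrow> sqrt 0 + (sqrt 0 + 0) * V"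
    unfolding d_def by (intro tendsto_intros a0 LIMSEQ_inverse_real_of_nat)
  hence lim: "(\<lambda>n. sqrt (a n) + d n * V) \<longlonglongrightarrow> 0" by simp
  show ?thesis by (rule Lim_null_comparison[OF _ lim]) (intro always_eventually allI bound)
qed

text \<open>
  Of the terms of the double sum only the one in which both factors stand still survives.
\<close>

lemma kernel_mean_sum_translates_tendsto:
  fixes N :: "nat \<Rightarrow> real^'d^'d::finite" and u v :: "'l \<Rightarrow> real^'d \<Rightarrow> real"
  assumes I: "finite I" "k \<in> I"
    and u: "\<And>l. l \<in> I \<Longrightarrow> square_integrable (u l)" and v: "\<And>l. l \<in> I \<Longrightarrow> square_integrable (v l)"
    and N: "N \<longlonglongrightarrow> L" and L: "spd L" and x: "x \<longlonglongrightarrow> x'"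
    and b0: "\<And>n. b n k = 0"
    and b: "\<And>l. l \<in> I \<Longrightarrow> l \<noteq> k \<Longrightarrow> filterlim (\<lambda>n. norm (b n l)) at_top sequentially"
  shows "(\<lambda>n. kernel_mean (N n) (x n) (\<lambda>y. (\<Sum>l\<in>I. u l (y + b n l)) * (\<Sum>j\<in>I. v j (y + b n j))))
    \<longlonglongrightarrow> kernel_mean L x' (\<lambda>y. u k y * v k y)"
proof -
  have sq: "square_integrable (\<lambda>y. w (y + c))" if "square_integrable w" for w :: "real^'d \<Rightarrow> real" and c
    using square_integrable_affine[OF spd_invertible[OF spd_mat_1] that, of c] by simp
  have int: "integrable lebesgue (\<lambda>y. u l (y + b n l) * v j (y + b n j))" if "l \<in> I" "j \<in> I" for l j n
    using that by (intro square_integrable_mult sq u v)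
  have expand: "kernel_mean (N n) (x n) (\<lambda>y. (\<Sum>l\<in>I. u l (y + b n l)) * (\<Sum>j\<in>I. v j (y + b n j)))
      = (\<Sum>l\<in>I. \<Sum>j\<in>I. kernel_mean (N n) (x n) (\<lambda>y. u l (y + b n l) * v j (y + b n j)))" for n
  proof -
    have "kernel_mean (N n) (x n) (\<lambda>y. \<Sum>l\<in>I. \<Sum>j\<in>I. u l (y + b n l) * v j (y + b n j))
      = (\<Sum>l\<in>I. kernel_mean (N n) (x n) (\<lambda>y. \<Sum>j\<in>I. u l (y + b n l) * v j (y + b n j)))"
      by (rule kernel_mean_sum[OF I(1)]) (intro Bochner_Integration.integrable_sum int)
    also have "\<dots> = (\<Sum>l\<in>I. \<Sum>j\<in>I. kernel_mean (N n) (x n) (\<lambda>y. u l (y + b n l) * v j (y + b n j)))"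
      by (intro sum.cong refl kernel_mean_sum[OF I(1)] int)
    finally show ?thesis by (simp add: sum_product)
  qed
  define T where "T l j = (if l = k \<and> j = k then kernel_mean L x' (\<lambda>y. u k y * v k y) else 0)" for l j
  have "(\<lambda>n. kernel_mean (N n) (x n) (\<lambda>y. u l (y + b n l) * v j (y + b n j))) \<longlonglongrightarrow> T l j"
    if l: "l \<in> I" and j: "j \<in> I" for l j
  proof -
    consider "l \<noteq> k" | "l = k" "j \<noteq> k" | "l = k" "j = k" by blast
    then show ?thesis
    proof cases
      case 1
      have "(\<lambda>n. kernel_mean (N n) (x n) (\<lambda>y. u l (y + b n l) * v j (y + b n j))) \<longlonglongrightarrow> 0"
        by (rule kernel_mean_escaping_tendsto_0[OF u[OF l] v[OF j] N L x b[OF l 1]])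
      thus ?thesis using 1 by (simp add: T_def)
    next
      case 2
      have "(\<lambda>n. kernel_mean (N n) (x n) (\<lambda>y. v j (y + b n j) * u l (y + b n l))) \<longlonglongrightarrow> 0"
        by (rule kernel_mean_escaping_tendsto_0[OF v[OF j] u[OF l] N L x b[OF j 2(2)]])
      thus ?thesis using 2 by (simp add: T_def mult.commute)
    next
      case 3
      have "integrable lebesgue (\<lambda>y. u k y * v k y)" using I by (intro square_integrable_mult u v)
      from kernel_mean_tendsto[OF this N x] show ?thesis using 3 by (simp add: T_def b0)
    qed
  qed
  hence "(\<lambda>n. \<Sum>l\<in>I. \<Sum>j\<in>I. kernel_mean (N n) (x n) (\<lambda>y. u l (y + b n l) * v j (y + b n j)))
      \<longlonglongrightarrow> (\<Sum>l\<in>I. \<Sum>j\<in>I. T l j)" by (intro tendsto_sum)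
  moreover have "(\<Sum>l\<in>I. \<Sum>j\<in>I. T l j) = kernel_mean L x' (\<lambda>y. u k y * v k y)"
  proof -
    have "(\<Sum>j\<in>I. T l j) = (if l = k then kernel_mean L x' (\<lambda>y. u k y * v k y) else 0)" for l
      using I by (cases "l = k") (simp_all add: T_def)
    thus ?thesis using I by simp
  qed
  ultimately show ?thesis by (simp add: expand)
qed

lemma kernel_mean_square_pos:
  assumes f: "square_integrable f" and nz: "\<not> (AE x in lebesgue. f x = 0)"
  shows "kernel_mean N x (\<lambda>y. (f y)\<^sup>2) > 0"
proof -
  have int: "integrable lebesgue (\<lambda>y. (f y)\<^sup>2 * gauss_kernel N (x - y))"
    using f by (intro integrable_mult_gauss_kernel) (simp add: square_integrable_def)
  have nonneg: "AE y in lebesgue. 0 \<le> (f y)\<^sup>2 * gauss_kernel N (x - y)"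
    by (intro AE_I2) (simp add: gauss_kernel_bounds less_imp_le)
  have "kernel_mean N x (\<lambda>y. (f y)\<^sup>2) \<noteq> 0"
  proof
    assume "kernel_mean N x (\<lambda>y. (f y)\<^sup>2) = 0"
    hence "AE y in lebesgue. (f y)\<^sup>2 * gauss_kernel N (x - y) = 0"
      using integral_nonneg_eq_0_iff_AE[OF int nonneg] by (simp add: kernel_mean_def)
    moreover have "gauss_kernel N (x - y) \<noteq> 0" for y using gauss_kernel_bounds(1)[of N "x - y"] by simp
    ultimately have "AE y in lebesgue. f y = 0" by simp
    with nz show False by contradiction
  qed
  moreover have "kernel_mean N x (\<lambda>y. (f y)\<^sup>2) \<ge> 0"
    unfolding kernel_mean_def by (rule integral_nonneg_AE[OF nonneg])
  ultimately show ?thesis by simp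
qed

text \<open>
  With a single summand this is the joint continuity of the right-hand side in the point and the
  matrix; with several summands that drift apart it is the convergence behind the last axiom. The
  limit of the denominator is nonzero because \<open>f k\<close> is.
\<close>

theorem eq_rhs_sum_translates_tendsto:
  fixes M :: "nat \<Rightarrow> real^'d^'d::finite" and f :: "'l \<Rightarrow> real^'d \<Rightarrow> real"
  assumes lam: "0 < lam" and I: "finite I" "k \<in> I"
    and jet: "\<And>l. l \<in> I \<Longrightarrow> weak_jet (f l) (g l) (h l)"
    and nz: "\<not> (AE x in lebesgue. f k x = 0)"
    and M: "\<And>n. spd (M n)" "M \<longlonglongrightarrow> M'" "spd M'" and x: "x \<longlonglongrightarrow> x'"
    and b0: "\<And>n. b n k = 0"
    and b: "\<And>l. l \<in> I \<Longrightarrow> l \<noteq> k \<Longrightarrow> filterlim (\<lambda>n. norm (b n l)) at_top sequentially"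
  shows "(\<lambda>n. eq_rhs lam (\<lambda>y. \<Sum>l\<in>I. f l (y + b n l)) (x n) (M n)) \<longlonglongrightarrow> eq_rhs lam (f k) x' M'"
proof -
  define N where "N n = lam *\<^sub>R M n" for n
  define L where "L = lam *\<^sub>R M'"
  have L: "spd L" unfolding L_def by (rule spd_scaleR[OF M(3) lam])
  have N: "N \<longlonglongrightarrow> L" unfolding N_def L_def by (intro tendsto_intros M)
  note D = weak_jetD[OF jet]
  note lim = kernel_mean_sum_translates_tendsto[where b = b and k = k and I = I, OF I _ _ N L x b0 b]
  have jet': "weak_jet (\<lambda>y. \<Sum>l\<in>I. f l (y + b n l)) (\<lambda>i y. \<Sum>l\<in>I. g l i (y + b n l))
      (\<lambda>i j y. \<Sum>l\<in>I. h l i j (y + b n l))" for n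
    by (rule weak_jet_sum[OF I(1)]) (rule weak_jet_translate[OF jet])
  have den: "(\<lambda>n. kernel_mean (N n) (x n) (\<lambda>y. (\<Sum>l\<in>I. f l (y + b n l))\<^sup>2)) \<longlonglongrightarrow> kernel_mean L x' (\<lambda>y. (f k y)\<^sup>2)"
    unfolding power2_eq_square by (rule lim) (auto intro: D(1))
  have pos: "kernel_mean L x' (\<lambda>y. (f k y)\<^sup>2) > 0"
    by (rule kernel_mean_square_pos[OF D(1)[OF I(2)] nz])
  have diff: "kernel_mean K z (\<lambda>y. p y - q y) = kernel_mean K z p - kernel_mean K z q"
    if "integrable lebesgue p" "integrable lebesgue q" for K z p q
    unfolding kernel_mean_def left_diff_distrib
    by (rule Bochner_Integration.integral_diff; rule integrable_mult_gauss_kernel[OF that(1)] integrable_mult_gauss_kernel[OF that(2)])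
  have num: "(\<lambda>n. kernel_mean (N n) (x n) (\<lambda>y. (\<Sum>l\<in>I. g l i (y + b n l)) * (\<Sum>l\<in>I. g l j (y + b n l))
        - (\<Sum>l\<in>I. f l (y + b n l)) * (\<Sum>l\<in>I. h l i j (y + b n l))))
      \<longlonglongrightarrow> kernel_mean L x' (\<lambda>y. g k i y * g k j y - f k y * h k i j y)" for i j
  proof -
    have gg: "(\<lambda>n. kernel_mean (N n) (x n) (\<lambda>y. (\<Sum>l\<in>I. g l i (y + b n l)) * (\<Sum>l\<in>I. g l j (y + b n l))))
      \<longlonglongrightarrow> kernel_mean L x' (\<lambda>y. g k i y * g k j y)"
      by (rule lim) (auto intro: D(2))
    have fh: "(\<lambda>n. kernel_mean (N n) (x n) (\<lambda>y. (\<Sum>l\<in>I. f l (y + b n l)) * (\<Sum>l\<in>I. h l i j (y + b n l))))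
      \<longlonglongrightarrow> kernel_mean L x' (\<lambda>y. f k y * h k i j y)"
      by (rule lim) (auto intro: D)
    have "kernel_mean L x' (\<lambda>y. g k i y * g k j y - f k y * h k i j y)
        = kernel_mean L x' (\<lambda>y. g k i y * g k j y) - kernel_mean L x' (\<lambda>y. f k y * h k i j y)"
      by (rule diff; rule square_integrable_mult; rule D[OF I(2)])
    moreover have "kernel_mean (N n) (x n) (\<lambda>y. (\<Sum>l\<in>I. g l i (y + b n l)) * (\<Sum>l\<in>I. g l j (y + b n l))
          - (\<Sum>l\<in>I. f l (y + b n l)) * (\<Sum>l\<in>I. h l i j (y + b n l)))
        = kernel_mean (N n) (x n) (\<lambda>y. (\<Sum>l\<in>I. g l i (y + b n l)) * (\<Sum>l\<in>I. g l j (y + b n l)))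
          - kernel_mean (N n) (x n) (\<lambda>y. (\<Sum>l\<in>I. f l (y + b n l)) * (\<Sum>l\<in>I. h l i j (y + b n l)))" for n
      by (rule diff; rule square_integrable_mult; rule weak_jetD[OF jet'])
    ultimately show ?thesis using tendsto_diff[OF gg fh] by simp
  qed
  have "(\<lambda>n. jet_rhs lam (\<lambda>y. \<Sum>l\<in>I. f l (y + b n l)) (\<lambda>i y. \<Sum>l\<in>I. g l i (y + b n l))
      (\<lambda>i j y. \<Sum>l\<in>I. h l i j (y + b n l)) (x n) (M n)) \<longlonglongrightarrow> jet_rhs lam (f k) (g k) (h k) x' M'"
    unfolding jet_rhs_def N_def[symmetric] L_def[symmetric]
  proof (intro tendsto_intros matrix_mult_tendsto N den num)
    show "2 * kernel_mean L x' (\<lambda>y. (f k y)\<^sup>2) \<noteq> 0" using pos by simp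
  qed
  thus ?thesis
    by (simp only: eq_rhs_eq_jet_rhs[OF lam M(1) jet'] eq_rhs_eq_jet_rhs[OF lam M(3) jet[OF I(2)]])
qed


section \<open>Stability of globally attracting fixed points\<close>

text \<open>
  Suppose that \<open>p t\<close> lies outside a compact ball \<open>B\<close> around \<open>m\<close> for arbitrarily large \<open>t\<close>. The orbit of \<open>m\<close> under
  \<open>\<Phi> t\<close> converges to \<open>p t\<close>, so it is in \<open>B\<close> only finitely often; let \<open>y\<close> be its last point in \<open>B\<close>. A limit \<open>y'\<close> of such
  points has an orbit under \<open>\<Psi>\<close> that converges to \<open>m\<close>, so \<open>\<Psi>\<^sup>j y'\<close> is in the interior of \<open>B\<close> for some \<open>j \<ge> 1\<close>. By
  continuity the same holds for \<open>\<Phi>\<^sup>j y\<close> with \<open>t\<close> large, contrary to the choice of \<open>y\<close>. Pointwise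
  convergence of the orbits thus takes the place of a contraction estimate.
\<close>

theorem attracting_points_of_perturbations_converge:
  fixes \<Phi> :: "real \<Rightarrow> 'a::metric_space \<Rightarrow> 'a"
  assumes maps: "\<And>t y. 0 \<le> t \<Longrightarrow> y \<in> P \<Longrightarrow> \<Phi> t y \<in> P" "\<And>y. y \<in> P \<Longrightarrow> \<Psi> y \<in> P"
    and cont: "\<And>s y y'. filterlim s at_top sequentially \<Longrightarrow> (\<And>n. 0 \<le> s n) \<Longrightarrow> (\<And>n. y n \<in> P) \<Longrightarrow>
      y \<longlonglongrightarrow> y' \<Longrightarrow> y' \<in> P \<Longrightarrow> (\<lambda>n. \<Phi> (s n) (y n)) \<longlonglongrightarrow> \<Psi> y'"
    and attract: "\<And>y. y \<in> P \<Longrightarrow> (\<lambda>n. (\<Psi> ^^ n) y) \<longlonglongrightarrow> m"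
      "\<And>t y. 0 \<le> t \<Longrightarrow> y \<in> P \<Longrightarrow> (\<lambda>n. (\<Phi> t ^^ n) y) \<longlonglongrightarrow> p t"
    and m: "m \<in> P" and e: "e > 0" "\<And>r. r \<le> e \<Longrightarrow> compact {y \<in> cball m r. y \<in> P}"
  shows "(p \<longlongrightarrow> m) at_top"
proof (rule ccontr)
  assume "\<not> (p \<longlongrightarrow> m) at_top"
  then obtain d where d: "d > 0" "\<not> eventually (\<lambda>t. dist (p t) m < d) at_top"
    unfolding tendsto_iff by blast
  define r where "r = min e (d / 2)"
  have r: "0 < r" "r \<le> e" "r < d" using d e by (auto simp: r_def)
  define B where "B = {y \<in> cball m r. y \<in> P}"
  have "\<exists>t\<ge>real n. \<not> dist (p t) m < d" for n
    using d(2) unfolding eventually_at_top_linorder by blast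
  then obtain s where s: "\<And>n. real n \<le> s n" "\<And>n. \<not> dist (p (s n)) m < d" by metis
  have s0: "0 \<le> s n" for n using s(1)[of n] of_nat_0_le_iff order_trans by blast
  have s_inf: "filterlim s at_top sequentially"
    by (rule filterlim_at_top_mono[OF filterlim_real_sequentially]) (simp add: s(1))
  have orbit: "(\<Phi> (s n) ^^ j) y \<in> P" if "y \<in> P" for n j y
    by (induction j) (use that maps s0 in auto)
  \<comment> \<open>The last point in \<open>B\<close> of the orbit of \<open>m\<close>.\<close>
  have "\<exists>y\<in>B. \<forall>j\<ge>1. (\<Phi> (s n) ^^ j) y \<notin> B" for n
  proof -
    define J where "J = {j. (\<Phi> (s n) ^^ j) m \<in> B}"
    have "p (s n) \<in> - cball m r" using s(2)[of n] r by (simp add: dist_commute)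
    moreover have "open (- cball m r)" by auto
    ultimately have "eventually (\<lambda>j. (\<Phi> (s n) ^^ j) m \<in> - cball m r) sequentially"
      using attract(2)[OF s0 m, of n] topological_tendstoD by blast
    then obtain j0 where "\<And>j. j \<ge> j0 \<Longrightarrow> (\<Phi> (s n) ^^ j) m \<in> - cball m r"
      unfolding eventually_sequentially by blast
    hence "j < j0" if "j \<in> J" for j using that unfolding J_def B_def by (force simp: not_less[symmetric])
    hence "J \<subseteq> {..<j0}" by blast
    hence fin: "finite J" by (rule finite_subset) simp
    have "0 \<in> J" using m r by (simp add: J_def B_def)
    hence last: "Max J \<in> J" using fin by (intro Max_in) auto
    show ?thesis
    proof (intro bexI[of _ "(\<Phi> (s n) ^^ Max J) m"] allI impI)
      show "(\<Phi> (s n) ^^ Max J) m \<in> B" using last by (simp add: J_def)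
      fix j :: nat assume "j \<ge> 1"
      hence "j + Max J \<notin> J" using Max_ge[OF fin, of "j + Max J"] by auto
      thus "(\<Phi> (s n) ^^ j) ((\<Phi> (s n) ^^ Max J) m) \<notin> B" by (simp add: J_def funpow_add)
    qed
  qed
  then obtain y where y: "\<And>n. y n \<in> B" "\<And>n j. 1 \<le> j \<Longrightarrow> (\<Phi> (s n) ^^ j) (y n) \<notin> B" by metis
  have "compact B" unfolding B_def by (rule e(2)[OF r(2)])
  then obtain y' \<rho> where y': "y' \<in> B" and \<rho>: "strict_mono \<rho>" and lim: "(y \<circ> \<rho>) \<longlonglongrightarrow> y'"
    using y(1) unfolding compact_def by blast
  have BP: "z \<in> P" if "z \<in> B" for z using that by (simp add: B_def)
  define \<sigma> where "\<sigma> n = s (\<rho> n)" for n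
  have \<sigma>: "filterlim \<sigma> at_top sequentially" "0 \<le> \<sigma> n" for n
    using filterlim_compose[OF s_inf filterlim_subseq[OF \<rho>]] s0 by (auto simp: \<sigma>_def[abs_def])
  have iter: "(\<lambda>n. (\<Phi> (\<sigma> n) ^^ j) (y (\<rho> n))) \<longlonglongrightarrow> (\<Psi> ^^ j) y' \<and> (\<Psi> ^^ j) y' \<in> P" for j
  proof (induction j)
    case 0
    show ?case using lim BP[OF y'] by (simp add: o_def)
  next
    case (Suc j)
    have "(\<lambda>n. \<Phi> (\<sigma> n) ((\<Phi> (\<sigma> n) ^^ j) (y (\<rho> n)))) \<longlonglongrightarrow> \<Psi> ((\<Psi> ^^ j) y')"
      by (rule cont[OF \<sigma>]) (use Suc orbit[OF BP[OF y(1)]] in \<open>auto simp: \<sigma>_def\<close>)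
    thus ?case using Suc maps(2) by simp
  qed
  have "eventually (\<lambda>j. (\<Psi> ^^ j) y' \<in> ball m r) sequentially"
    using attract(1)[OF BP[OF y']] r(1) by (intro topological_tendstoD) auto
  then obtain j0 where j0: "\<And>j. j \<ge> j0 \<Longrightarrow> (\<Psi> ^^ j) y' \<in> ball m r" unfolding eventually_sequentially by blast
  define j where "j = Suc j0"
  have "eventually (\<lambda>n. (\<Phi> (\<sigma> n) ^^ j) (y (\<rho> n)) \<in> ball m r) sequentially"
    using iter[of j] j0[of j] by (intro topological_tendstoD) (auto simp: j_def)
  then obtain n where "(\<Phi> (\<sigma> n) ^^ j) (y (\<rho> n)) \<in> ball m r" unfolding eventually_sequentially by blast
  hence "(\<Phi> (\<sigma> n) ^^ j) (y (\<rho> n)) \<in> B"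
    using orbit[where n = "\<rho> n" and j = j, OF BP[OF y(1)[of "\<rho> n"]]] by (simp add: B_def \<sigma>_def)
  thus False using y(2)[of j "\<rho> n"] by (simp add: \<sigma>_def j_def)
qed

section \<open>The adaptation axioms\<close>

definition fp_step where "fp_step lam f x M = spd_sqrt (eq_rhs lam f x M)"

lemma fp_iter_const: "fp_iter lam f (\<lambda>_. M) n x = (fp_step lam f x ^^ n) M"
  by (induction n) (simp_all add: fp_step_def)

lemma admissible_weak_jet: "f \<in> admissible lam \<Longrightarrow> \<exists>g h. weak_jet f g h"
  by (rule W2_imp_weak_jet) (simp add: admissible_def)

lemma admissible_nonzero: "f \<in> admissible lam \<Longrightarrow> \<not> (AE x in lebesgue. f x = 0)"
  by (simp add: admissible_def)

lemma admissible_solution_unique: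
  "f \<in> admissible lam \<Longrightarrow> solves lam f m \<Longrightarrow> solves lam f m' \<Longrightarrow> m = m'"
  unfolding admissible_def by blast

lemma admissible_iteration:
  assumes f: "f \<in> admissible lam" and m: "solves lam f m" and M: "spd M"
  shows "spd (eq_rhs lam f x M)" "spd (fp_step lam f x M)"
    "(\<lambda>n. (fp_step lam f x ^^ n) M) \<longlonglongrightarrow> m x"
proof -
  have conv: "iteration_converges lam f m" using f m unfolding admissible_def by blast
  have "(\<forall>n x. spd (eq_rhs lam f x (fp_iter lam f (\<lambda>_. M) n x))) \<and> (\<forall>x. (\<lambda>n. fp_iter lam f (\<lambda>_. M) n x) \<longlonglongrightarrow> m x)"
    by (rule conv[unfolded iteration_converges_def, THEN spec, of "\<lambda>_. M", THEN mp]) (simp add: M)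
  hence *: "spd (eq_rhs lam f x (fp_iter lam f (\<lambda>_. M) n x))" "(\<lambda>n. fp_iter lam f (\<lambda>_. M) n x) \<longlonglongrightarrow> m x" for n x
    by simp_all
  show s: "spd (eq_rhs lam f x M)" using *(1)[of x 0] by simp
  show "spd (fp_step lam f x M)" unfolding fp_step_def by (rule spd_sqrt(1)[OF s])
  show "(\<lambda>n. (fp_step lam f x ^^ n) M) \<longlonglongrightarrow> m x" using *(2)[of x] by (simp add: fp_iter_const)
qed

lemma admissible_orbit_spd:
  assumes "f \<in> admissible lam" "solves lam f m" "spd M"
  shows "spd ((fp_step lam f x ^^ n) M)"
  by (induction n) (use assms admissible_iteration(2)[OF assms(1,2)] in auto)

text \<open>
  The iterates that start at the identity matrix are continuous in \<open>x\<close>, and \<open>m\<close> is their pointwise limit.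
\<close>

lemma solution_borel_measurable:
  fixes f :: "real^'d::finite \<Rightarrow> real"
  assumes lam: "0 < lam" and f: "f \<in> admissible lam" and m: "solves lam f m"
  shows "m \<in> borel_measurable borel"
proof (rule borel_measurable_LIMSEQ_metric)
  obtain g h where jet: "weak_jet f g h" using admissible_weak_jet[OF f] by blast
  have "continuous_on UNIV (\<lambda>x. (fp_step lam f x ^^ n) (mat 1))" for n
  proof (induction n)
    case (Suc n)
    show ?case
      unfolding continuous_on_sequentially o_def
    proof (intro allI ballI impI, elim conjE)
      fix x :: "nat \<Rightarrow> real^'d" and x' assume x: "x \<longlonglongrightarrow> x'"
      let ?M = "\<lambda>x. (fp_step lam f x ^^ n) (mat 1)"
      have spd: "spd (?M z)" for z by (rule admissible_orbit_spd[OF f m spd_mat_1])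
      have "(\<lambda>i. ?M (x i)) \<longlonglongrightarrow> ?M x'"
        using Suc x unfolding continuous_on_sequentially by (auto simp: o_def)
      \<comment> \<open>A sum of translates with one summand that stands still.\<close>
      hence "(\<lambda>i. eq_rhs lam (\<lambda>y. \<Sum>l\<in>{()}. f (y + 0)) (x i) (?M (x i))) \<longlonglongrightarrow> eq_rhs lam f x' (?M x')"
        by (intro eq_rhs_sum_translates_tendsto[where f = "\<lambda>_. f" and g = "\<lambda>_. g" and h = "\<lambda>_. h" and k = "()" and b = "\<lambda>_ _. 0"])
           (use lam jet admissible_nonzero[OF f] spd x in auto)
      hence "(\<lambda>i. eq_rhs lam f (x i) (?M (x i))) \<longlonglongrightarrow> eq_rhs lam f x' (?M x')" by simp
      hence "(\<lambda>i. spd_sqrt (eq_rhs lam f (x i) (?M (x i)))) \<longlonglongrightarrow> spd_sqrt (eq_rhs lam f x' (?M x'))"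
        by (intro spd_sqrt_tendsto admissible_iteration(1)[OF f m] spd)
      thus "(\<lambda>i. (fp_step lam f (x i) ^^ Suc n) (mat 1)) \<longlonglongrightarrow> (fp_step lam f x' ^^ Suc n) (mat 1)"
        by (simp add: fp_step_def)
    qed
  qed simp
  thus "(\<lambda>x. (fp_step lam f x ^^ n) (mat 1)) \<in> borel_measurable borel" for n
    by (rule borel_measurable_continuous_onI)
  show "(\<lambda>n. (fp_step lam f x ^^ n) (mat 1)) \<longlonglongrightarrow> m x" for x
    by (rule admissible_iteration(3)[OF f m spd_mat_1])
qed

lemma solvesD: "solves lam f m \<Longrightarrow> spd (m x)" "solves lam f m \<Longrightarrow> m x ** m x = eq_rhs lam f x (m x)"
  by (auto simp: solves_def)

lemma solution_translate:
  assumes lam: "0 < lam" and f: "f \<in> admissible lam" and m: "solves lam f m"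
  shows "solves lam (\<lambda>y. f (y - a)) (\<lambda>x. m (x - a))"
proof -
  obtain g h where jet: "weak_jet f g h" using admissible_weak_jet[OF f] by blast
  show ?thesis unfolding solves_def
    using solvesD[OF m] eq_rhs_translate[OF lam solvesD(1)[OF m] jet, of "- a"] by simp
qed

lemma solution_scale:
  assumes lam: "0 < lam" and f: "f \<in> admissible lam" and m: "solves lam f m" and c: "c \<noteq> 0"
  shows "solves lam (\<lambda>y. c * f y) m"
proof -
  obtain g h where jet: "weak_jet f g h" using admissible_weak_jet[OF f] by blast
  show ?thesis unfolding solves_def
    using solvesD[OF m] eq_rhs_scale[OF lam solvesD(1)[OF m] jet c] by simp
qed

lemma solution_linear:
  fixes A :: "real^'d^'d::finite"
  assumes lam: "0 < lam" and f: "f \<in> admissible lam" and m: "solves lam f m" and A: "invertible A"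
  shows "solves lam (\<lambda>y. f (A *v y)) (\<lambda>x. spd_sqrt (transpose A ** (m (A *v x) ** m (A *v x)) ** A))"
  unfolding solves_def
proof (intro allI conjI)
  fix x
  obtain g h where jet: "weak_jet f g h" using admissible_weak_jet[OF f] by blast
  let ?M = "m (A *v x)" and ?S = "transpose A ** (m (A *v x) ** m (A *v x)) ** A"
  have M: "spd ?M" by (rule solvesD(1)[OF m])
  have S: "spd ?S" by (rule spd_congruence[OF spd_square[OF M] A])
  show "spd (spd_sqrt ?S)" by (rule spd_sqrt(1)[OF S])
  have "eq_rhs lam (\<lambda>y. f (A *v y)) x (spd_sqrt ?S) = transpose A ** eq_rhs lam f (A *v x) ?M ** A"
    by (rule eq_rhs_linear[OF lam M spd_sqrt(1)[OF S] A jet spd_sqrt(2)[OF S]])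
  also have "\<dots> = spd_sqrt ?S ** spd_sqrt ?S"
    by (simp only: solvesD(2)[OF m, symmetric] spd_sqrt(2)[OF S])
  finally show "spd_sqrt ?S ** spd_sqrt ?S = eq_rhs lam (\<lambda>y. f (A *v y)) x (spd_sqrt ?S)" by (rule sym)
qed

text \<open>
  At the point \<open>x + a k t\<close> the equation of the sum is the equation at \<open>x\<close> of the sum translated by \<open>a k t\<close>, in
  which \<open>f k\<close> does not move and every other summand \<open>f l\<close> is translated by \<open>a k t - a l t\<close>.
\<close>

lemma solution_of_separating_sum_tendsto:
  fixes f :: "'l \<Rightarrow> real^'d::finite \<Rightarrow> real" and a :: "'l \<Rightarrow> real \<Rightarrow> real^'d"
  assumes lam: "0 < lam" and I: "finite I" "k \<in> I"
    and f: "\<And>l. l \<in> I \<Longrightarrow> f l \<in> admissible lam"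
    and F: "\<And>t. 0 \<le> t \<Longrightarrow> (\<lambda>y. \<Sum>l\<in>I. f l (y - a l t)) \<in> admissible lam"
    and m: "solves lam (f k) m" "\<And>t. 0 \<le> t \<Longrightarrow> solves lam (\<lambda>y. \<Sum>l\<in>I. f l (y - a l t)) (p t)"
    and sep: "\<And>l. l \<in> I \<Longrightarrow> l \<noteq> k \<Longrightarrow> filterlim (\<lambda>t. norm (a k t - a l t)) at_top at_top"
  shows "((\<lambda>t. p t (x + a k t)) \<longlongrightarrow> m x) at_top"
proof -
  define Ft where "Ft t y = (\<Sum>l\<in>I. f l (y - a l t))" for t y
  have F': "Ft t \<in> admissible lam" "solves lam (Ft t) (p t)" if "0 \<le> t" for t
    using F[OF that] m(2)[OF that] unfolding Ft_def[abs_def] by blast+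
  have "\<forall>l\<in>I. \<exists>g h. weak_jet (f l) g h" using f admissible_weak_jet by blast
  then obtain g h where jet: "\<And>l. l \<in> I \<Longrightarrow> weak_jet (f l) (g l) (h l)" by metis
  have mx: "spd (m x)" by (rule solvesD(1)[OF m(1)])
  obtain e where e: "e > 0" "\<And>r. r \<le> e \<Longrightarrow> compact {X \<in> cball (m x) r. spd X}"
    using spd_compact_neighbourhood[OF mx] by blast
  show ?thesis
  proof (rule attracting_points_of_perturbations_converge[where P = "{M. spd M}" and e = e
        and \<Phi> = "\<lambda>t. fp_step lam (Ft t) (x + a k t)" and \<Psi> = "fp_step lam (f k) x"])
    show "fp_step lam (Ft t) (x + a k t) M \<in> {M. spd M}" if "0 \<le> t" "M \<in> {M. spd M}" for t M
      using admissible_iteration(2)[OF F'[OF that(1)]] that(2) by simp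
    show "fp_step lam (f k) x M \<in> {M. spd M}" if "M \<in> {M. spd M}" for M
      using admissible_iteration(2)[OF f[OF I(2)] m(1)] that by simp
    show "(\<lambda>n. (fp_step lam (f k) x ^^ n) M) \<longlonglongrightarrow> m x" if "M \<in> {M. spd M}" for M
      using admissible_iteration(3)[OF f[OF I(2)] m(1)] that by simp
    show "(\<lambda>n. (fp_step lam (Ft t) (x + a k t) ^^ n) M) \<longlonglongrightarrow> p t (x + a k t)"
      if "0 \<le> t" "M \<in> {M. spd M}" for t M
      using admissible_iteration(3)[OF F'[OF that(1)]] that(2) by simp
    show "m x \<in> {M. spd M}" using mx by simp
    show "0 < e" by (rule e(1))
    show "compact {X \<in> cball (m x) r. X \<in> {M. spd M}}" if "r \<le> e" for r using e(2)[OF that] by simp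
    fix s and M :: "nat \<Rightarrow> real^'d^'d" and M'
    assume s: "filterlim s at_top sequentially" "\<And>n. (0::real) \<le> s n" and M: "\<And>n. M n \<in> {M. spd M}"
      "M \<longlonglongrightarrow> M'" "M' \<in> {M. spd M}"
    define b where "b n l = a k (s n) - a l (s n)" for n l
    have "(\<lambda>n. eq_rhs lam (\<lambda>y. \<Sum>l\<in>I. f l (y + b n l)) x (M n)) \<longlonglongrightarrow> eq_rhs lam (f k) x M'"
    proof (rule eq_rhs_sum_translates_tendsto[where f = f and g = g and h = h, OF lam I jet admissible_nonzero[OF f[OF I(2)]]])
      show "filterlim (\<lambda>n. norm (b n l)) at_top sequentially" if "l \<in> I" "l \<noteq> k" for l
        unfolding b_def by (rule filterlim_compose[OF sep[OF that] s(1)])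
    qed (use M in \<open>auto simp: b_def\<close>)
    moreover have "eq_rhs lam (\<lambda>y. \<Sum>l\<in>I. f l (y + b n l)) x (M n) = eq_rhs lam (Ft (s n)) (x + a k (s n)) (M n)" for n
    proof -
      obtain G H where "weak_jet (Ft (s n)) G H" using admissible_weak_jet[OF F'(1)[OF s(2)]] by blast
      from eq_rhs_translate[OF lam _ this, of "M n" "a k (s n)" x] M(1)[of n]
      show ?thesis by (simp add: Ft_def[abs_def] b_def add_diff_eq)
    qed
    ultimately have "(\<lambda>n. eq_rhs lam (Ft (s n)) (x + a k (s n)) (M n)) \<longlonglongrightarrow> eq_rhs lam (f k) x M'" by simp
    thus "(\<lambda>n. fp_step lam (Ft (s n)) (x + a k (s n)) (M n)) \<longlonglongrightarrow> fp_step lam (f k) x M'"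
      unfolding fp_step_def
    proof (rule spd_sqrt_tendsto[rotated 2])
      show "spd (eq_rhs lam (Ft (s n)) (x + a k (s n)) (M n))" for n
        using admissible_iteration(1)[OF F'[OF s(2)]] M(1) by simp
      show "spd (eq_rhs lam (f k) x M')"
        using admissible_iteration(1)[OF f[OF I(2)] m(1)] M(3) by simp
    qed
  qed
qed

theorem theorem24:
  fixes lam :: real
    and \<mu> :: "(real^'d::finite \<Rightarrow> real) \<Rightarrow> real^'d \<Rightarrow> real^'d^'d"
  assumes "0 < lam" and "lam < sqrt 2"
    and "\<And>f. f \<in> admissible lam \<Longrightarrow> solves lam f (\<mu> f)"
  shows "adaptation_axioms (admissible lam) \<mu>"
proof -
  note lam = assms(1) and sol = assms(3)
  have "\<forall>f\<in>admissible lam. \<mu> f \<in> borel_measurable borel \<and> (\<forall>x. invertible (\<mu> f x))"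
    using solution_borel_measurable[OF lam _ sol] spd_invertible solvesD(1)[OF sol] by blast
  moreover have "axiom_A1 (admissible lam) \<mu>"
    unfolding axiom_A1_def
  proof (intro allI impI, elim conjE)
    fix f :: "real^'d \<Rightarrow> real" and a x
    assume f: "f \<in> admissible lam" and fa: "(\<lambda>y. f (y - a)) \<in> admissible lam"
    have "\<mu> (\<lambda>y. f (y - a)) = (\<lambda>x. \<mu> f (x - a))"
      by (rule admissible_solution_unique[OF fa sol[OF fa] solution_translate[OF lam f sol[OF f]]])
    thus "\<mu> (\<lambda>y. f (y - a)) x = \<mu> f (x - a)" by simp
  qed
  moreover have "axiom_A2 (admissible lam) \<mu>"
    unfolding axiom_A2_def
  proof (intro allI impI, elim conjE)
    fix f :: "real^'d \<Rightarrow> real" and c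
    assume f: "f \<in> admissible lam" and c: "c \<noteq> 0" and fc: "(\<lambda>y. c * f y) \<in> admissible lam"
    show "\<mu> (\<lambda>y. c * f y) = \<mu> f"
      by (rule admissible_solution_unique[OF fc sol[OF fc] solution_scale[OF lam f sol[OF f] c]])
  qed
  moreover have "axiom_A3 (admissible lam) \<mu>"
    unfolding axiom_A3_def
  proof (intro allI impI, elim conjE)
    fix f :: "real^'d \<Rightarrow> real" and A :: "real^'d^'d" and x
    assume f: "f \<in> admissible lam" and A: "invertible A" and fA: "(\<lambda>y. f (A *v y)) \<in> admissible lam"
    let ?S = "transpose A ** (\<mu> f (A *v x) ** \<mu> f (A *v x)) ** A"
    have M: "spd (\<mu> f (A *v x))" by (rule solvesD(1)[OF sol[OF f]])
    have S: "spd ?S" by (rule spd_congruence[OF spd_square[OF M] A])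
    have "\<mu> (\<lambda>y. f (A *v y)) = (\<lambda>x. spd_sqrt (transpose A ** (\<mu> f (A *v x) ** \<mu> f (A *v x)) ** A))"
      by (rule admissible_solution_unique[OF fA sol[OF fA] solution_linear[OF lam f sol[OF f] A]])
    hence "\<mu> (\<lambda>y. f (A *v y)) x = spd_sqrt ?S" by simp
    moreover have "transpose (spd_sqrt ?S) = spd_sqrt ?S" "transpose (\<mu> f (A *v x)) = \<mu> f (A *v x)"
      using spd_sqrt(1)[OF S] M unfolding spd_def by blast+
    moreover note spd_sqrt(2)[OF S]
    ultimately show "transpose (\<mu> (\<lambda>y. f (A *v y)) x) ** \<mu> (\<lambda>y. f (A *v y)) x
        = transpose A ** transpose (\<mu> f (A *v x)) ** \<mu> f (A *v x) ** A"
      by (simp only: matrix_mul_assoc)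
  qed
  moreover have "axiom_A4 (admissible lam) \<mu>"
    unfolding axiom_A4_def
  proof (intro allI impI ballI, elim conjE)
    fix K :: nat and f :: "nat \<Rightarrow> real^'d \<Rightarrow> real" and a :: "nat \<Rightarrow> real \<Rightarrow> real^'d" and x :: "real^'d" and k
    assume k: "k \<in> {1..K}" and f: "\<forall>k\<in>{1..K}. f k \<in> admissible lam"
      and F: "\<forall>t\<ge>0. (\<lambda>y. \<Sum>k=1..K. f k (y - a k t)) \<in> admissible lam"
      and sep: "\<forall>k\<in>{1..K}. \<forall>j\<in>{1..K}. k \<noteq> j \<longrightarrow> filterlim (\<lambda>t. norm (a k t - a j t)) at_top at_top"
    show "((\<lambda>t. \<mu> (\<lambda>y. \<Sum>l=1..K. f l (y - a l t)) (x + a k t)) \<longlongrightarrow> \<mu> (f k) x) at_top"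
    proof (rule solution_of_separating_sum_tendsto[OF lam _ k])
      show "finite {1..K}" by simp
      show "f l \<in> admissible lam" if "l \<in> {1..K}" for l using f that by blast
      show "(\<lambda>y. \<Sum>l=1..K. f l (y - a l t)) \<in> admissible lam" if "0 \<le> t" for t using F that by blast
      thus "solves lam (\<lambda>y. \<Sum>l=1..K. f l (y - a l t)) (\<mu> (\<lambda>y. \<Sum>l=1..K. f l (y - a l t)))" if "0 \<le> t" for t
        using that by (intro sol)
      show "solves lam (f k) (\<mu> (f k))" using f k by (intro sol) blast
      show "filterlim (\<lambda>t. norm (a k t - a l t)) at_top at_top" if "l \<in> {1..K}" "l \<noteq> k" for l
        by (rule sep[rule_format, OF k that(1) that(2)[symmetric]])
    qed
  qed
  ultimately show ?thesis unfolding adaptation_axioms_def by blast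
qed

end
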